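(* Let $R$ be a unital commutative associative ring with $2\in R^\times$. Consider all quadruples $(S,P,h,\alpha)$ where $S$ is a quadratic étale $R$-algebra with canonical involution $\overline{\phantom{x}}$, $(P,h)$ is a nondegenerate $\overline{\phantom{x}}$-hermitian space of rank three over $S$ with trivial determinant, and $\alpha:\bigwedge^3(P,h)\to\langle1\rangle$ is an isomorphism. The maps $W(S,P,h,\alpha)\mapsto{\rm Cay}(S,P,h,\alpha)$ and $W(S,P,h,\alpha)\mapsto{\rm Col}(S,P,h,\alpha)$ induce bijections between the following sets: (i) the set of isomorphism classes of pairs $({\rm Cay}(S,P,h,\alpha),S)$ of octonion algebras over $R$ with subalgebra $S$; (ii) the set of isomorphism classes of colour algebras ${\rm Col}(S,P,h,\alpha)$ over $R$; (iii) the set of isomorphism classes of vector algebras $W(S,P,h,\alpha)$ over $R$.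
   Context: A nondegenerate hermitian space $(P,h)$ of rank three over $S$ is a finitely generated projective $S$-module $P$ of constant rank three with a biadditive map $h:P\times P\to S$ that is $S$-linear in the first and conjugate-linear in the second variable, satisfies $h(w,w')=\overline{h(w',w)}$, and is such that $w\mapsto h(\cdot,w)$ is a conjugate-linear bijection $P\to{\rm Hom}_S(P,S)$. $\bigwedge^3(P,h)$ is $\bigwedge^3_S P$ with the hermitian form determined by $(u_1\wedge u_2\wedge u_3,v_1\wedge v_2\wedge v_3)\mapsto\det(h(u_i,v_j))$; $\langle1\rangle$ is $S$ with the form $(a,b)\mapsto a\bar b$. The space has trivial determinant if there is an isomorphism of hermitian spaces $\alpha:\bigwedge^3(P,h)\to\langle1\rangle$. Given $\alpha$, the cross product $\times_\alpha:P\times P\to P$ is defined by $h(u,v\times_\alpha w)=\alpha(u\wedge v\wedge w)$ for all $u,v,w\in P$. The associated $R$-algebras are: - $W(S,P,h,\alpha)=(P,\times_\alpha)$ (vector algebra); - ${\rm Col}(S,P,h,\alpha)=R\oplus P$ with $(a,u)(b,v)=(ab-\frac12(h(u,v)+\overline{h(u,v)}),\,va+ub+u\times_\alpha v)$ for $a,b\in R$, $u,v\in P$ (colour algebra); - ${\rm Cay}(S,P,h,\alpha)=S\oplus P$ with $(a,u)(b,v)=(ab-h(u,v),\,va+u\bar b+u\times_\alpha v)$ for $a,b\in S$, $u,v\in P$ (octonion algebra), containing $S=S\oplus0$ as a subalgebra. Isomorphisms in (ii) and (iii) are $R$-algebra isomorphisms; an isomorphism of pairs $(A,S)\to(A',S')$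 in (i) is an $R$-algebra isomorphism $A\to A'$ mapping $S$ onto $S'$. *)

theory Defs
  imports "HOL-Algebra.Module" "HOL-Algebra.Ideal" "HOL-Library.FuncSet"
begin

section \<open>Modules\<close>

definition Hom_mod ::
  "('a, 'm) ring_scheme \<Rightarrow> ('a, 'b, 'k) module_scheme \<Rightarrow> ('a, 'c, 'l) module_scheme \<Rightarrow> ('b \<Rightarrow> 'c) set"
  where "Hom_mod A M N =
    {f \<in> carrier M \<rightarrow>\<^sub>E carrier N.
       (\<forall>x\<in>carrier M. \<forall>y\<in>carrier M. f (x \<oplus>\<^bsub>M\<^esub> y) = f x \<oplus>\<^bsub>N\<^esub> f y) \<and>
       (\<forall>a\<in>carrier A. \<forall>x\<in>carrier M. f (a \<odot>\<^bsub>M\<^esub> x) = a \<odot>\<^bsub>N\<^esub> f x)}"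

text \<open>The record type of modules contains the fields of a ring. Where an object below is only a
  module, its fields \<open>mult\<close> and \<open>one\<close> are irrelevant and left \<open>undefined\<close>.\<close>

definition regular_module :: "('a, 'm) ring_scheme \<Rightarrow> ('a, 'a) module"
  where "regular_module A =
    \<lparr>carrier = carrier A, mult = undefined, one = undefined,
     zero = \<zero>\<^bsub>A\<^esub>, add = (\<oplus>\<^bsub>A\<^esub>), smult = (\<otimes>\<^bsub>A\<^esub>)\<rparr>"

definition free_module :: "('a, 'm) ring_scheme \<Rightarrow> 'x set \<Rightarrow> ('a, 'x \<Rightarrow> 'a) module"
  where "free_module A X =
    \<lparr>carrier = {f. (\<forall>x\<in>X. f x \<in> carrier A) \<and> (\<forall>x. x \<notin> X \<longrightarrow> f x = \<zero>\<^bsub>A\<^esub>) \<and>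
                   finite {x. f x \<noteq> \<zero>\<^bsub>A\<^esub>}},
     mult = undefined, one = undefined,
     zero = (\<lambda>x. \<zero>\<^bsub>A\<^esub>), add = (\<lambda>f g x. f x \<oplus>\<^bsub>A\<^esub> g x), smult = (\<lambda>a f x. a \<otimes>\<^bsub>A\<^esub> f x)\<rparr>"

definition free_gen :: "('a, 'm) ring_scheme \<Rightarrow> 'x \<Rightarrow> 'x \<Rightarrow> 'a"
  where "free_gen A x = (\<lambda>y. if y = x then \<one>\<^bsub>A\<^esub> else \<zero>\<^bsub>A\<^esub>)"

definition submodule_gen ::
  "('a, 'm) ring_scheme \<Rightarrow> ('a, 'b, 'k) module_scheme \<Rightarrow> 'b set \<Rightarrow> 'b set"
  where "submodule_gen A M X = \<Inter>{H. submodule H A M \<and> X \<subseteq> H}"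

definition quotient_module :: "('a, 'b, 'k) module_scheme \<Rightarrow> 'b set \<Rightarrow> ('a, 'b set) module"
  where "quotient_module M N =
    \<lparr>carrier = a_rcosets\<^bsub>M\<^esub> N, mult = undefined, one = undefined,
     zero = N, add = set_add M, smult = (\<lambda>a X. \<Union>x\<in>X. N +>\<^bsub>M\<^esub> (a \<odot>\<^bsub>M\<^esub> x))\<rparr>"

text \<open>A finitely generated projective module is a direct summand of some \<open>A\<^sup>n\<close>.\<close>

definition fg_projective :: "('a, 'm) ring_scheme \<Rightarrow> ('a, 'b, 'k) module_scheme \<Rightarrow> bool"
  where "fg_projective A M \<longleftrightarrow> module A M \<and>
    (\<exists>n::nat. \<exists>i \<in> Hom_mod A M (free_module A {..<n}). \<exists>p \<in> Hom_mod A (free_module A {..<n}) M.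
       \<forall>x\<in>carrier M. p (i x) = x)"

text \<open>The localisation \<open>M\<^sub>\<pp>\<close> is free of rank \<open>n\<close> over \<open>A\<^sub>\<pp>\<close>. Since denominators are units of \<open>A\<^sub>\<pp>\<close>, a basis
  may be taken of the form \<open>b\<^sub>0/1, \<dots>, b\<^sub>n\<^sub>-\<^sub>1/1\<close>. The two conditions say that these elements span
  \<open>M\<^sub>\<pp>\<close> and are linearly independent, written out with the description of fractions: an element
  \<open>x/s\<close> is zero iff some \<open>t \<notin> \<pp>\<close> kills \<open>x\<close>.\<close>

definition free_at_prime ::
  "('a, 'm) ring_scheme \<Rightarrow> ('a, 'b, 'k) module_scheme \<Rightarrow> 'a set \<Rightarrow> nat \<Rightarrow> bool"
  where "free_at_prime A M \<pp> n \<longleftrightarrow>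
    (\<exists>b \<in> {..<n} \<rightarrow> carrier M.
       (\<forall>x\<in>carrier M. \<exists>s \<in> carrier A - \<pp>. \<exists>c \<in> {..<n} \<rightarrow> carrier A.
          s \<odot>\<^bsub>M\<^esub> x = (\<Oplus>\<^bsub>M\<^esub>i\<in>{..<n}. c i \<odot>\<^bsub>M\<^esub> b i)) \<and>
       (\<forall>c \<in> {..<n} \<rightarrow> carrier A.
          (\<exists>t \<in> carrier A - \<pp>. t \<odot>\<^bsub>M\<^esub> (\<Oplus>\<^bsub>M\<^esub>i\<in>{..<n}. c i \<odot>\<^bsub>M\<^esub> b i) = \<zero>\<^bsub>M\<^esub>) \<longrightarrow>
          (\<forall>i<n. \<exists>t \<in> carrier A - \<pp>. t \<otimes>\<^bsub>A\<^esub> c i = \<zero>\<^bsub>A\<^esub>)))"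

definition constant_rank :: "('a, 'm) ring_scheme \<Rightarrow> ('a, 'b, 'k) module_scheme \<Rightarrow> nat \<Rightarrow> bool"
  where "constant_rank A M n \<longleftrightarrow> (\<forall>\<pp>. primeideal \<pp> A \<longrightarrow> free_at_prime A M \<pp> n)"


section \<open>Quadratic \'etale algebras\<close>

definition tensor_relations ::
  "('a, 'm) ring_scheme \<Rightarrow> ('a, 'b, 'k) module_scheme \<Rightarrow> ('a, 'c, 'l) module_scheme
     \<Rightarrow> ('b \<times> 'c \<Rightarrow> 'a) set"
  where "tensor_relations A M N =
    (let F = free_module A (carrier M \<times> carrier N); g = free_gen A in
      {g (x \<oplus>\<^bsub>M\<^esub> x', y) \<ominus>\<^bsub>F\<^esub> (g (x, y) \<oplus>\<^bsub>F\<^esub> g (x', y)) | x x' y.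
          x \<in> carrier M \<and> x' \<in> carrier M \<and> y \<in> carrier N} \<union>
      {g (x, y \<oplus>\<^bsub>N\<^esub> y') \<ominus>\<^bsub>F\<^esub> (g (x, y) \<oplus>\<^bsub>F\<^esub> g (x, y')) | x y y'.
          x \<in> carrier M \<and> y \<in> carrier N \<and> y' \<in> carrier N} \<union>
      {g (a \<odot>\<^bsub>M\<^esub> x, y) \<ominus>\<^bsub>F\<^esub> a \<odot>\<^bsub>F\<^esub> g (x, y) | a x y.
          a \<in> carrier A \<and> x \<in> carrier M \<and> y \<in> carrier N} \<union>
      {g (x, a \<odot>\<^bsub>N\<^esub> y) \<ominus>\<^bsub>F\<^esub> a \<odot>\<^bsub>F\<^esub> g (x, y) | a x y.
          a \<in> carrier A \<and> x \<in> carrier M \<and> y \<in> carrier N})"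

definition tensor_kernel ::
  "('a, 'm) ring_scheme \<Rightarrow> ('a, 'b, 'k) module_scheme \<Rightarrow> ('a, 'c, 'l) module_scheme
     \<Rightarrow> ('b \<times> 'c \<Rightarrow> 'a) set"
  where "tensor_kernel A M N =
    submodule_gen A (free_module A (carrier M \<times> carrier N)) (tensor_relations A M N)"

definition tensor_module ::
  "('a, 'm) ring_scheme \<Rightarrow> ('a, 'b, 'k) module_scheme \<Rightarrow> ('a, 'c, 'l) module_scheme
     \<Rightarrow> ('a, ('b \<times> 'c \<Rightarrow> 'a) set) module"
  where "tensor_module A M N =
    quotient_module (free_module A (carrier M \<times> carrier N)) (tensor_kernel A M N)"

definition tensor ::
  "('a, 'm) ring_scheme \<Rightarrow> ('a, 'b, 'k) module_scheme \<Rightarrow> ('a, 'c, 'l) module_scheme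
     \<Rightarrow> 'b \<Rightarrow> 'c \<Rightarrow> ('b \<times> 'c \<Rightarrow> 'a) set"
  where "tensor A M N x y =
    tensor_kernel A M N +>\<^bsub>free_module A (carrier M \<times> carrier N)\<^esub> free_gen A (x, y)"

text \<open>A commutative algebra \<open>S\<close> is separable over \<open>R\<close> if \<open>S \<otimes>\<^sub>R S\<close> contains a separability idempotent
  \<open>e = \<Sum> a\<^sub>i \<otimes> b\<^sub>i\<close>, that is \<open>\<Sum> a\<^sub>i b\<^sub>i = 1\<close> and \<open>(s \<otimes> 1) e = (1 \<otimes> s) e\<close> for all \<open>s\<close>. A finitely
  generated projective commutative algebra is \'etale iff it is separable.\<close>

definition separable_algebra :: "('r, 'm) ring_scheme \<Rightarrow> ('r, 's, 'k) module_scheme \<Rightarrow> bool"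
  where "separable_algebra R S \<longleftrightarrow>
    (\<exists>n::nat. \<exists>a \<in> {..<n} \<rightarrow> carrier S. \<exists>b \<in> {..<n} \<rightarrow> carrier S.
       (\<Oplus>\<^bsub>S\<^esub>i\<in>{..<n}. a i \<otimes>\<^bsub>S\<^esub> b i) = \<one>\<^bsub>S\<^esub> \<and>
       (\<forall>s\<in>carrier S.
          (\<Oplus>\<^bsub>tensor_module R S S\<^esub>i\<in>{..<n}. tensor R S S (s \<otimes>\<^bsub>S\<^esub> a i) (b i)) =
          (\<Oplus>\<^bsub>tensor_module R S S\<^esub>i\<in>{..<n}. tensor R S S (a i) (s \<otimes>\<^bsub>S\<^esub> b i))))"

text \<open>Quadratic \'etale algebras carry their canonical involution as an extra record field. It is the
  unique \<open>R\<close>-linear multiplicative involution with \<open>x + \<sigma>(x) \<in> R1\<close> and \<open>x \<sigma>(x) \<in> R1\<close> for all \<open>x\<close>.\<close>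

record ('r, 's) invol_algebra = "('r, 's) module" +
  invol :: "'s \<Rightarrow> 's"

definition scalars :: "('r, 'm) ring_scheme \<Rightarrow> ('r, 's, 'k) module_scheme \<Rightarrow> 's set"
  where "scalars R S = (\<lambda>r. r \<odot>\<^bsub>S\<^esub> \<one>\<^bsub>S\<^esub>) ` carrier R"

definition canonical_involution ::
  "('r, 'm) ring_scheme \<Rightarrow> ('r, 's, 'k) module_scheme \<Rightarrow> ('s \<Rightarrow> 's) \<Rightarrow> bool"
  where "canonical_involution R S \<sigma> \<longleftrightarrow>
    (\<forall>x\<in>carrier S. \<sigma> x \<in> carrier S \<and> \<sigma> (\<sigma> x) = x \<and>
       x \<oplus>\<^bsub>S\<^esub> \<sigma> x \<in> scalars R S \<and> x \<otimes>\<^bsub>S\<^esub> \<sigma> x \<in> scalars R S) \<and>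
    (\<forall>x\<in>carrier S. \<forall>y\<in>carrier S.
       \<sigma> (x \<oplus>\<^bsub>S\<^esub> y) = \<sigma> x \<oplus>\<^bsub>S\<^esub> \<sigma> y \<and> \<sigma> (x \<otimes>\<^bsub>S\<^esub> y) = \<sigma> x \<otimes>\<^bsub>S\<^esub> \<sigma> y) \<and>
    \<sigma> \<one>\<^bsub>S\<^esub> = \<one>\<^bsub>S\<^esub> \<and>
    (\<forall>r\<in>carrier R. \<forall>x\<in>carrier S. \<sigma> (r \<odot>\<^bsub>S\<^esub> x) = r \<odot>\<^bsub>S\<^esub> \<sigma> x)"

definition quadratic_etale :: "('r, 'm) ring_scheme \<Rightarrow> ('r, 's, 'k) invol_algebra_scheme \<Rightarrow> bool"
  where "quadratic_etale R S \<longleftrightarrow>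
    algebra R S \<and> fg_projective R S \<and> constant_rank R S 2 \<and> separable_algebra R S \<and>
    canonical_involution R S (invol S)"


section \<open>Hermitian spaces\<close>

definition hermitian_form ::
  "('r, 's, 'k) invol_algebra_scheme \<Rightarrow> ('s, 'p, 'l) module_scheme \<Rightarrow> ('p \<Rightarrow> 'p \<Rightarrow> 's) \<Rightarrow> bool"
  where "hermitian_form S P h \<longleftrightarrow>
    (\<forall>u\<in>carrier P. \<forall>v\<in>carrier P. h u v \<in> carrier S \<and> h u v = invol S (h v u)) \<and>
    (\<forall>u\<in>carrier P. \<forall>v\<in>carrier P. \<forall>w\<in>carrier P.
       h (u \<oplus>\<^bsub>P\<^esub> v) w = h u w \<oplus>\<^bsub>S\<^esub> h v w \<and> h u (v \<oplus>\<^bsub>P\<^esub> w) = h u v \<oplus>\<^bsub>S\<^esub> h u w) \<and>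
    (\<forall>a\<in>carrier S. \<forall>u\<in>carrier P. \<forall>v\<in>carrier P.
       h (a \<odot>\<^bsub>P\<^esub> u) v = a \<otimes>\<^bsub>S\<^esub> h u v \<and> h u (a \<odot>\<^bsub>P\<^esub> v) = invol S a \<otimes>\<^bsub>S\<^esub> h u v)"

definition nondegenerate ::
  "('r, 's, 'k) invol_algebra_scheme \<Rightarrow> ('s, 'p, 'l) module_scheme \<Rightarrow> ('p \<Rightarrow> 'p \<Rightarrow> 's) \<Rightarrow> bool"
  where "nondegenerate S P h \<longleftrightarrow>
    bij_betw (\<lambda>w. \<lambda>u\<in>carrier P. h u w) (carrier P) (Hom_mod S P (regular_module S))"

definition hermitian_iso ::
  "('r, 's, 'k) invol_algebra_scheme
     \<Rightarrow> ('s, 'p, 'l) module_scheme \<Rightarrow> ('p \<Rightarrow> 'p \<Rightarrow> 's)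
     \<Rightarrow> ('s, 'q, 'n) module_scheme \<Rightarrow> ('q \<Rightarrow> 'q \<Rightarrow> 's) \<Rightarrow> ('p \<Rightarrow> 'q) set"
  where "hermitian_iso S P h Q k =
    {f \<in> Hom_mod S P Q. bij_betw f (carrier P) (carrier Q) \<and>
       (\<forall>u\<in>carrier P. \<forall>v\<in>carrier P. k (f u) (f v) = h u v)}"

definition unit_form :: "('r, 's, 'k) invol_algebra_scheme \<Rightarrow> 's \<Rightarrow> 's \<Rightarrow> 's"
  where "unit_form S a b = a \<otimes>\<^bsub>S\<^esub> invol S b"


section \<open>The third exterior power\<close>

definition wedge_relations ::
  "('s, 'm) ring_scheme \<Rightarrow> ('s, 'p, 'l) module_scheme \<Rightarrow> ('p \<times> 'p \<times> 'p \<Rightarrow> 's) set"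
  where "wedge_relations S P =
    (let F = free_module S (carrier P \<times> carrier P \<times> carrier P); g = free_gen S in
      {g (u \<oplus>\<^bsub>P\<^esub> u', v, w) \<ominus>\<^bsub>F\<^esub> (g (u, v, w) \<oplus>\<^bsub>F\<^esub> g (u', v, w)) | u u' v w.
          u \<in> carrier P \<and> u' \<in> carrier P \<and> v \<in> carrier P \<and> w \<in> carrier P} \<union>
      {g (u, v \<oplus>\<^bsub>P\<^esub> v', w) \<ominus>\<^bsub>F\<^esub> (g (u, v, w) \<oplus>\<^bsub>F\<^esub> g (u, v', w)) | u v v' w.
          u \<in> carrier P \<and> v \<in> carrier P \<and> v' \<in> carrier P \<and> w \<in> carrier P} \<union>
      {g (u, v, w \<oplus>\<^bsub>P\<^esub> w') \<ominus>\<^bsub>F\<^esub> (g (u, v, w) \<oplus>\<^bsub>F\<^esub> g (u, v, w')) | u v w w'.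
          u \<in> carrier P \<and> v \<in> carrier P \<and> w \<in> carrier P \<and> w' \<in> carrier P} \<union>
      {g (a \<odot>\<^bsub>P\<^esub> u, v, w) \<ominus>\<^bsub>F\<^esub> a \<odot>\<^bsub>F\<^esub> g (u, v, w) | a u v w.
          a \<in> carrier S \<and> u \<in> carrier P \<and> v \<in> carrier P \<and> w \<in> carrier P} \<union>
      {g (u, a \<odot>\<^bsub>P\<^esub> v, w) \<ominus>\<^bsub>F\<^esub> a \<odot>\<^bsub>F\<^esub> g (u, v, w) | a u v w.
          a \<in> carrier S \<and> u \<in> carrier P \<and> v \<in> carrier P \<and> w \<in> carrier P} \<union>
      {g (u, v, a \<odot>\<^bsub>P\<^esub> w) \<ominus>\<^bsub>F\<^esub> a \<odot>\<^bsub>F\<^esub> g (u, v, w) | a u v w.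
          a \<in> carrier S \<and> u \<in> carrier P \<and> v \<in> carrier P \<and> w \<in> carrier P} \<union>
      {g (u, u, w) | u w. u \<in> carrier P \<and> w \<in> carrier P} \<union>
      {g (u, v, u) | u v. u \<in> carrier P \<and> v \<in> carrier P} \<union>
      {g (u, v, v) | u v. u \<in> carrier P \<and> v \<in> carrier P})"

definition wedge_kernel ::
  "('s, 'm) ring_scheme \<Rightarrow> ('s, 'p, 'l) module_scheme \<Rightarrow> ('p \<times> 'p \<times> 'p \<Rightarrow> 's) set"
  where "wedge_kernel S P =
    submodule_gen S (free_module S (carrier P \<times> carrier P \<times> carrier P)) (wedge_relations S P)"

definition exterior_cube ::
  "('s, 'm) ring_scheme \<Rightarrow> ('s, 'p, 'l) module_scheme
     \<Rightarrow> ('s, ('p \<times> 'p \<times> 'p \<Rightarrow> 's) set) module"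
  where "exterior_cube S P =
    quotient_module (free_module S (carrier P \<times> carrier P \<times> carrier P)) (wedge_kernel S P)"

definition wedge ::
  "('s, 'm) ring_scheme \<Rightarrow> ('s, 'p, 'l) module_scheme \<Rightarrow> 'p \<Rightarrow> 'p \<Rightarrow> 'p
     \<Rightarrow> ('p \<times> 'p \<times> 'p \<Rightarrow> 's) set"
  where "wedge S P u v w =
    wedge_kernel S P +>\<^bsub>free_module S (carrier P \<times> carrier P \<times> carrier P)\<^esub> free_gen S (u, v, w)"

definition gram_det ::
  "('s, 'm) ring_scheme \<Rightarrow> ('p \<Rightarrow> 'p \<Rightarrow> 's) \<Rightarrow> 'p \<times> 'p \<times> 'p \<Rightarrow> 'p \<times> 'p \<times> 'p \<Rightarrow> 's"
  where "gram_det S h = (\<lambda>(u1, u2, u3) (v1, v2, v3).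
     h u1 v1 \<otimes>\<^bsub>S\<^esub> (h u2 v2 \<otimes>\<^bsub>S\<^esub> h u3 v3 \<ominus>\<^bsub>S\<^esub> h u2 v3 \<otimes>\<^bsub>S\<^esub> h u3 v2)
     \<ominus>\<^bsub>S\<^esub> h u1 v2 \<otimes>\<^bsub>S\<^esub> (h u2 v1 \<otimes>\<^bsub>S\<^esub> h u3 v3 \<ominus>\<^bsub>S\<^esub> h u2 v3 \<otimes>\<^bsub>S\<^esub> h u3 v1)
     \<oplus>\<^bsub>S\<^esub> h u1 v3 \<otimes>\<^bsub>S\<^esub> (h u2 v1 \<otimes>\<^bsub>S\<^esub> h u3 v2 \<ominus>\<^bsub>S\<^esub> h u2 v2 \<otimes>\<^bsub>S\<^esub> h u3 v1))"

text \<open>The form on \<open>\<And>\<^sup>3 P\<close> determined by \<open>(u\<^sub>1 \<and> u\<^sub>2 \<and> u\<^sub>3, v\<^sub>1 \<and> v\<^sub>2 \<and> v\<^sub>3) \<mapsto> det (h u\<^sub>i v\<^sub>j)\<close>: the sesquilinear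
  extension of this rule to the free module is independent of the representatives of the cosets.\<close>

definition wedge_form ::
  "('r, 's, 'k) invol_algebra_scheme \<Rightarrow> ('p \<Rightarrow> 'p \<Rightarrow> 's)
     \<Rightarrow> ('p \<times> 'p \<times> 'p \<Rightarrow> 's) set \<Rightarrow> ('p \<times> 'p \<times> 'p \<Rightarrow> 's) set \<Rightarrow> 's"
  where "wedge_form S h X Y =
    (THE c. \<forall>f\<in>X. \<forall>g\<in>Y.
       c = (\<Oplus>\<^bsub>S\<^esub>x\<in>{x. f x \<noteq> \<zero>\<^bsub>S\<^esub>}. \<Oplus>\<^bsub>S\<^esub>y\<in>{y. g y \<noteq> \<zero>\<^bsub>S\<^esub>}.
              f x \<otimes>\<^bsub>S\<^esub> invol S (g y) \<otimes>\<^bsub>S\<^esub> gram_det S h x y))"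


section \<open>The quadruples and the associated algebras\<close>

type_synonym ('r, 's, 'p) quadruple =
  "('r, 's) invol_algebra \<times> ('s, 'p) module \<times> ('p \<Rightarrow> 'p \<Rightarrow> 's) \<times>
   (('p \<times> 'p \<times> 'p \<Rightarrow> 's) set \<Rightarrow> 's)"

definition hermitian_space ::
  "('r, 's, 'k) invol_algebra_scheme \<Rightarrow> ('s, 'p, 'l) module_scheme \<Rightarrow> ('p \<Rightarrow> 'p \<Rightarrow> 's) \<Rightarrow> bool"
  where "hermitian_space S P h \<longleftrightarrow>
    fg_projective S P \<and> constant_rank S P 3 \<and> hermitian_form S P h \<and> nondegenerate S P h"

definition det_trivialisations ::
  "('r, 's, 'k) invol_algebra_scheme \<Rightarrow> ('s, 'p, 'l) module_scheme \<Rightarrow> ('p \<Rightarrow> 'p \<Rightarrow> 's)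
     \<Rightarrow> (('p \<times> 'p \<times> 'p \<Rightarrow> 's) set \<Rightarrow> 's) set"
  where "det_trivialisations S P h =
    hermitian_iso S (exterior_cube S P) (wedge_form S h) (regular_module S) (unit_form S)"

definition quadruples :: "('r, 'm) ring_scheme \<Rightarrow> ('r, 's, 'p) quadruple set"
  where "quadruples R =
    {(S, P, h, \<alpha>). quadratic_etale R S \<and> hermitian_space S P h \<and> \<alpha> \<in> det_trivialisations S P h}"

definition cross ::
  "('s, 'm) ring_scheme \<Rightarrow> ('s, 'p, 'l) module_scheme \<Rightarrow> ('p \<Rightarrow> 'p \<Rightarrow> 's)
     \<Rightarrow> (('p \<times> 'p \<times> 'p \<Rightarrow> 's) set \<Rightarrow> 's) \<Rightarrow> 'p \<Rightarrow> 'p \<Rightarrow> 'p"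
  where "cross S P h \<alpha> v w =
    (THE z. z \<in> carrier P \<and> (\<forall>u\<in>carrier P. h u z = \<alpha> (wedge S P u v w)))"

definition restrict_smult ::
  "('r, 's, 'k) module_scheme \<Rightarrow> ('s, 'p, 'l) module_scheme \<Rightarrow> 'r \<Rightarrow> 'p \<Rightarrow> 'p"
  where "restrict_smult S P r u = (r \<odot>\<^bsub>S\<^esub> \<one>\<^bsub>S\<^esub>) \<odot>\<^bsub>P\<^esub> u"

definition half :: "('r, 'm) ring_scheme \<Rightarrow> 'r"
  where "half R = inv\<^bsub>R\<^esub> (\<one>\<^bsub>R\<^esub> \<oplus>\<^bsub>R\<^esub> \<one>\<^bsub>R\<^esub>)"

text \<open>The element of \<open>R\<close> that corresponds to \<open>x \<in> R1 \<subseteq> S\<close>.\<close>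

definition scalar_part :: "('r, 'm) ring_scheme \<Rightarrow> ('r, 's, 'k) module_scheme \<Rightarrow> 's \<Rightarrow> 'r"
  where "scalar_part R S x = (THE r. r \<in> carrier R \<and> r \<odot>\<^bsub>S\<^esub> \<one>\<^bsub>S\<^esub> = x)"

text \<open>Nonassociative \<open>R\<close>-algebras are represented by module records with a bilinear \<open>mult\<close>. The vector
  algebra has no unit element, and its field \<open>one\<close> carries no information.\<close>

fun vector_algebra :: "('r, 'm) ring_scheme \<Rightarrow> ('r, 's, 'p) quadruple \<Rightarrow> ('r, 'p) module"
  where "vector_algebra R (S, P, h, \<alpha>) =
    \<lparr>carrier = carrier P, mult = cross S P h \<alpha>, one = undefined,
     zero = \<zero>\<^bsub>P\<^esub>, add = (\<oplus>\<^bsub>P\<^esub>), smult = restrict_smult S P\<rparr>"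

fun colour_algebra :: "('r, 'm) ring_scheme \<Rightarrow> ('r, 's, 'p) quadruple \<Rightarrow> ('r, 'r \<times> 'p) module"
  where "colour_algebra R (S, P, h, \<alpha>) =
    \<lparr>carrier = carrier R \<times> carrier P,
     mult = (\<lambda>(a, u) (b, v).
       (a \<otimes>\<^bsub>R\<^esub> b \<ominus>\<^bsub>R\<^esub> half R \<otimes>\<^bsub>R\<^esub> scalar_part R S (h u v \<oplus>\<^bsub>S\<^esub> invol S (h u v)),
        restrict_smult S P a v \<oplus>\<^bsub>P\<^esub> restrict_smult S P b u \<oplus>\<^bsub>P\<^esub> cross S P h \<alpha> u v)),
     one = (\<one>\<^bsub>R\<^esub>, \<zero>\<^bsub>P\<^esub>), zero = (\<zero>\<^bsub>R\<^esub>, \<zero>\<^bsub>P\<^esub>),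
     add = (\<lambda>(a, u) (b, v). (a \<oplus>\<^bsub>R\<^esub> b, u \<oplus>\<^bsub>P\<^esub> v)),
     smult = (\<lambda>r (a, u). (r \<otimes>\<^bsub>R\<^esub> a, restrict_smult S P r u))\<rparr>"

fun octonion_algebra :: "('r, 'm) ring_scheme \<Rightarrow> ('r, 's, 'p) quadruple \<Rightarrow> ('r, 's \<times> 'p) module"
  where "octonion_algebra R (S, P, h, \<alpha>) =
    \<lparr>carrier = carrier S \<times> carrier P,
     mult = (\<lambda>(a, u) (b, v).
       (a \<otimes>\<^bsub>S\<^esub> b \<ominus>\<^bsub>S\<^esub> h u v,
        a \<odot>\<^bsub>P\<^esub> v \<oplus>\<^bsub>P\<^esub> invol S b \<odot>\<^bsub>P\<^esub> u \<oplus>\<^bsub>P\<^esub> cross S P h \<alpha> u v)),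
     one = (\<one>\<^bsub>S\<^esub>, \<zero>\<^bsub>P\<^esub>), zero = (\<zero>\<^bsub>S\<^esub>, \<zero>\<^bsub>P\<^esub>),
     add = (\<lambda>(a, u) (b, v). (a \<oplus>\<^bsub>S\<^esub> b, u \<oplus>\<^bsub>P\<^esub> v)),
     smult = (\<lambda>r (a, u). (r \<odot>\<^bsub>S\<^esub> a, restrict_smult S P r u))\<rparr>"

fun octonion_pair ::
  "('r, 'm) ring_scheme \<Rightarrow> ('r, 's, 'p) quadruple \<Rightarrow> ('r, 's \<times> 'p) module \<times> ('s \<times> 'p) set"
  where "octonion_pair R (S, P, h, \<alpha>) =
    (octonion_algebra R (S, P, h, \<alpha>), carrier S \<times> {\<zero>\<^bsub>P\<^esub>})"


section \<open>Isomorphism classes\<close>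

definition algebra_iso ::
  "('r, 'm) ring_scheme \<Rightarrow> ('r, 'a) module \<Rightarrow> ('r, 'b) module \<Rightarrow> ('a \<Rightarrow> 'b) set"
  where "algebra_iso R A B =
    {f \<in> Hom_mod R A B. bij_betw f (carrier A) (carrier B) \<and>
       (\<forall>x\<in>carrier A. \<forall>y\<in>carrier A. f (x \<otimes>\<^bsub>A\<^esub> y) = f x \<otimes>\<^bsub>B\<^esub> f y)}"

definition isomorphic_algebras ::
  "('r, 'm) ring_scheme \<Rightarrow> ('r, 'a) module \<Rightarrow> ('r, 'b) module \<Rightarrow> bool"
  where "isomorphic_algebras R A B \<longleftrightarrow> algebra_iso R A B \<noteq> {}"

definition isomorphic_pairs ::
  "('r, 'm) ring_scheme \<Rightarrow> ('r, 'a) module \<times> 'a set \<Rightarrow> ('r, 'b) module \<times> 'b set \<Rightarrow> bool"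
  where "isomorphic_pairs R A B \<longleftrightarrow> (\<exists>f \<in> algebra_iso R (fst A) (fst B). f ` snd A = snd B)"

definition iso_rel :: "('a \<Rightarrow> 'a \<Rightarrow> bool) \<Rightarrow> 'a set \<Rightarrow> ('a \<times> 'a) set"
  where "iso_rel E X = {(A, B). A \<in> X \<and> B \<in> X \<and> E A B}"

definition iso_classes :: "('a \<Rightarrow> 'a \<Rightarrow> bool) \<Rightarrow> 'a set \<Rightarrow> 'a set set"
  where "iso_classes E X = X // iso_rel E X"

definition iso_class :: "('a \<Rightarrow> 'a \<Rightarrow> bool) \<Rightarrow> 'a set \<Rightarrow> 'a \<Rightarrow> 'a set"
  where "iso_class E X A = iso_rel E X `` {A}"

definition vector_algebras :: "('r, 'm) ring_scheme \<Rightarrow> ('r, 's, 'p) quadruple set \<Rightarrow> ('r, 'p) module set"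
  where "vector_algebras R Q = vector_algebra R ` Q"

definition colour_algebras ::
  "('r, 'm) ring_scheme \<Rightarrow> ('r, 's, 'p) quadruple set \<Rightarrow> ('r, 'r \<times> 'p) module set"
  where "colour_algebras R Q = colour_algebra R ` Q"

definition octonion_pairs ::
  "('r, 'm) ring_scheme \<Rightarrow> ('r, 's, 'p) quadruple set
     \<Rightarrow> (('r, 's \<times> 'p) module \<times> ('s \<times> 'p) set) set"
  where "octonion_pairs R Q = octonion_pair R ` Q"

end

theory Submission
  imports Defs
begin

text \<open>Fix a quadruple \<open>(S, P, h, \<alpha>)\<close> and write \<open>vol u v w = \<alpha> (u \<and> v \<and> w)\<close> and \<open>u \<times> v\<close> for the cross product. The
  point is that the vector algebra \<open>(P, \<times>)\<close>, a mere \<open>R\<close>-algebra, remembers the ring \<open>S\<close>, its involution,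
  its action on \<open>P\<close> and the form \<open>h\<close>. Everything rests on the identity
  \<open>(a \<times> b) \<times> c = h a c \<cdot> b - h b c \<cdot> a\<close> (lemma \<open>triple_product\<close>). It comes from two facts: \<open>\<alpha>\<close> is an isometry,
  which makes Gram determinants products of volumes (\<open>gram_det_vol\<close>), and \<open>P\<close> has rank three, which gives
  Cramer's rule for volumes (\<open>cramer\<close>).

  There are no bases of \<open>P\<close> in this argument. Its local freeness enters once, to see that alternating four-linear
  forms on \<open>P\<close> vanish. Otherwise the substitute for a basis is that \<open>\<alpha>\<close> is onto: the values of \<open>vol\<close>
  generate the unit ideal of \<open>S\<close> (\<open>vol_values_generate\<close>), so it suffices to prove a claim after multiplication
  by an arbitrary \<open>vol u v w\<close>.

  An isomorphism \<open>f\<close> of vector algebras carries multiplication by \<open>a \<in> S\<close> to an additive map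
  \<open>\<phi>\<close> of \<open>P'\<close> with \<open>\<phi> u \<times> v = u \<times> \<phi> v = \<psi> (u \<times> v)\<close>, where \<open>\<psi>\<close> comes from the conjugate of \<open>a\<close>. The triple
  product identity forces such a map to be a scalar (\<open>centroid_scalar\<close>). This defines a ring isomorphism
  \<open>\<sigma> : S \<rightarrow> S'\<close> over which \<open>f\<close> is semilinear, and the same identity shows that \<open>f\<close> is an isometry
  (\<open>isometry\<close>). Then \<open>(\<sigma>, f)\<close> and \<open>(id, f)\<close> are isomorphisms of the octonion and of the colour algebras.

  Conversely \<open>P\<close> has to be recognised inside the two larger algebras. In the octonion algebra commutators
  with \<open>s \<in> S\<close> yield \<open>(s - bar s) P\<close>, where \<open>bar\<close> is the involution, and the differences \<open>s - bar s\<close> generate the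
  unit ideal because \<open>S\<close> is \'etale of rank two (\<open>etale_differences_generate\<close>). In the colour algebra
  commutators yield \<open>2 (u \<times> v)\<close>, and the cross products span \<open>P\<close> (\<open>cross_products_span\<close>). So an isomorphism
  of octonion pairs or of colour algebras maps \<open>P\<close> onto \<open>P'\<close>, and the \<open>P'\<close>-component of the product of
  two elements of \<open>P'\<close> is their cross product.\<close>

section \<open>Prime ideals and vanishing\<close>

text \<open>By Zorn's lemma there is a largest ideal that contains \<open>I\<close> and avoids \<open>1\<close>; unions of chains still
  avoid \<open>1\<close>.\<close>
lemma (in cring) proper_ideal_in_prime_ideal:
  assumes I: "ideal I R" and one: "\<one> \<notin> I"
  obtains \<pp> where "primeideal \<pp> R" "I \<subseteq> \<pp>"
proof -
  let ?\<A> = "{J. ideal J R \<and> I \<subseteq> J \<and> \<one> \<notin> J}"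
  have "\<exists>M\<in>?\<A>. \<forall>X\<in>?\<A>. M \<subseteq> X \<longrightarrow> X = M"
  proof (rule subset_Zorn_nonempty)
    have "I \<in> ?\<A>" using assms by simp
    then show "?\<A> \<noteq> {}" by (metis empty_iff)
    fix \<C> assume ne: "\<C> \<noteq> {}" and ch: "subset.chain ?\<A> \<C>"
    have sub\<A>: "\<C> \<subseteq> ?\<A>" and cmp: "\<And>J K. J \<in> \<C> \<Longrightarrow> K \<in> \<C> \<Longrightarrow> J \<subseteq> K \<or> K \<subseteq> J"
      using ch unfolding subset.chain_def subset_chain_def by auto
    have id: "ideal J R" "I \<subseteq> J" "\<one> \<notin> J" if "J \<in> \<C>" for J
      using subsetD[OF sub\<A> that] by simp_all
    have sub: "additive_subgroup J R" if "J \<in> \<C>" for J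
      using id(1)[OF that] by (rule ideal.axioms(1))
    obtain J0 where J0: "J0 \<in> \<C>" using ne by blast
    have "ideal (\<Union>\<C>) R"
    proof (rule idealI[OF ring_axioms])
      show "subgroup (\<Union>\<C>) (add_monoid R)"
      proof (rule add.subgroupI)
        show "\<Union>\<C> \<subseteq> carrier R" using additive_subgroup.a_subset[OF sub] by (rule Union_least)
        show "\<Union>\<C> \<noteq> {}" using additive_subgroup.zero_closed[OF sub[OF J0]] J0 by (metis UnionI empty_iff)
      next
        fix a assume "a \<in> \<Union>\<C>"
        then obtain J where "J \<in> \<C>" "a \<in> J" by (rule UnionE)
        then show "\<ominus> a \<in> \<Union>\<C>"
          using additive_subgroup.a_inv_closed[OF sub] by (metis UnionI)
      next
        fix a b assume a: "a \<in> \<Union>\<C>" and b: "b \<in> \<Union>\<C>"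
        obtain J where J: "J \<in> \<C>" "a \<in> J" using a by (rule UnionE)
        obtain K where K: "K \<in> \<C>" "b \<in> K" using b by (rule UnionE)
        obtain L where L: "L \<in> \<C>" "a \<in> L" "b \<in> L"
          using cmp[OF J(1) K(1)] J K by (metis subsetD)
        then show "a \<oplus> b \<in> \<Union>\<C>"
          using additive_subgroup.a_closed[OF sub] by (metis UnionI)
      qed
    next
      fix a x assume a: "a \<in> \<Union>\<C>" and x: "x \<in> carrier R"
      obtain J where J: "J \<in> \<C>" "a \<in> J" using a by (rule UnionE)
      show "x \<otimes> a \<in> \<Union>\<C>" "a \<otimes> x \<in> \<Union>\<C>"
        using ideal.I_l_closed[OF id(1)[OF J(1)] J(2) x] ideal.I_r_closed[OF id(1)[OF J(1)] J(2) x] J(1)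
        by (metis UnionI)+
    qed
    moreover have "I \<subseteq> \<Union>\<C>" using id(2)[OF J0] J0 by (metis Union_upper subset_trans)
    moreover have "\<one> \<notin> \<Union>\<C>" using id(3) by (metis UnionE)
    ultimately show "\<Union>\<C> \<in> ?\<A>" by simp
  qed
  then obtain M where "M \<in> ?\<A>" and maxM: "\<forall>X\<in>?\<A>. M \<subseteq> X \<longrightarrow> X = M" by (rule bexE)
  then have M: "ideal M R" "I \<subseteq> M" "\<one> \<notin> M" by simp_all
  have max: "X = M" if "ideal X R" "\<one> \<notin> X" "M \<subseteq> X" for X
    using maxM that M(2) by simp
  have "maximalideal M R"
  proof (rule maximalidealI[OF M(1)])
    show "carrier R \<noteq> M" using M(3) one_closed by metis
    fix J assume J: "ideal J R" "M \<subseteq> J" "J \<subseteq> carrier R"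
    show "J = M \<or> J = carrier R"
      using max[OF J(1)] J(2) ideal.one_imp_carrier[OF J(1)] by metis
  qed
  then show thesis using that[OF maximalideal_prime M(2)] by simp
qed

lemma (in module) annihilator_ideal:
  assumes "x \<in> carrier M"
  shows "ideal {t \<in> carrier R. t \<odot>\<^bsub>M\<^esub> x = \<zero>\<^bsub>M\<^esub>} R"
proof (rule idealI[OF R.ring_axioms])
  show "subgroup {t \<in> carrier R. t \<odot>\<^bsub>M\<^esub> x = \<zero>\<^bsub>M\<^esub>} (add_monoid R)"
    using assms by (intro R.add.subgroupI) (auto simp: smult_l_minus smult_l_distr)
next
  fix a b assume "a \<in> {t \<in> carrier R. t \<odot>\<^bsub>M\<^esub> x = \<zero>\<^bsub>M\<^esub>}" "b \<in> carrier R"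
  with assms show "b \<otimes> a \<in> {t \<in> carrier R. t \<odot>\<^bsub>M\<^esub> x = \<zero>\<^bsub>M\<^esub>}"
    "a \<otimes> b \<in> {t \<in> carrier R. t \<odot>\<^bsub>M\<^esub> x = \<zero>\<^bsub>M\<^esub>}"
    by (simp_all add: R.m_comm[of a b] smult_assoc1)
qed

lemma (in cring) regular_module: "module R (regular_module R)"
proof (rule moduleI[OF is_cring])
  show "abelian_group (regular_module R)"
  proof (rule abelian_groupI)
    fix x assume "x \<in> carrier (regular_module R)"
    then show "\<exists>y\<in>carrier (regular_module R). y \<oplus>\<^bsub>regular_module R\<^esub> x = \<zero>\<^bsub>regular_module R\<^esub>"
      by (intro bexI[of _ "\<ominus> x"]) (auto simp: regular_module_def l_neg)
  qed (auto simp: regular_module_def a_ac)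
qed (auto simp: regular_module_def l_distr r_distr m_assoc)

text \<open>The annihilator of \<open>c\<close> is an ideal that lies in no prime ideal, hence contains \<open>1\<close>. This is how
  information about localisations is turned into equations in the ring.\<close>
lemma (in cring) locally_zero_imp_zero:
  assumes c: "c \<in> carrier R"
    and loc: "\<And>\<pp>. primeideal \<pp> R \<Longrightarrow> \<exists>t\<in>carrier R - \<pp>. t \<otimes> c = \<zero>"
  shows "c = \<zero>"
proof (rule ccontr)
  let ?I = "{t \<in> carrier R. t \<otimes> c = \<zero>}"
  assume "c \<noteq> \<zero>"
  then have "\<one> \<notin> ?I" using c by simp
  moreover have "ideal ?I R"
    using module.annihilator_ideal[OF regular_module, of c] c by (simp add: regular_module_def)
  ultimately obtain \<pp> where "primeideal \<pp> R" "?I \<subseteq> \<pp>" by (metis proper_ideal_in_prime_ideal)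
  then show False using loc by blast
qed


section \<open>Linear maps on free modules and their quotients\<close>

text \<open>Linearity without the extensionality built into \<open>Hom_mod\<close>, so that composites and
  \<open>\<lambda>\<close>-terms qualify as they stand.\<close>

definition linear_map ::
  "('a, 'm) ring_scheme \<Rightarrow> ('a, 'b, 'k) module_scheme \<Rightarrow> ('a, 'c, 'l) module_scheme \<Rightarrow> ('b \<Rightarrow> 'c) \<Rightarrow> bool"
  where "linear_map A M N L \<longleftrightarrow> L \<in> carrier M \<rightarrow> carrier N \<and>
     (\<forall>x\<in>carrier M. \<forall>y\<in>carrier M. L (x \<oplus>\<^bsub>M\<^esub> y) = L x \<oplus>\<^bsub>N\<^esub> L y) \<and>
     (\<forall>a\<in>carrier A. \<forall>x\<in>carrier M. L (a \<odot>\<^bsub>M\<^esub> x) = a \<odot>\<^bsub>N\<^esub> L x)"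

lemma Hom_mod_linear: "L \<in> Hom_mod A M N \<Longrightarrow> linear_map A M N L"
  by (auto simp: Hom_mod_def linear_map_def)

lemma linear_mapD:
  assumes "linear_map A M N L"
  shows "x \<in> carrier M \<Longrightarrow> L x \<in> carrier N"
    "\<lbrakk>x \<in> carrier M; y \<in> carrier M\<rbrakk> \<Longrightarrow> L (x \<oplus>\<^bsub>M\<^esub> y) = L x \<oplus>\<^bsub>N\<^esub> L y"
    "\<lbrakk>a \<in> carrier A; x \<in> carrier M\<rbrakk> \<Longrightarrow> L (a \<odot>\<^bsub>M\<^esub> x) = a \<odot>\<^bsub>N\<^esub> L x"
  using assms by (auto simp: linear_map_def)

lemma linear_map_comp:
  "linear_map A M N L \<Longrightarrow> linear_map A N K L' \<Longrightarrow> linear_map A M K (\<lambda>x. L' (L x))"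
  by (auto simp: linear_map_def Pi_def)

lemma additive_map_zero_minus:
  assumes "abelian_group M" "abelian_group N" "L \<in> carrier M \<rightarrow> carrier N"
    "\<forall>x\<in>carrier M. \<forall>y\<in>carrier M. L (x \<oplus>\<^bsub>M\<^esub> y) = L x \<oplus>\<^bsub>N\<^esub> L y"
  shows "L \<zero>\<^bsub>M\<^esub> = \<zero>\<^bsub>N\<^esub>"
    "x \<in> carrier M \<Longrightarrow> L (\<ominus>\<^bsub>M\<^esub> x) = \<ominus>\<^bsub>N\<^esub> L x"
    "\<lbrakk>x \<in> carrier M; y \<in> carrier M\<rbrakk> \<Longrightarrow> L (x \<ominus>\<^bsub>M\<^esub> y) = L x \<ominus>\<^bsub>N\<^esub> L y"
proof -
  interpret M: abelian_group M by fact
  interpret N: abelian_group N by fact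
  have clo: "\<And>x. x \<in> carrier M \<Longrightarrow> L x \<in> carrier N" using assms(3) by auto
  have add: "L (x \<oplus>\<^bsub>M\<^esub> y) = L x \<oplus>\<^bsub>N\<^esub> L y" if "x \<in> carrier M" "y \<in> carrier M" for x y
    using assms(4) that by simp
  have "L \<zero>\<^bsub>M\<^esub> \<oplus>\<^bsub>N\<^esub> L \<zero>\<^bsub>M\<^esub> = L \<zero>\<^bsub>M\<^esub>" using add[of "\<zero>\<^bsub>M\<^esub>" "\<zero>\<^bsub>M\<^esub>"] by simp
  then show z: "L \<zero>\<^bsub>M\<^esub> = \<zero>\<^bsub>N\<^esub>" using clo[of "\<zero>\<^bsub>M\<^esub>"] by simp
  show m: "L (\<ominus>\<^bsub>M\<^esub> x) = \<ominus>\<^bsub>N\<^esub> L x" if x: "x \<in> carrier M" for x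
  proof -
    have "L (\<ominus>\<^bsub>M\<^esub> x) \<oplus>\<^bsub>N\<^esub> L x = \<zero>\<^bsub>N\<^esub>" using add[of "\<ominus>\<^bsub>M\<^esub> x" x] x z by (simp add: M.l_neg)
    then show ?thesis using clo[of "\<ominus>\<^bsub>M\<^esub> x"] clo[of x] x by (simp add: N.minus_equality)
  qed
  show "\<lbrakk>x \<in> carrier M; y \<in> carrier M\<rbrakk> \<Longrightarrow> L (x \<ominus>\<^bsub>M\<^esub> y) = L x \<ominus>\<^bsub>N\<^esub> L y"
    using m by (simp add: a_minus_def add)
qed

lemma linear_map_minus:
  assumes "module A M" "module A N" "linear_map A M N L"
  shows "L \<zero>\<^bsub>M\<^esub> = \<zero>\<^bsub>N\<^esub>" "x \<in> carrier M \<Longrightarrow> L (\<ominus>\<^bsub>M\<^esub> x) = \<ominus>\<^bsub>N\<^esub> L x"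
    "\<lbrakk>x \<in> carrier M; y \<in> carrier M\<rbrakk> \<Longrightarrow> L (x \<ominus>\<^bsub>M\<^esub> y) = L x \<ominus>\<^bsub>N\<^esub> L y"
  using assms additive_map_zero_minus[OF module.axioms(2)[OF assms(1)] module.axioms(2)[OF assms(2)], of L]
  by (simp_all add: linear_map_def)

lemma additive_map_finsum:
  assumes "abelian_group M" "abelian_group N" and L: "L \<in> carrier M \<rightarrow> carrier N"
    and add: "\<forall>x\<in>carrier M. \<forall>y\<in>carrier M. L (x \<oplus>\<^bsub>M\<^esub> y) = L x \<oplus>\<^bsub>N\<^esub> L y"
    and "finite I" "g \<in> I \<rightarrow> carrier M"
  shows "L (\<Oplus>\<^bsub>M\<^esub>i\<in>I. g i) = (\<Oplus>\<^bsub>N\<^esub>i\<in>I. L (g i))"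
proof -
  interpret M: abelian_group M by fact
  interpret N: abelian_group N by fact
  show ?thesis using assms(5,6)
  proof (induction I rule: finite_induct)
    case empty
    then show ?case using additive_map_zero_minus(1)[OF assms(1,2) L add] by simp
  next
    case (insert i I)
    then show ?case using L add by (simp add: Pi_def M.finsum_closed)
  qed
qed

lemma submodule_vimage:
  assumes "module A M" "module A N" "linear_map A M N L" "submodule H A N"
  shows "submodule {x \<in> carrier M. L x \<in> H} A M"
proof -
  interpret M: module A M by fact
  interpret N: module A N by fact
  note lin = linear_mapD[OF assms(3)] linear_map_minus[OF assms(1-3)]
  note H = N.submoduleE[OF assms(4)] subgroup.one_closed[OF submodule.axioms(1)[OF assms(4)]]
  show ?thesis
    using H by (intro M.submoduleI) (auto simp: lin)
qed

lemma linear_maps_equaliser: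
  assumes "module A M" "module A N" "linear_map A M N L" "linear_map A M N L'"
  shows "submodule {x \<in> carrier M. L x = L' x} A M"
proof -
  interpret M: module A M by fact
  show ?thesis
    by (rule M.submoduleI)
      (simp_all add: linear_mapD[OF assms(3)] linear_mapD[OF assms(4)]
        linear_map_minus[OF assms(1-3)] linear_map_minus[OF assms(1,2,4)] subset_iff)
qed

lemma zero_submodule:
  assumes "module A N" shows "submodule {\<zero>\<^bsub>N\<^esub>} A N"
proof -
  interpret N: module A N by fact
  show ?thesis by (rule N.submoduleI) auto
qed

lemma submodule_gen_properties:
  assumes "module A M" "X \<subseteq> carrier M"
  shows "submodule (submodule_gen A M X) A M" "X \<subseteq> submodule_gen A M X"
    "\<And>H. submodule H A M \<Longrightarrow> X \<subseteq> H \<Longrightarrow> submodule_gen A M X \<subseteq> H"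
proof -
  interpret M: module A M by fact
  have ex: "submodule (carrier M) A M" by (rule M.carrier_is_submodule)
  show "submodule (submodule_gen A M X) A M"
    unfolding submodule_gen_def
  proof (rule M.submoduleI)
    show "\<Inter>{H. submodule H A M \<and> X \<subseteq> H} \<subseteq> carrier M" using ex assms(2) by (intro Inter_lower) simp
    show "\<zero>\<^bsub>M\<^esub> \<in> \<Inter>{H. submodule H A M \<and> X \<subseteq> H}"
      using subgroup.one_closed[OF submodule.axioms(1)] by fastforce
  qed (simp_all add: M.submoduleE(3-5))
  show "X \<subseteq> submodule_gen A M X" "\<And>H. submodule H A M \<Longrightarrow> X \<subseteq> H \<Longrightarrow> submodule_gen A M X \<subseteq> H"
    unfolding submodule_gen_def by blast+
qed

text \<open>The kernel is a submodule, so it contains the submodule generated by any subset of it. This is what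
  makes linear maps descend to the tensor product and to the exterior cube.\<close>
lemma linear_map_kills_submodule_gen:
  assumes "module A M" "module A N" "linear_map A M N L" "X \<subseteq> carrier M"
    "\<And>x. x \<in> X \<Longrightarrow> L x = \<zero>\<^bsub>N\<^esub>" "x \<in> submodule_gen A M X"
  shows "L x = \<zero>\<^bsub>N\<^esub>"
  using submodule_gen_properties(3)[OF assms(1,4) submodule_vimage[OF assms(1-3) zero_submodule[OF assms(2)]]]
    assms(4-6) by blast

context
  fixes A :: "('a, 'm) ring_scheme" (structure) and X :: "'x set" and F
  assumes A: "cring A"
  defines "F \<equiv> free_module A X"
begin

interpretation A: cring A by (rule A)

lemma free_module_mem:
  "f \<in> carrier F \<longleftrightarrow> (\<forall>x. f x \<in> carrier A) \<and> (\<forall>x. x \<notin> X \<longrightarrow> f x = \<zero>) \<and> finite {x. f x \<noteq> \<zero>}"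
  by (simp add: F_def free_module_def) (metis A.zero_closed)

lemma free_module_ops:
  "\<zero>\<^bsub>F\<^esub> = (\<lambda>x. \<zero>)" "f \<oplus>\<^bsub>F\<^esub> g = (\<lambda>x. f x \<oplus> g x)" "a \<odot>\<^bsub>F\<^esub> f = (\<lambda>x. a \<otimes> f x)"
  by (simp_all add: F_def free_module_def)

lemma free_module_module: "module A F"
proof (rule moduleI[OF A])
  have sub: "finite {x. f x \<oplus> g x \<noteq> \<zero>}" if "finite {x. f x \<noteq> \<zero>}" "finite {x. g x \<noteq> \<zero>}"
    for f g :: "'x \<Rightarrow> 'a"
    by (rule finite_subset[OF _ finite_UnI[OF that]]) auto
  show "abelian_group F"
  proof (rule abelian_groupI)
    fix f assume f: "f \<in> carrier F"
    have "finite {x. \<ominus> f x \<noteq> \<zero>}"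
      by (rule finite_subset[of _ "{x. f x \<noteq> \<zero>}"]) (use f in \<open>auto simp: free_module_mem\<close>)
    then have "(\<lambda>x. \<ominus> f x) \<in> carrier F" using f by (simp add: free_module_mem)
    moreover have "(\<lambda>x. \<ominus> f x) \<oplus>\<^bsub>F\<^esub> f = \<zero>\<^bsub>F\<^esub>"
      using f by (simp add: free_module_ops free_module_mem A.l_neg)
    ultimately show "\<exists>g\<in>carrier F. g \<oplus>\<^bsub>F\<^esub> f = \<zero>\<^bsub>F\<^esub>" by metis
  qed (simp_all add: free_module_mem free_module_ops sub A.a_ac)
next
  fix a f assume a: "a \<in> carrier A" and f: "f \<in> carrier F"
  have "finite {x. a \<otimes> f x \<noteq> \<zero>}"
    by (rule finite_subset[of _ "{x. f x \<noteq> \<zero>}"]) (use a f in \<open>auto simp: free_module_mem\<close>)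
  then show "a \<odot>\<^bsub>F\<^esub> f \<in> carrier F" using a f by (simp add: free_module_mem free_module_ops)
qed (simp_all add: free_module_mem free_module_ops A.l_distr A.r_distr A.m_assoc)

interpretation F: module A F by (rule free_module_module)

lemma free_gen_closed: "x \<in> X \<Longrightarrow> free_gen A x \<in> carrier F"
  by (simp add: free_module_mem free_gen_def)

text \<open>Induction on a finite set containing the support: one coordinate is split off as a multiple of a
  generator.\<close>
lemma free_module_generated:
  assumes H: "submodule H A F" and gens: "\<And>x. x \<in> X \<Longrightarrow> free_gen A x \<in> H" and f: "f \<in> carrier F"
  shows "f \<in> H"
proof -
  have "finite I \<Longrightarrow> \<forall>f\<in>carrier F. {x. f x \<noteq> \<zero>} \<subseteq> I \<longrightarrow> f \<in> H" for I
  proof (induction I rule: finite_induct)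
    case empty
    have "f \<in> H" if "f \<in> carrier F" "{x. f x \<noteq> \<zero>} \<subseteq> {}" for f
    proof -
      have "f = \<zero>\<^bsub>F\<^esub>" using that(2) by (auto simp: free_module_ops)
      then show ?thesis using subgroup.one_closed[OF submodule.axioms(1)[OF H]] by simp
    qed
    then show ?case by metis
  next
    case (insert i I)
    have "f \<in> H" if f: "f \<in> carrier F" and sub: "{x. f x \<noteq> \<zero>} \<subseteq> insert i I" for f
    proof (cases "i \<in> X")
      case False
      then have "f i = \<zero>" using f by (simp add: free_module_mem)
      then show ?thesis using insert.IH f sub by auto
    next
      case True
      let ?t = "f i \<odot>\<^bsub>F\<^esub> free_gen A i"
      define g where "g = f(i := \<zero>)"
      have t: "?t \<in> H" using F.submoduleE(4)[OF H _ gens[OF True]] f by (simp add: free_module_mem)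
      have "finite {x. g x \<noteq> \<zero>}"
        by (rule finite_subset[of _ "{x. f x \<noteq> \<zero>}"]) (use f in \<open>auto simp: free_module_mem g_def\<close>)
      then have gF: "g \<in> carrier F" using f by (simp add: free_module_mem g_def)
      have "f = g \<oplus>\<^bsub>F\<^esub> ?t"
        using f by (auto simp: g_def free_module_ops free_gen_def fun_eq_iff free_module_mem)
      moreover have "{x. g x \<noteq> \<zero>} \<subseteq> I" using sub by (auto simp: g_def)
      then have "g \<in> H" using insert.IH gF by metis
      ultimately show ?thesis using F.submoduleE(5)[OF H _ t] by metis
    qed
    then show ?case by simp
  qed
  from this[of "{x. f x \<noteq> \<zero>}"] f show ?thesis by (simp add: free_module_mem)
qed

lemma linear_maps_eq_on_free_module:
  assumes "module A N" "linear_map A F N L" "linear_map A F N L'"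
    and "\<And>x. x \<in> X \<Longrightarrow> L (free_gen A x) = L' (free_gen A x)" "f \<in> carrier F"
  shows "L f = L' f"
  using free_module_generated[OF linear_maps_equaliser[OF F.module_axioms assms(1-3)] _ assms(5)]
    assms(4) free_gen_closed by simp

definition linear_ext :: "('a, 'c, 'l) module_scheme \<Rightarrow> ('x \<Rightarrow> 'c) \<Rightarrow> ('x \<Rightarrow> 'a) \<Rightarrow> 'c"
  where "linear_ext N \<phi> f = (\<Oplus>\<^bsub>N\<^esub>x\<in>{x. f x \<noteq> \<zero>}. f x \<odot>\<^bsub>N\<^esub> \<phi> x)"

context
  fixes N :: "('a, 'c, 'l) module_scheme" and \<phi> :: "'x \<Rightarrow> 'c"
  assumes N: "module A N" and \<phi>: "\<And>x. x \<in> X \<Longrightarrow> \<phi> x \<in> carrier N"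
begin

interpretation N: module A N by (rule N)

text \<open>Two elements and their sum have different supports; additivity is checked by summing all of them over
  a common finite index set.\<close>
lemma linear_ext_superset:
  assumes f: "f \<in> carrier F" and I: "finite I" "{x. f x \<noteq> \<zero>} \<subseteq> I" "I \<subseteq> X"
  shows "linear_ext N \<phi> f = (\<Oplus>\<^bsub>N\<^esub>x\<in>I. f x \<odot>\<^bsub>N\<^esub> \<phi> x)"
  unfolding linear_ext_def
proof (rule N.add.finprod_mono_neutral_cong_left[OF I(1,2)])
  show "f x \<odot>\<^bsub>N\<^esub> \<phi> x = \<zero>\<^bsub>N\<^esub>" if "x \<in> I - {x. f x \<noteq> \<zero>}" for x
    using that I(3) \<phi> by auto
  show "(\<lambda>x. f x \<odot>\<^bsub>N\<^esub> \<phi> x) \<in> I \<rightarrow> carrier N"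
    using f I(3) \<phi> by (auto simp: free_module_mem)
qed simp

lemma linear_ext_gen:
  assumes "x \<in> X" shows "linear_ext N \<phi> (free_gen A x) = \<phi> x"
proof -
  have "linear_ext N \<phi> (free_gen A x) = (\<Oplus>\<^bsub>N\<^esub>y\<in>{x}. free_gen A x y \<odot>\<^bsub>N\<^esub> \<phi> y)"
    using assms by (intro linear_ext_superset free_gen_closed) (auto simp: free_gen_def split: if_splits)
  then show ?thesis using assms \<phi> by (simp add: free_gen_def)
qed

lemma linear_ext_linear: "linear_map A F N (linear_ext N \<phi>)"
  unfolding linear_map_def
proof (intro conjI ballI)
  have supp: "finite {x. f x \<noteq> \<zero>}" "{x. f x \<noteq> \<zero>} \<subseteq> X" if "f \<in> carrier F" for f
    using that by (auto simp: free_module_mem)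
  have tm: "(\<lambda>x. f x \<odot>\<^bsub>N\<^esub> \<phi> x) \<in> I \<rightarrow> carrier N" if "f \<in> carrier F" "I \<subseteq> X" for f I
    using that \<phi> by (auto simp: free_module_mem)
  show "linear_ext N \<phi> \<in> carrier F \<rightarrow> carrier N"
    unfolding linear_ext_def using supp tm by (auto intro!: N.finsum_closed)
  fix f assume f: "f \<in> carrier F"
  { fix g assume g: "g \<in> carrier F"
    let ?I = "{x. f x \<noteq> \<zero>} \<union> {x. g x \<noteq> \<zero>}"
    have I: "finite ?I" "?I \<subseteq> X" using supp[OF f] supp[OF g] by simp_all
    have fg: "f \<oplus>\<^bsub>F\<^esub> g \<in> carrier F" using f g by simp
    have sub: "{x. f x \<noteq> \<zero>} \<subseteq> ?I" "{x. g x \<noteq> \<zero>} \<subseteq> ?I" "{x. (f \<oplus>\<^bsub>F\<^esub> g) x \<noteq> \<zero>} \<subseteq> ?I"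
      by (auto simp: free_module_ops)
    have "linear_ext N \<phi> (f \<oplus>\<^bsub>F\<^esub> g) = (\<Oplus>\<^bsub>N\<^esub>x\<in>?I. (f \<oplus>\<^bsub>F\<^esub> g) x \<odot>\<^bsub>N\<^esub> \<phi> x)"
      by (rule linear_ext_superset[OF fg I(1) sub(3) I(2)])
    also have "\<dots> = (\<Oplus>\<^bsub>N\<^esub>x\<in>?I. f x \<odot>\<^bsub>N\<^esub> \<phi> x \<oplus>\<^bsub>N\<^esub> g x \<odot>\<^bsub>N\<^esub> \<phi> x)"
    proof (rule N.finsum_cong'[OF refl])
      show "(\<lambda>x. f x \<odot>\<^bsub>N\<^esub> \<phi> x \<oplus>\<^bsub>N\<^esub> g x \<odot>\<^bsub>N\<^esub> \<phi> x) \<in> ?I \<rightarrow> carrier N"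
        using tm[OF f I(2)] tm[OF g I(2)] by (auto simp: Pi_def)
      fix x assume "x \<in> ?I"
      then have "x \<in> X" using I(2) by (rule subsetD[rotated])
      then show "(f \<oplus>\<^bsub>F\<^esub> g) x \<odot>\<^bsub>N\<^esub> \<phi> x = f x \<odot>\<^bsub>N\<^esub> \<phi> x \<oplus>\<^bsub>N\<^esub> g x \<odot>\<^bsub>N\<^esub> \<phi> x"
        using f g \<phi> by (simp add: free_module_ops free_module_mem N.smult_l_distr)
    qed
    also have "\<dots> = (\<Oplus>\<^bsub>N\<^esub>x\<in>?I. f x \<odot>\<^bsub>N\<^esub> \<phi> x) \<oplus>\<^bsub>N\<^esub> (\<Oplus>\<^bsub>N\<^esub>x\<in>?I. g x \<odot>\<^bsub>N\<^esub> \<phi> x)"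
      by (rule N.finsum_addf[OF tm[OF f I(2)] tm[OF g I(2)]])
    also have "\<dots> = linear_ext N \<phi> f \<oplus>\<^bsub>N\<^esub> linear_ext N \<phi> g"
      by (simp only: linear_ext_superset[OF f I(1) sub(1) I(2)] linear_ext_superset[OF g I(1) sub(2) I(2)])
    finally show "linear_ext N \<phi> (f \<oplus>\<^bsub>F\<^esub> g) = linear_ext N \<phi> f \<oplus>\<^bsub>N\<^esub> linear_ext N \<phi> g" .
  }
  fix a assume a: "a \<in> carrier A"
  let ?I = "{x. f x \<noteq> \<zero>}"
  have af: "a \<odot>\<^bsub>F\<^esub> f \<in> carrier F" using f a by simp
  have "{x. (a \<odot>\<^bsub>F\<^esub> f) x \<noteq> \<zero>} \<subseteq> ?I" using a by (auto simp: free_module_ops)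
  then have "linear_ext N \<phi> (a \<odot>\<^bsub>F\<^esub> f) = (\<Oplus>\<^bsub>N\<^esub>x\<in>?I. (a \<odot>\<^bsub>F\<^esub> f) x \<odot>\<^bsub>N\<^esub> \<phi> x)"
    by (rule linear_ext_superset[OF af supp(1)[OF f] _ supp(2)[OF f]])
  also have "\<dots> = (\<Oplus>\<^bsub>N\<^esub>x\<in>?I. a \<odot>\<^bsub>N\<^esub> (f x \<odot>\<^bsub>N\<^esub> \<phi> x))"
  proof (rule N.finsum_cong'[OF refl])
    show "(\<lambda>x. a \<odot>\<^bsub>N\<^esub> (f x \<odot>\<^bsub>N\<^esub> \<phi> x)) \<in> ?I \<rightarrow> carrier N"
      using tm[OF f supp(2)[OF f]] a by (auto simp: Pi_def)
    fix x assume "x \<in> ?I"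
    then have "x \<in> X" using supp(2)[OF f] by (rule subsetD[rotated])
    then show "(a \<odot>\<^bsub>F\<^esub> f) x \<odot>\<^bsub>N\<^esub> \<phi> x = a \<odot>\<^bsub>N\<^esub> (f x \<odot>\<^bsub>N\<^esub> \<phi> x)"
      using f a \<phi> by (simp add: free_module_ops free_module_mem N.smult_assoc1)
  qed
  also have "\<dots> = a \<odot>\<^bsub>N\<^esub> linear_ext N \<phi> f"
    unfolding linear_ext_def
    by (rule N.finsum_smult_ldistr[symmetric, OF supp(1)[OF f] a tm[OF f supp(2)[OF f]]])
  finally show "linear_ext N \<phi> (a \<odot>\<^bsub>F\<^esub> f) = a \<odot>\<^bsub>N\<^esub> linear_ext N \<phi> f" .
qed

end

end

context
  fixes A :: "('a, 'm) ring_scheme" and M :: "('a, 'b, 'k) module_scheme" and K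
  assumes M: "module A M" and K: "submodule K A M"
begin

interpretation M: module A M by (rule M)

lemma submodule_abelian_subgroup: "abelian_subgroup K M"
  by (rule abelian_subgroupI3[OF _ M.abelian_group_axioms])
    (simp add: additive_subgroup_def submodule.axioms(1)[OF K])

interpretation K: abelian_subgroup K M by (rule submodule_abelian_subgroup)

lemma quotient_abelian_group: "abelian_group (quotient_module M K)"
proof -
  interpret Q: comm_group "M A_Mod K" by (rule K.a_factorgroup_is_comm_group)
  have c: "carrier (quotient_module M K) = carrier (M A_Mod K)"
    and a: "(\<oplus>\<^bsub>quotient_module M K\<^esub>) = mult (M A_Mod K)" and z: "\<zero>\<^bsub>quotient_module M K\<^esub> = \<one>\<^bsub>M A_Mod K\<^esub>"
    by (simp_all add: quotient_module_def A_FactGroup_def')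
  show ?thesis
    by (rule abelian_groupI; unfold c a z)
      (rule Q.m_closed Q.one_closed Q.m_assoc Q.m_comm Q.l_one Q.l_inv_ex; assumption)+
qed

text \<open>The scalar multiplication of the quotient is a union of cosets over the elements of a coset; it is a
  single coset because \<open>a K \<subseteq> K\<close>.\<close>
lemma coset_map_linear: "linear_map A M (quotient_module M K) (\<lambda>x. K +>\<^bsub>M\<^esub> x)"
  unfolding linear_map_def
proof (intro conjI ballI)
  show "(\<lambda>x. K +>\<^bsub>M\<^esub> x) \<in> carrier M \<rightarrow> carrier (quotient_module M K)"
    by (auto simp: quotient_module_def A_RCOSETS_def')
  show "K +>\<^bsub>M\<^esub> (x \<oplus>\<^bsub>M\<^esub> y) = (K +>\<^bsub>M\<^esub> x) \<oplus>\<^bsub>quotient_module M K\<^esub> (K +>\<^bsub>M\<^esub> y)"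
    if "x \<in> carrier M" "y \<in> carrier M" for x y
    using that by (simp add: quotient_module_def K.a_rcos_sum)
  fix a x assume a: "a \<in> carrier A" and x: "x \<in> carrier M"
  have eq: "K +>\<^bsub>M\<^esub> (a \<odot>\<^bsub>M\<^esub> y) = K +>\<^bsub>M\<^esub> (a \<odot>\<^bsub>M\<^esub> x)" if y: "y \<in> K +>\<^bsub>M\<^esub> x" for y
  proof -
    obtain k where k: "k \<in> K" "y = k \<oplus>\<^bsub>M\<^esub> x" using y by (auto simp: a_r_coset_def')
    then have "a \<odot>\<^bsub>M\<^esub> y = a \<odot>\<^bsub>M\<^esub> k \<oplus>\<^bsub>M\<^esub> a \<odot>\<^bsub>M\<^esub> x" using a x by (simp add: M.smult_r_distr)
    moreover have "a \<odot>\<^bsub>M\<^esub> k \<in> K" using M.submoduleE(4)[OF K a k(1)] .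
    ultimately have "a \<odot>\<^bsub>M\<^esub> y \<in> K +>\<^bsub>M\<^esub> (a \<odot>\<^bsub>M\<^esub> x)" by (auto simp: a_r_coset_def')
    then show ?thesis using K.a_repr_independence' a x by simp
  qed
  have "x \<in> K +>\<^bsub>M\<^esub> x" using x by (rule K.a_rcos_self)
  then have "(\<Union>y\<in>K +>\<^bsub>M\<^esub> x. K +>\<^bsub>M\<^esub> (a \<odot>\<^bsub>M\<^esub> x)) = K +>\<^bsub>M\<^esub> (a \<odot>\<^bsub>M\<^esub> x)"
    by (metis UN_constant empty_iff)
  then show "K +>\<^bsub>M\<^esub> (a \<odot>\<^bsub>M\<^esub> x) = a \<odot>\<^bsub>quotient_module M K\<^esub> (K +>\<^bsub>M\<^esub> x)"
    using SUP_cong[OF refl eq, of "K +>\<^bsub>M\<^esub> x" "\<lambda>y. y"] by (simp add: quotient_module_def)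
qed

lemma coset_map_surj: "carrier (quotient_module M K) = (\<lambda>x. K +>\<^bsub>M\<^esub> x) ` carrier M"
  by (auto simp: quotient_module_def A_RCOSETS_def')

lemma coset_eq_iff:
  assumes "x \<in> carrier M" "y \<in> carrier M"
  shows "K +>\<^bsub>M\<^esub> x = K +>\<^bsub>M\<^esub> y \<longleftrightarrow> x \<ominus>\<^bsub>M\<^esub> y \<in> K"
proof
  assume "K +>\<^bsub>M\<^esub> x = K +>\<^bsub>M\<^esub> y"
  then have "x \<in> K +>\<^bsub>M\<^esub> y" using K.a_rcos_self[OF assms(1)] by simp
  then obtain k where k: "k \<in> K" "x = k \<oplus>\<^bsub>M\<^esub> y" by (auto simp: a_r_coset_def')
  then have "x \<ominus>\<^bsub>M\<^esub> y = k" using assms by (simp add: M.minus_eq M.a_assoc M.r_neg)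
  then show "x \<ominus>\<^bsub>M\<^esub> y \<in> K" using k by simp
next
  assume "x \<ominus>\<^bsub>M\<^esub> y \<in> K"
  moreover have "x = (x \<ominus>\<^bsub>M\<^esub> y) \<oplus>\<^bsub>M\<^esub> y" using assms by (simp add: M.minus_eq M.a_assoc M.l_neg)
  ultimately have "x \<in> K +>\<^bsub>M\<^esub> y" by (auto simp: a_r_coset_def')
  then show "K +>\<^bsub>M\<^esub> x = K +>\<^bsub>M\<^esub> y" using K.a_repr_independence' assms by simp
qed

end


lemma regular_module_simps [simp]:
  "carrier (regular_module A) = carrier A" "\<zero>\<^bsub>regular_module A\<^esub> = \<zero>\<^bsub>A\<^esub>"
  "x \<oplus>\<^bsub>regular_module A\<^esub> y = x \<oplus>\<^bsub>A\<^esub> y" "x \<odot>\<^bsub>regular_module A\<^esub> y = x \<otimes>\<^bsub>A\<^esub> y"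
  by (simp_all add: regular_module_def)

lemma regular_module_minus [simp]:
  "\<ominus>\<^bsub>regular_module A\<^esub> x = \<ominus>\<^bsub>A\<^esub> x" "x \<ominus>\<^bsub>regular_module A\<^esub> y = x \<ominus>\<^bsub>A\<^esub> y"
  by (simp_all add: a_minus_def a_inv_def m_inv_def regular_module_def)

lemma finsum_regular_module [simp]: "finsum (regular_module A) f I = finsum A f I"
proof -
  have "finprod (add_monoid (regular_module A)) f I = finprod (add_monoid A) f I"
    by (simp add: finprod_def regular_module_def)
  then show ?thesis by (simp add: finsum_def)
qed

lemma (in abelian_group) minus_eq_zero_iff:
  assumes "x \<in> carrier G" "y \<in> carrier G" shows "x \<ominus> y = \<zero> \<longleftrightarrow> x = y"
proof
  assume "x \<ominus> y = \<zero>"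
  then have "(x \<ominus> y) \<oplus> y = y" using assms by simp
  then show "x = y" using assms by (simp add: minus_eq a_assoc l_neg)
qed (use assms in \<open>simp add: minus_eq r_neg\<close>)

section \<open>Alternating trilinear forms\<close>

text \<open>The clauses correspond one by one to the families of generators in \<open>wedge_relations\<close>.\<close>
definition alternating_trilinear ::
  "('s, 'm) ring_scheme \<Rightarrow> ('s, 'p, 'l) module_scheme \<Rightarrow> ('p \<Rightarrow> 'p \<Rightarrow> 'p \<Rightarrow> 's) \<Rightarrow> bool"
  where "alternating_trilinear S P t \<longleftrightarrow>
    (\<forall>u v w. u \<in> carrier P \<and> v \<in> carrier P \<and> w \<in> carrier P \<longrightarrow> t u v w \<in> carrier S) \<and>
    (\<forall>u u' v w. u \<in> carrier P \<and> u' \<in> carrier P \<and> v \<in> carrier P \<and> w \<in> carrier P \<longrightarrow>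
       t (u \<oplus>\<^bsub>P\<^esub> u') v w = t u v w \<oplus>\<^bsub>S\<^esub> t u' v w) \<and>
    (\<forall>u v v' w. u \<in> carrier P \<and> v \<in> carrier P \<and> v' \<in> carrier P \<and> w \<in> carrier P \<longrightarrow>
       t u (v \<oplus>\<^bsub>P\<^esub> v') w = t u v w \<oplus>\<^bsub>S\<^esub> t u v' w) \<and>
    (\<forall>u v w w'. u \<in> carrier P \<and> v \<in> carrier P \<and> w \<in> carrier P \<and> w' \<in> carrier P \<longrightarrow>
       t u v (w \<oplus>\<^bsub>P\<^esub> w') = t u v w \<oplus>\<^bsub>S\<^esub> t u v w') \<and>
    (\<forall>a u v w. a \<in> carrier S \<and> u \<in> carrier P \<and> v \<in> carrier P \<and> w \<in> carrier P \<longrightarrow>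
       t (a \<odot>\<^bsub>P\<^esub> u) v w = a \<otimes>\<^bsub>S\<^esub> t u v w) \<and>
    (\<forall>a u v w. a \<in> carrier S \<and> u \<in> carrier P \<and> v \<in> carrier P \<and> w \<in> carrier P \<longrightarrow>
       t u (a \<odot>\<^bsub>P\<^esub> v) w = a \<otimes>\<^bsub>S\<^esub> t u v w) \<and>
    (\<forall>a u v w. a \<in> carrier S \<and> u \<in> carrier P \<and> v \<in> carrier P \<and> w \<in> carrier P \<longrightarrow>
       t u v (a \<odot>\<^bsub>P\<^esub> w) = a \<otimes>\<^bsub>S\<^esub> t u v w) \<and>
    (\<forall>u w. u \<in> carrier P \<and> w \<in> carrier P \<longrightarrow> t u u w = \<zero>\<^bsub>S\<^esub>) \<and>
    (\<forall>u v. u \<in> carrier P \<and> v \<in> carrier P \<longrightarrow> t u v u = \<zero>\<^bsub>S\<^esub>) \<and>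
    (\<forall>u v. u \<in> carrier P \<and> v \<in> carrier P \<longrightarrow> t u v v = \<zero>\<^bsub>S\<^esub>)"

context
  fixes S :: "('s, 'm) ring_scheme" (structure) and P :: "('s, 'p, 'l) module_scheme" (structure) and F
  assumes P: "module S P"
  defines "F \<equiv> free_module S (carrier P \<times> carrier P \<times> carrier P)"
begin

interpretation P: module S P by (rule P)
interpretation F: module S F unfolding F_def by (rule free_module_module[OF P.is_cring])

lemma wedge_gen_closed:
  "u \<in> carrier P \<Longrightarrow> v \<in> carrier P \<Longrightarrow> w \<in> carrier P \<Longrightarrow> free_gen S (u, v, w) \<in> carrier F"
  unfolding F_def by (rule free_gen_closed[OF P.is_cring]) simp

lemma wedge_relations_closed: "wedge_relations S P \<subseteq> carrier F"
  unfolding wedge_relations_def Let_def F_def[symmetric]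
  by (auto simp: wedge_gen_closed)

text \<open>Since \<open>L (x - y) = 0\<close> means \<open>L x = L y\<close>, each family of relations turns into one clause of the
  definition of an alternating trilinear map.\<close>
lemma wedge_relations_killed_iff:
  assumes L: "linear_map S F (regular_module S) L"
  shows "(\<forall>r\<in>wedge_relations S P. L r = \<zero>) \<longleftrightarrow> alternating_trilinear S P (\<lambda>u v w. L (free_gen S (u, v, w)))"
proof -
  note lin = linear_mapD[OF L] linear_map_minus[OF F.module_axioms P.regular_module L]
  have clo: "L (free_gen S (u, v, w)) \<in> carrier S"
    if "u \<in> carrier P" "v \<in> carrier P" "w \<in> carrier P" for u v w
    using lin(1)[OF wedge_gen_closed[OF that]] by simp
  have ball2: "(\<forall>r\<in>{f a b | a b. Q a b}. T r) \<longleftrightarrow> (\<forall>a b. Q a b \<longrightarrow> T (f a b))"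
    for f :: "'x \<Rightarrow> 'y \<Rightarrow> 'z" and Q T by blast
  have ball4: "(\<forall>r\<in>{f a b c d | a b c d. Q a b c d}. T r) \<longleftrightarrow> (\<forall>a b c d. Q a b c d \<longrightarrow> T (f a b c d))"
    for f :: "'w \<Rightarrow> 'x \<Rightarrow> 'y \<Rightarrow> 'v \<Rightarrow> 'z" and Q T by blast
  show ?thesis
    unfolding wedge_relations_def alternating_trilinear_def Let_def F_def[symmetric] ball_Un
    by (simp only: ball2 ball4) (simp add: lin wedge_gen_closed clo P.R.minus_eq_zero_iff)
qed

lemma wedge_kernel_submodule: "submodule (wedge_kernel S P) S F"
  and wedge_relations_in_kernel: "wedge_relations S P \<subseteq> wedge_kernel S P"
  unfolding wedge_kernel_def F_def[symmetric]
  by (rule submodule_gen_properties[OF F.module_axioms wedge_relations_closed])+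

lemma wedge_kernel_killed:
  assumes L: "linear_map S F (regular_module S) L"
    and t: "alternating_trilinear S P (\<lambda>u v w. L (free_gen S (u, v, w)))" and k: "k \<in> wedge_kernel S P"
  shows "L k = \<zero>"
  using linear_map_kills_submodule_gen[OF F.module_axioms P.regular_module L wedge_relations_closed]
    wedge_relations_killed_iff[OF L] t k
  by (simp add: wedge_kernel_def F_def)

lemma wedge_class_linear: "linear_map S F (exterior_cube S P) (\<lambda>f. wedge_kernel S P +>\<^bsub>F\<^esub> f)"
  unfolding exterior_cube_def F_def[symmetric]
  by (rule coset_map_linear[OF F.module_axioms wedge_kernel_submodule])

lemma wedge_class: "wedge S P u v w = wedge_kernel S P +>\<^bsub>F\<^esub> free_gen S (u, v, w)"
  by (simp add: wedge_def F_def)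

lemma exterior_cube_carrier: "carrier (exterior_cube S P) = (\<lambda>f. wedge_kernel S P +>\<^bsub>F\<^esub> f) ` carrier F"
  unfolding exterior_cube_def F_def[symmetric]
  by (rule coset_map_surj[OF F.module_axioms wedge_kernel_submodule])

lemma functional_on_cube_alternating_trilinear:
  assumes L: "linear_map S (exterior_cube S P) (regular_module S) L"
  shows "alternating_trilinear S P (\<lambda>u v w. L (wedge S P u v w))"
proof -
  let ?\<pi> = "\<lambda>f. wedge_kernel S P +>\<^bsub>F\<^esub> f"
  have L\<pi>: "linear_map S F (regular_module S) (\<lambda>f. L (?\<pi> f))"
    by (rule linear_map_comp[OF wedge_class_linear L])
  have "L (?\<pi> r) = \<zero>" if r: "r \<in> wedge_relations S P" for r
  proof -
    have rF: "r \<in> carrier F" using r wedge_relations_closed by blast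
    then have "r \<ominus>\<^bsub>F\<^esub> \<zero>\<^bsub>F\<^esub> = r" by (simp add: F.minus_eq)
    then have "?\<pi> r = ?\<pi> \<zero>\<^bsub>F\<^esub>"
      using coset_eq_iff[OF F.module_axioms wedge_kernel_submodule rF, of "\<zero>\<^bsub>F\<^esub>"] r
        wedge_relations_in_kernel by auto
    then show ?thesis using linear_map_minus(1)[OF F.module_axioms P.regular_module L\<pi>] by simp
  qed
  then show ?thesis using wedge_relations_killed_iff[OF L\<pi>] by (simp add: wedge_class)
qed

text \<open>Every element of the exterior cube is a linear combination of pure wedges. This form of the statement
  avoids naming the coefficients.\<close>
lemma functional_on_cube_in_ideal:
  assumes L: "linear_map S (exterior_cube S P) (regular_module S) L" and I: "ideal I S"
    and gens: "\<And>u v w. u \<in> carrier P \<Longrightarrow> v \<in> carrier P \<Longrightarrow> w \<in> carrier P \<Longrightarrow> L (wedge S P u v w) \<in> I"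
    and X: "X \<in> carrier (exterior_cube S P)"
  shows "L X \<in> I"
proof -
  let ?\<pi> = "\<lambda>f. wedge_kernel S P +>\<^bsub>F\<^esub> f"
  have L\<pi>: "linear_map S F (regular_module S) (\<lambda>f. L (?\<pi> f))"
    by (rule linear_map_comp[OF wedge_class_linear L])
  interpret I: ideal I S by (rule I)
  have "submodule I S (regular_module S)"
  proof (rule module.submoduleI[OF P.regular_module])
  qed (use I.a_subset in \<open>auto simp: I.I_l_closed\<close>)
  then have "submodule {f \<in> carrier F. L (?\<pi> f) \<in> I} S F"
    by (rule submodule_vimage[OF F.module_axioms P.regular_module L\<pi>])
  moreover obtain f where f: "f \<in> carrier F" "X = ?\<pi> f" using X exterior_cube_carrier by blast
  moreover have "free_gen S x \<in> {f \<in> carrier F. L (?\<pi> f) \<in> I}" if "x \<in> carrier P \<times> carrier P \<times> carrier P" for x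
    using that gens wedge_gen_closed wedge_class by auto
  ultimately have "f \<in> {f \<in> carrier F. L (?\<pi> f) \<in> I}"
    using free_module_generated[OF P.is_cring, of "{f \<in> carrier F. L (?\<pi> f) \<in> I}" "carrier P \<times> carrier P \<times> carrier P" f] f(1)
    unfolding F_def by blast
  then show ?thesis using f by simp
qed

end

section \<open>Gram determinants\<close>

definition det3 :: "('s, 'm) ring_scheme \<Rightarrow> 's \<Rightarrow> 's \<Rightarrow> 's \<Rightarrow> 's \<Rightarrow> 's \<Rightarrow> 's \<Rightarrow> 's \<Rightarrow> 's \<Rightarrow> 's \<Rightarrow> 's"
  where "det3 S a1 a2 a3 b1 b2 b3 c1 c2 c3 =
     a1 \<otimes>\<^bsub>S\<^esub> (b2 \<otimes>\<^bsub>S\<^esub> c3 \<ominus>\<^bsub>S\<^esub> b3 \<otimes>\<^bsub>S\<^esub> c2)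
     \<ominus>\<^bsub>S\<^esub> a2 \<otimes>\<^bsub>S\<^esub> (b1 \<otimes>\<^bsub>S\<^esub> c3 \<ominus>\<^bsub>S\<^esub> b3 \<otimes>\<^bsub>S\<^esub> c1)
     \<oplus>\<^bsub>S\<^esub> a3 \<otimes>\<^bsub>S\<^esub> (b1 \<otimes>\<^bsub>S\<^esub> c2 \<ominus>\<^bsub>S\<^esub> b2 \<otimes>\<^bsub>S\<^esub> c1)"

context cring
begin

lemma cancel_simps: "x \<in> carrier R \<Longrightarrow> y \<in> carrier R \<Longrightarrow> x \<oplus> (\<ominus> x \<oplus> y) = y"
  "x \<in> carrier R \<Longrightarrow> y \<in> carrier R \<Longrightarrow> \<ominus> x \<oplus> (x \<oplus> y) = y"
  by (simp_all add: a_assoc[symmetric] r_neg l_neg)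

text \<open>A normal form for polynomial identities: everything multiplied out, sums and products sorted, and
  opposite summands cancelled.\<close>
lemmas expand_simps = minus_eq l_distr r_distr minus_add l_minus r_minus a_ac m_ac l_neg r_neg cancel_simps

lemma det3_closed [simp]:
  assumes "a1 \<in> carrier R" "a2 \<in> carrier R" "a3 \<in> carrier R" "b1 \<in> carrier R" "b2 \<in> carrier R" "b3 \<in> carrier R"
    "c1 \<in> carrier R" "c2 \<in> carrier R" "c3 \<in> carrier R"
  shows "det3 R a1 a2 a3 b1 b2 b3 c1 c2 c3 \<in> carrier R"
  using assms by (simp add: det3_def)

lemma det3_additive:
  assumes "a1 \<in> carrier R" "a2 \<in> carrier R" "a3 \<in> carrier R" "b1 \<in> carrier R" "b2 \<in> carrier R" "b3 \<in> carrier R"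
    "c1 \<in> carrier R" "c2 \<in> carrier R" "c3 \<in> carrier R" "x1 \<in> carrier R" "x2 \<in> carrier R" "x3 \<in> carrier R"
  shows "det3 R (a1 \<oplus> x1) (a2 \<oplus> x2) (a3 \<oplus> x3) b1 b2 b3 c1 c2 c3 =
      det3 R a1 a2 a3 b1 b2 b3 c1 c2 c3 \<oplus> det3 R x1 x2 x3 b1 b2 b3 c1 c2 c3"
    "det3 R a1 a2 a3 (b1 \<oplus> x1) (b2 \<oplus> x2) (b3 \<oplus> x3) c1 c2 c3 =
      det3 R a1 a2 a3 b1 b2 b3 c1 c2 c3 \<oplus> det3 R a1 a2 a3 x1 x2 x3 c1 c2 c3"
    "det3 R a1 a2 a3 b1 b2 b3 (c1 \<oplus> x1) (c2 \<oplus> x2) (c3 \<oplus> x3) =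
      det3 R a1 a2 a3 b1 b2 b3 c1 c2 c3 \<oplus> det3 R a1 a2 a3 b1 b2 b3 x1 x2 x3"
  using assms by (simp_all add: det3_def expand_simps)

lemma det3_homogeneous:
  assumes "a1 \<in> carrier R" "a2 \<in> carrier R" "a3 \<in> carrier R" "b1 \<in> carrier R" "b2 \<in> carrier R" "b3 \<in> carrier R"
    "c1 \<in> carrier R" "c2 \<in> carrier R" "c3 \<in> carrier R" "x \<in> carrier R"
  shows "det3 R (x \<otimes> a1) (x \<otimes> a2) (x \<otimes> a3) b1 b2 b3 c1 c2 c3 = x \<otimes> det3 R a1 a2 a3 b1 b2 b3 c1 c2 c3"
    "det3 R a1 a2 a3 (x \<otimes> b1) (x \<otimes> b2) (x \<otimes> b3) c1 c2 c3 = x \<otimes> det3 R a1 a2 a3 b1 b2 b3 c1 c2 c3"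
    "det3 R a1 a2 a3 b1 b2 b3 (x \<otimes> c1) (x \<otimes> c2) (x \<otimes> c3) = x \<otimes> det3 R a1 a2 a3 b1 b2 b3 c1 c2 c3"
  using assms by (simp_all add: det3_def expand_simps)

lemma det3_alternating:
  assumes "a1 \<in> carrier R" "a2 \<in> carrier R" "a3 \<in> carrier R" "b1 \<in> carrier R" "b2 \<in> carrier R" "b3 \<in> carrier R"
  shows "det3 R a1 a2 a3 a1 a2 a3 b1 b2 b3 = \<zero>" "det3 R a1 a2 a3 b1 b2 b3 a1 a2 a3 = \<zero>"
    "det3 R b1 b2 b3 a1 a2 a3 a1 a2 a3 = \<zero>"
  using assms by (simp_all add: det3_def expand_simps)

lemma det3_transpose:
  assumes "a1 \<in> carrier R" "a2 \<in> carrier R" "a3 \<in> carrier R" "b1 \<in> carrier R" "b2 \<in> carrier R" "b3 \<in> carrier R"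
    "c1 \<in> carrier R" "c2 \<in> carrier R" "c3 \<in> carrier R"
  shows "det3 R a1 b1 c1 a2 b2 c2 a3 b3 c3 = det3 R a1 a2 a3 b1 b2 b3 c1 c2 c3"
  using assms by (simp add: det3_def expand_simps)

end


section \<open>Hermitian spaces and their volume form\<close>

locale trivialised_space =
  fixes R :: "('r, 'm) ring_scheme"
    and S :: "('r, 's) invol_algebra" (structure)
    and P :: "('s, 'p) module" (structure)
    and h :: "'p \<Rightarrow> 'p \<Rightarrow> 's"
    and \<alpha> :: "('p \<times> 'p \<times> 'p \<Rightarrow> 's) set \<Rightarrow> 's"
  assumes R_cring: "cring R"
    and two_unit: "\<one>\<^bsub>R\<^esub> \<oplus>\<^bsub>R\<^esub> \<one>\<^bsub>R\<^esub> \<in> Units R"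
    and quadruple: "(S, P, h, \<alpha>) \<in> quadruples R"
begin

lemma etale: "quadratic_etale R S" and space: "hermitian_space S P h" and triv: "\<alpha> \<in> det_trivialisations S P h"
  using quadruple by (simp_all add: quadruples_def)

lemma algebra_S: "algebra R S" and invol: "canonical_involution R S (invol S)"
  using etale by (simp_all add: quadratic_etale_def)

lemma module_P: "module S P"
  using space by (simp add: hermitian_space_def fg_projective_def)

end

sublocale trivialised_space \<subseteq> R: cring R by (rule R_cring)
sublocale trivialised_space \<subseteq> S: cring S by (rule algebra.M_cring[OF algebra_S])
sublocale trivialised_space \<subseteq> P: module S P by (rule module_P)
sublocale trivialised_space \<subseteq> A: algebra R S by (rule algebra_S)

context trivialised_space
begin

abbreviation bar where "bar \<equiv> invol S"

lemma bar_closed [simp]: "x \<in> carrier S \<Longrightarrow> bar x \<in> carrier S"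
  and bar_bar [simp]: "x \<in> carrier S \<Longrightarrow> bar (bar x) = x"
  and bar_add [simp]: "x \<in> carrier S \<Longrightarrow> y \<in> carrier S \<Longrightarrow> bar (x \<oplus> y) = bar x \<oplus> bar y"
  and bar_mult [simp]: "x \<in> carrier S \<Longrightarrow> y \<in> carrier S \<Longrightarrow> bar (x \<otimes> y) = bar x \<otimes> bar y"
  and bar_one [simp]: "bar \<one> = \<one>"
  and bar_smult: "r \<in> carrier R \<Longrightarrow> x \<in> carrier S \<Longrightarrow> bar (r \<odot> x) = r \<odot> bar x"
  and trace_scalar: "x \<in> carrier S \<Longrightarrow> x \<oplus> bar x \<in> scalars R S"
  and norm_scalar: "x \<in> carrier S \<Longrightarrow> x \<otimes> bar x \<in> scalars R S"
  using invol unfolding canonical_involution_def by simp_all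

lemma bar_zero [simp]: "bar \<zero> = \<zero>"
  and bar_neg [simp]: "x \<in> carrier S \<Longrightarrow> bar (\<ominus> x) = \<ominus> bar x"
  and bar_minus [simp]: "x \<in> carrier S \<Longrightarrow> y \<in> carrier S \<Longrightarrow> bar (x \<ominus> y) = bar x \<ominus> bar y"
  using additive_map_zero_minus[OF S.abelian_group_axioms S.abelian_group_axioms, of bar] by simp_all

lemma h_closed [simp]: "u \<in> carrier P \<Longrightarrow> v \<in> carrier P \<Longrightarrow> h u v \<in> carrier S"
  and h_add_left: "\<lbrakk>u \<in> carrier P; v \<in> carrier P; w \<in> carrier P\<rbrakk> \<Longrightarrow> h (u \<oplus>\<^bsub>P\<^esub> v) w = h u w \<oplus> h v w"
  and h_add_right: "\<lbrakk>u \<in> carrier P; v \<in> carrier P; w \<in> carrier P\<rbrakk> \<Longrightarrow> h u (v \<oplus>\<^bsub>P\<^esub> w) = h u v \<oplus> h u w"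
  and h_smult_left: "\<lbrakk>a \<in> carrier S; u \<in> carrier P; v \<in> carrier P\<rbrakk> \<Longrightarrow> h (a \<odot>\<^bsub>P\<^esub> u) v = a \<otimes> h u v"
  and h_smult_right: "\<lbrakk>a \<in> carrier S; u \<in> carrier P; v \<in> carrier P\<rbrakk> \<Longrightarrow> h u (a \<odot>\<^bsub>P\<^esub> v) = bar a \<otimes> h u v"
  using space unfolding hermitian_space_def hermitian_form_def by blast+

lemma bar_h [simp]: "u \<in> carrier P \<Longrightarrow> v \<in> carrier P \<Longrightarrow> bar (h u v) = h v u"
  using space unfolding hermitian_space_def hermitian_form_def by metis

lemma h_minus_right: "\<lbrakk>u \<in> carrier P; v \<in> carrier P; w \<in> carrier P\<rbrakk> \<Longrightarrow> h u (v \<ominus>\<^bsub>P\<^esub> w) = h u v \<ominus> h u w"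
  using additive_map_zero_minus(3)[OF P.abelian_group_axioms S.abelian_group_axioms, of "h u"]
  by (simp add: h_add_right)

lemma h_zero_right [simp]: "u \<in> carrier P \<Longrightarrow> h u \<zero>\<^bsub>P\<^esub> = \<zero>"
  using additive_map_zero_minus(1)[OF P.abelian_group_axioms S.abelian_group_axioms, of "h u"]
  by (simp add: h_add_right)

lemma nondeg: "bij_betw (\<lambda>w. \<lambda>u\<in>carrier P. h u w) (carrier P) (Hom_mod S P (regular_module S))"
  using space by (simp add: hermitian_space_def nondegenerate_def)

lemma h_right_cancel:
  assumes "v \<in> carrier P" "w \<in> carrier P" "\<And>u. u \<in> carrier P \<Longrightarrow> h u v = h u w"
  shows "v = w"
proof -
  have "(\<lambda>u\<in>carrier P. h u v) = (\<lambda>u\<in>carrier P. h u w)" using assms(3) by (rule restrict_ext)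
  then show ?thesis using inj_onD[OF bij_betw_imp_inj_on[OF nondeg]] assms(1,2) by simp
qed

definition vol where "vol u v w = \<alpha> (wedge S P u v w)"

lemma \<alpha>_linear: "linear_map S (exterior_cube S P) (regular_module S) \<alpha>"
  using triv unfolding det_trivialisations_def hermitian_iso_def by (simp add: Hom_mod_linear)

lemma vol_alternating_trilinear: "alternating_trilinear S P vol"
  unfolding vol_def by (rule functional_on_cube_alternating_trilinear[OF module_P \<alpha>_linear])

lemma vol_closed [simp]: "\<lbrakk>u \<in> carrier P; v \<in> carrier P; w \<in> carrier P\<rbrakk> \<Longrightarrow> vol u v w \<in> carrier S"
  and vol_add: "\<lbrakk>u \<in> carrier P; u' \<in> carrier P; v \<in> carrier P; w \<in> carrier P\<rbrakk> \<Longrightarrow> vol (u \<oplus>\<^bsub>P\<^esub> u') v w = vol u v w \<oplus> vol u' v w"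
   "\<lbrakk>u \<in> carrier P; v \<in> carrier P; v' \<in> carrier P; w \<in> carrier P\<rbrakk> \<Longrightarrow> vol u (v \<oplus>\<^bsub>P\<^esub> v') w = vol u v w \<oplus> vol u v' w"
   "\<lbrakk>u \<in> carrier P; v \<in> carrier P; w \<in> carrier P; w' \<in> carrier P\<rbrakk> \<Longrightarrow> vol u v (w \<oplus>\<^bsub>P\<^esub> w') = vol u v w \<oplus> vol u v w'"
  and vol_smult: "\<lbrakk>a \<in> carrier S; u \<in> carrier P; v \<in> carrier P; w \<in> carrier P\<rbrakk> \<Longrightarrow> vol (a \<odot>\<^bsub>P\<^esub> u) v w = a \<otimes> vol u v w"
   "\<lbrakk>a \<in> carrier S; u \<in> carrier P; v \<in> carrier P; w \<in> carrier P\<rbrakk> \<Longrightarrow> vol u (a \<odot>\<^bsub>P\<^esub> v) w = a \<otimes> vol u v w"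
   "\<lbrakk>a \<in> carrier S; u \<in> carrier P; v \<in> carrier P; w \<in> carrier P\<rbrakk> \<Longrightarrow> vol u v (a \<odot>\<^bsub>P\<^esub> w) = a \<otimes> vol u v w"
  and vol_repeat [simp]: "\<lbrakk>u \<in> carrier P; w \<in> carrier P\<rbrakk> \<Longrightarrow> vol u u w = \<zero>"
   "\<lbrakk>u \<in> carrier P; v \<in> carrier P\<rbrakk> \<Longrightarrow> vol u v u = \<zero>"
   "\<lbrakk>u \<in> carrier P; v \<in> carrier P\<rbrakk> \<Longrightarrow> vol u v v = \<zero>"
  using vol_alternating_trilinear unfolding alternating_trilinear_def by simp_all

lemma vol_swap12:
  assumes "u \<in> carrier P" "v \<in> carrier P" "w \<in> carrier P"
  shows "vol v u w = \<ominus> vol u v w"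
proof -
  have "\<zero> = vol (u \<oplus>\<^bsub>P\<^esub> v) (u \<oplus>\<^bsub>P\<^esub> v) w" using assms by simp
  also have "\<dots> = vol u (u \<oplus>\<^bsub>P\<^esub> v) w \<oplus> vol v (u \<oplus>\<^bsub>P\<^esub> v) w" by (rule vol_add(1)) (use assms in simp_all)
  also have "\<dots> = vol u v w \<oplus> vol v u w" using assms by (simp add: vol_add)
  finally show ?thesis using assms by (metis S.minus_equality S.a_comm vol_closed)
qed

lemma vol_swap23:
  assumes "u \<in> carrier P" "v \<in> carrier P" "w \<in> carrier P"
  shows "vol u w v = \<ominus> vol u v w"
proof -
  have "\<zero> = vol u (v \<oplus>\<^bsub>P\<^esub> w) (v \<oplus>\<^bsub>P\<^esub> w)" using assms by simp
  also have "\<dots> = vol u v (v \<oplus>\<^bsub>P\<^esub> w) \<oplus> vol u w (v \<oplus>\<^bsub>P\<^esub> w)" by (rule vol_add(2)) (use assms in simp_all)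
  also have "\<dots> = vol u v w \<oplus> vol u w v" using assms by (simp add: vol_add)
  finally show ?thesis using assms by (metis S.minus_equality S.a_comm vol_closed)
qed

lemma vol_cycle:
  assumes "u \<in> carrier P" "v \<in> carrier P" "w \<in> carrier P"
  shows "vol v w u = vol u v w"
  using assms vol_swap12[of u v w] vol_swap23[of v u w] by simp

text \<open>The functional \<open>\<alpha>\<close> is onto, so it takes the value \<open>1\<close> at some combination of wedges. The lemma replaces
  the choice of a basis of \<open>P\<close>: a property of scalars that defines an ideal need only be checked for the values
  of \<open>vol\<close>.\<close>
lemma vol_values_generate:
  assumes I: "ideal I S"
    and vol: "\<And>u v w. u \<in> carrier P \<Longrightarrow> v \<in> carrier P \<Longrightarrow> w \<in> carrier P \<Longrightarrow> vol u v w \<in> I"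
  shows "\<one> \<in> I"
proof -
  have "bij_betw \<alpha> (carrier (exterior_cube S P)) (carrier S)"
    using triv unfolding det_trivialisations_def hermitian_iso_def by simp
  then have "\<one> \<in> \<alpha> ` carrier (exterior_cube S P)" by (simp add: bij_betw_imp_surj_on)
  then obtain X where "X \<in> carrier (exterior_cube S P)" "\<one> = \<alpha> X" by (rule imageE)
  then show ?thesis
    using functional_on_cube_in_ideal[OF module_P \<alpha>_linear I] vol by (simp add: vol_def)
qed

lemma gram_det3: "gram_det S h (u1, u2, u3) (v1, v2, v3) =
    det3 S (h u1 v1) (h u1 v2) (h u1 v3) (h u2 v1) (h u2 v2) (h u2 v3) (h u3 v1) (h u3 v2) (h u3 v3)"
  by (simp add: gram_det_def det3_def)

lemma gram_det_closed:
  assumes "x \<in> carrier P \<times> carrier P \<times> carrier P" "y \<in> carrier P \<times> carrier P \<times> carrier P"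
  shows "gram_det S h x y \<in> carrier S"
  using assms by (auto simp: gram_det3)

lemma bar_gram_det:
  assumes "x \<in> carrier P \<times> carrier P \<times> carrier P" "y \<in> carrier P \<times> carrier P \<times> carrier P"
  shows "bar (gram_det S h x y) = gram_det S h y x"
proof -
  obtain u1 u2 u3 v1 v2 v3 where xy: "x = (u1, u2, u3)" "y = (v1, v2, v3)"
    and c: "u1 \<in> carrier P" "u2 \<in> carrier P" "u3 \<in> carrier P" "v1 \<in> carrier P" "v2 \<in> carrier P" "v3 \<in> carrier P"
    using assms by auto
  have "bar (gram_det S h x y) =
    det3 S (h v1 u1) (h v2 u1) (h v3 u1) (h v1 u2) (h v2 u2) (h v3 u2) (h v1 u3) (h v2 u3) (h v3 u3)"
    using c by (simp add: xy gram_det3 det3_def)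
  also have "\<dots> = gram_det S h y x"
    unfolding xy gram_det3 by (rule S.det3_transpose; simp add: c)
  finally show ?thesis .
qed

lemma gram_det_alternating_trilinear:
  assumes "y \<in> carrier P \<times> carrier P \<times> carrier P"
  shows "alternating_trilinear S P (\<lambda>u v w. gram_det S h (u, v, w) y)"
  using assms unfolding alternating_trilinear_def
  by (auto simp: gram_det3 h_add_left h_smult_left S.det3_additive S.det3_homogeneous S.det3_alternating)

end


lemma linear_map_combination:
  assumes "module A M" "cring A" "linear_map A M (regular_module A) L" "linear_map A M (regular_module A) L'"
  shows "linear_map A M (regular_module A) (\<lambda>x. L x \<oplus>\<^bsub>A\<^esub> L' x)"
    "c \<in> carrier A \<Longrightarrow> linear_map A M (regular_module A) (\<lambda>x. c \<otimes>\<^bsub>A\<^esub> L x)"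
proof -
  interpret A: cring A by fact
  note * = linear_mapD[OF assms(3)] linear_mapD[OF assms(4)]
  show "linear_map A M (regular_module A) (\<lambda>x. L x \<oplus>\<^bsub>A\<^esub> L' x)"
    using * by (auto simp: linear_map_def A.r_distr A.a_ac)
  show "linear_map A M (regular_module A) (\<lambda>x. c \<otimes>\<^bsub>A\<^esub> L x)" if "c \<in> carrier A"
    using * that by (auto simp: linear_map_def A.r_distr A.m_ac)
qed

context trivialised_space
begin

abbreviation "triples \<equiv> carrier P \<times> carrier P \<times> carrier P"
abbreviation "F \<equiv> free_module S triples"
text \<open>The linear extension of the Gram determinant in its first argument, and its extension to both
  arguments, linear in the first and semilinear in the second. The latter is the double sum in the definition
  of \<open>wedge_form\<close> (lemma \<open>sesqui_ext_sum\<close>).\<close>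
abbreviation "gram_ext \<equiv> \<lambda>y. linear_ext S (regular_module S) (\<lambda>x. gram_det S h x y)"
abbreviation "sesqui_ext \<equiv> \<lambda>g. linear_ext S (regular_module S) (\<lambda>x. bar (gram_ext x g))"

lemma module_F: "module S F" by (rule free_module_module[OF S.is_cring])

lemma gram_ext_linear: "y \<in> triples \<Longrightarrow> linear_map S F (regular_module S) (gram_ext y)"
  by (rule linear_ext_linear[OF S.is_cring S.regular_module]) (simp only: gram_det_closed regular_module_simps)

lemma gram_ext_gen: "x \<in> triples \<Longrightarrow> y \<in> triples \<Longrightarrow> gram_ext y (free_gen S x) = gram_det S h x y"
  by (rule linear_ext_gen[OF S.is_cring S.regular_module]) (simp_all only: gram_det_closed regular_module_simps)

lemma gram_ext_closed: "y \<in> triples \<Longrightarrow> g \<in> carrier F \<Longrightarrow> gram_ext y g \<in> carrier S"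
  using linear_mapD(1)[OF gram_ext_linear] by simp

lemma gram_ext_kernel:
  assumes y: "y \<in> triples" and k: "k \<in> wedge_kernel S P" shows "gram_ext y k = \<zero>"
proof (rule wedge_kernel_killed[OF module_P gram_ext_linear[OF y] _ k])
  have "alternating_trilinear S P (\<lambda>u v w. gram_ext y (free_gen S (u, v, w))) =
      alternating_trilinear S P (\<lambda>u v w. gram_det S h (u, v, w) y)"
    unfolding alternating_trilinear_def using y by (simp add: gram_ext_gen P.smult_closed)
  then show "alternating_trilinear S P (\<lambda>u v w. gram_ext y (free_gen S (u, v, w)))"
    using gram_det_alternating_trilinear[OF y] by simp
qed

lemma sesqui_ext_linear: "g \<in> carrier F \<Longrightarrow> linear_map S F (regular_module S) (sesqui_ext g)"
  by (rule linear_ext_linear[OF S.is_cring S.regular_module])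
    (simp only: gram_ext_closed bar_closed regular_module_simps)

lemma sesqui_ext_gen: "x \<in> triples \<Longrightarrow> g \<in> carrier F \<Longrightarrow> sesqui_ext g (free_gen S x) = bar (gram_ext x g)"
  by (rule linear_ext_gen[OF S.is_cring S.regular_module])
    (simp_all only: gram_ext_closed bar_closed regular_module_simps)

lemma sesqui_ext_gen_right:
  assumes y: "y \<in> triples" and f: "f \<in> carrier F"
  shows "sesqui_ext (free_gen S y) f = gram_ext y f"
proof (rule linear_maps_eq_on_free_module[OF S.is_cring S.regular_module _ gram_ext_linear[OF y] _ f])
  have gy: "free_gen S y \<in> carrier F" by (rule free_gen_closed[OF S.is_cring y])
  then show "linear_map S F (regular_module S) (sesqui_ext (free_gen S y))" by (rule sesqui_ext_linear)
  fix x assume x: "x \<in> triples"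
  show "sesqui_ext (free_gen S y) (free_gen S x) = gram_ext y (free_gen S x)"
    by (simp only: sesqui_ext_gen[OF x gy] gram_ext_gen[OF y x] gram_ext_gen[OF x y] bar_gram_det[OF y x])
qed

text \<open>Semilinearity in the second argument. For a fixed second argument both sides of each equation are linear
  in the first argument, so the equation need only be tested on generators.\<close>
lemma bar_sesqui_ext_linear:
  assumes f: "f \<in> carrier F"
  shows "linear_map S F (regular_module S) (\<lambda>g. bar (sesqui_ext g f))"
proof -
  interpret F: module S F by (rule module_F)
  have clo: "sesqui_ext g f \<in> carrier S" if "g \<in> carrier F" for g
    using linear_mapD(1)[OF sesqui_ext_linear[OF that] f] by simp
  have add: "sesqui_ext (g \<oplus>\<^bsub>F\<^esub> g') f = sesqui_ext g f \<oplus> sesqui_ext g' f"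
    if g: "g \<in> carrier F" "g' \<in> carrier F" for g g'
  proof (rule linear_maps_eq_on_free_module[OF S.is_cring S.regular_module _ _ _ f])
    show "linear_map S F (regular_module S) (sesqui_ext (g \<oplus>\<^bsub>F\<^esub> g'))"
      by (rule sesqui_ext_linear) (rule F.a_closed[OF g])
    show "linear_map S F (regular_module S) (\<lambda>f. sesqui_ext g f \<oplus> sesqui_ext g' f)"
      by (rule linear_map_combination(1)[OF module_F S.is_cring]) (rule sesqui_ext_linear, rule g)+
    fix x assume x: "x \<in> triples"
    show "sesqui_ext (g \<oplus>\<^bsub>F\<^esub> g') (free_gen S x) = sesqui_ext g (free_gen S x) \<oplus> sesqui_ext g' (free_gen S x)"
      using linear_mapD(2)[OF gram_ext_linear[OF x] g]
      by (simp only: sesqui_ext_gen[OF x] F.a_closed g regular_module_simps bar_add gram_ext_closed[OF x])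
  qed
  have smult: "sesqui_ext (a \<odot>\<^bsub>F\<^esub> g) f = bar a \<otimes> sesqui_ext g f"
    if a: "a \<in> carrier S" and g: "g \<in> carrier F" for a g
  proof (rule linear_maps_eq_on_free_module[OF S.is_cring S.regular_module _ _ _ f])
    show "linear_map S F (regular_module S) (sesqui_ext (a \<odot>\<^bsub>F\<^esub> g))"
      by (rule sesqui_ext_linear) (rule F.smult_closed[OF a g])
    show "linear_map S F (regular_module S) (\<lambda>f. bar a \<otimes> sesqui_ext g f)"
      by (rule linear_map_combination(2)[OF module_F S.is_cring]) (rule sesqui_ext_linear[OF g] bar_closed[OF a])+
    fix x assume x: "x \<in> triples"
    show "sesqui_ext (a \<odot>\<^bsub>F\<^esub> g) (free_gen S x) = bar a \<otimes> sesqui_ext g (free_gen S x)"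
      using linear_mapD(3)[OF gram_ext_linear[OF x] a g]
      by (simp only: sesqui_ext_gen[OF x] F.smult_closed a g regular_module_simps bar_mult gram_ext_closed[OF x])
  qed
  show ?thesis
    unfolding linear_map_def
    using clo by (auto simp: add smult simp del: mem_Times_iff)
qed

text \<open>By semilinearity it suffices to let \<open>g\<close> be a generator, and then the extension is the linear extension of
  an alternating trilinear form.\<close>
lemma sesqui_ext_kernel_right:
  assumes k: "k \<in> wedge_kernel S P" "k \<in> carrier F" and g: "g \<in> carrier F"
  shows "sesqui_ext g k = \<zero>"
proof -
  have "bar (sesqui_ext g k) = \<zero>"
  proof (rule linear_maps_eq_on_free_module[OF S.is_cring S.regular_module bar_sesqui_ext_linear[OF k(2)] _ _ g])
    show "linear_map S F (regular_module S) (\<lambda>f. \<zero>)" by (simp add: linear_map_def)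
    fix y assume y: "y \<in> triples"
    show "bar (sesqui_ext (free_gen S y) k) = \<zero>"
      by (simp only: sesqui_ext_gen_right[OF y k(2)] gram_ext_kernel[OF y k(1)] bar_zero)
  qed
  moreover have "sesqui_ext g k \<in> carrier S" using linear_mapD(1)[OF sesqui_ext_linear[OF g] k(2)] by simp
  ultimately show ?thesis by (metis bar_bar bar_zero)
qed

lemma free_module_support:
  assumes "f \<in> carrier F"
  shows "finite {x. f x \<noteq> \<zero>}" "{x. f x \<noteq> \<zero>} \<subseteq> triples" "f x \<in> carrier S"
  using assms unfolding free_module_mem[OF S.is_cring] by blast+

lemma sesqui_ext_sum:
  assumes f: "f \<in> carrier F" and g: "g \<in> carrier F"
  shows "(\<Oplus>x\<in>{x. f x \<noteq> \<zero>}. \<Oplus>y\<in>{y. g y \<noteq> \<zero>}. f x \<otimes> bar (g y) \<otimes> gram_det S h x y) = sesqui_ext g f"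
proof -
  have inner: "(\<Oplus>y\<in>{y. g y \<noteq> \<zero>}. f x \<otimes> bar (g y) \<otimes> gram_det S h x y) = f x \<otimes> bar (gram_ext x g)"
    if x: "x \<in> triples" for x
  proof -
    have tm: "g y \<otimes> gram_det S h y x \<in> carrier S" if "y \<in> {y. g y \<noteq> \<zero>}" for y
    proof -
      have "y \<in> triples" using that free_module_support(2)[OF g] by (rule rev_subsetD)
      then show ?thesis by (simp only: free_module_support(3)[OF g] gram_det_closed x S.m_closed)
    qed
    have "bar (gram_ext x g) = bar (\<Oplus>y\<in>{y. g y \<noteq> \<zero>}. g y \<otimes> gram_det S h y x)"
      by (simp only: linear_ext_def[OF S.is_cring] finsum_regular_module regular_module_simps)
    also have "\<dots> = (\<Oplus>y\<in>{y. g y \<noteq> \<zero>}. bar (g y \<otimes> gram_det S h y x))"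
      by (rule additive_map_finsum[OF S.abelian_group_axioms S.abelian_group_axioms])
        (simp_all add: free_module_support(1)[OF g] tm[simplified] Pi_def)
    finally have "f x \<otimes> bar (gram_ext x g) = f x \<otimes> (\<Oplus>y\<in>{y. g y \<noteq> \<zero>}. bar (g y \<otimes> gram_det S h y x))" by simp
    also have "\<dots> = (\<Oplus>y\<in>{y. g y \<noteq> \<zero>}. f x \<otimes> bar (g y \<otimes> gram_det S h y x))"
      by (rule S.finsum_rdistr)
        (simp_all add: free_module_support(1)[OF g] free_module_support(3)[OF f] tm[simplified] Pi_def)
    also have "\<dots> = (\<Oplus>y\<in>{y. g y \<noteq> \<zero>}. f x \<otimes> bar (g y) \<otimes> gram_det S h x y)"
    proof (rule S.finsum_cong'[OF refl])
      have yt: "y \<in> triples" if "y \<in> {y. g y \<noteq> \<zero>}" for y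
        using that free_module_support(2)[OF g] by (rule rev_subsetD)
      show "(\<lambda>y. f x \<otimes> bar (g y) \<otimes> gram_det S h x y) \<in> {y. g y \<noteq> \<zero>} \<rightarrow> carrier S"
        by (rule Pi_I) (simp only: free_module_support(3)[OF f] free_module_support(3)[OF g]
          gram_det_closed x S.m_closed bar_closed yt)
      show "f x \<otimes> bar (g y \<otimes> gram_det S h y x) = f x \<otimes> bar (g y) \<otimes> gram_det S h x y" if "y \<in> {y. g y \<noteq> \<zero>}" for y
        by (simp only: free_module_support(3)[OF f] free_module_support(3)[OF g]
          gram_det_closed x S.m_closed bar_closed yt[OF that] bar_mult bar_gram_det S.m_assoc)
    qed
    finally show ?thesis by simp
  qed
  show ?thesis
    unfolding linear_ext_def[OF S.is_cring, of "regular_module S" "\<lambda>x. bar (gram_ext x g)"] finsum_regular_module regular_module_simps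
  proof (rule S.finsum_cong'[OF refl])
    have xt: "x \<in> triples" if "x \<in> {x. f x \<noteq> \<zero>}" for x
      using that free_module_support(2)[OF f] by (rule rev_subsetD)
    show "(\<lambda>x. f x \<otimes> bar (gram_ext x g)) \<in> {x. f x \<noteq> \<zero>} \<rightarrow> carrier S"
      by (rule Pi_I) (simp only: free_module_support(3)[OF f] gram_ext_closed g xt bar_closed S.m_closed)
  qed (rule inner, erule rev_subsetD[OF _ free_module_support(2)[OF f]])
qed

text \<open>The double sum does not depend on the representatives of the two wedges, so the definite description
  has a solution; it is unique because the wedges are nonempty as cosets.\<close>
lemma wedge_form_wedge:
  assumes x: "u1 \<in> carrier P" "u2 \<in> carrier P" "u3 \<in> carrier P"
    and y: "v1 \<in> carrier P" "v2 \<in> carrier P" "v3 \<in> carrier P"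
  shows "wedge_form S h (wedge S P u1 u2 u3) (wedge S P v1 v2 v3) = gram_det S h (u1, u2, u3) (v1, v2, v3)"
proof -
  let ?x = "(u1, u2, u3)" and ?y = "(v1, v2, v3)"
  interpret F: module S F by (rule module_F)
  have K: "submodule (wedge_kernel S P) S F" by (rule wedge_kernel_submodule[OF module_P])
  interpret K: abelian_subgroup "wedge_kernel S P" F by (rule submodule_abelian_subgroup[OF module_F K])
  have xt: "?x \<in> triples" and yt: "?y \<in> triples" using x y by simp_all
  note gx = free_gen_closed[OF S.is_cring xt] and gy = free_gen_closed[OF S.is_cring yt]
  have val: "(\<Oplus>x\<in>{x. f x \<noteq> \<zero>}. \<Oplus>y\<in>{y. g y \<noteq> \<zero>}. f x \<otimes> bar (g y) \<otimes> gram_det S h x y) = gram_det S h ?x ?y"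
    if "f \<in> wedge S P u1 u2 u3" "g \<in> wedge S P v1 v2 v3" for f g
  proof -
    obtain k where k: "k \<in> wedge_kernel S P" "f = k \<oplus>\<^bsub>F\<^esub> free_gen S ?x"
      using \<open>f \<in> _\<close> by (auto simp: wedge_def a_r_coset_def')
    obtain l where l: "l \<in> wedge_kernel S P" "g = l \<oplus>\<^bsub>F\<^esub> free_gen S ?y"
      using \<open>g \<in> _\<close> by (auto simp: wedge_def a_r_coset_def')
    have kF: "k \<in> carrier F" and lF: "l \<in> carrier F" using k(1) l(1) F.submoduleE(1)[OF K] by blast+
    have fF: "f \<in> carrier F" and gF: "g \<in> carrier F"
      unfolding k(2) l(2) by (rule F.a_closed[OF kF gx] F.a_closed[OF lF gy])+
    have "sesqui_ext g f = sesqui_ext g k \<oplus> sesqui_ext g (free_gen S ?x)"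
      unfolding k(2) using linear_mapD(2)[OF sesqui_ext_linear[OF gF] kF gx] by simp
    also have "\<dots> = bar (gram_ext ?x g)"
      by (simp only: sesqui_ext_kernel_right[OF k(1) kF gF] sesqui_ext_gen[OF xt gF] S.l_zero
        bar_closed gram_ext_closed xt gF)
    also have "gram_ext ?x g = gram_ext ?x l \<oplus> gram_ext ?x (free_gen S ?y)"
      unfolding l(2) using linear_mapD(2)[OF gram_ext_linear[OF xt] lF gy] by simp
    also have "\<dots> = gram_det S h ?y ?x"
      by (simp only: gram_ext_kernel[OF xt l(1)] gram_ext_gen[OF yt xt] S.l_zero gram_det_closed xt yt)
    also have "bar \<dots> = gram_det S h ?x ?y" by (rule bar_gram_det[OF yt xt])
    finally show ?thesis using sesqui_ext_sum[OF fF gF] by simp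
  qed
  have inx: "free_gen S ?x \<in> wedge S P u1 u2 u3" and iny: "free_gen S ?y \<in> wedge S P v1 v2 v3"
    unfolding wedge_def by (rule K.a_rcos_self, rule gx gy)+
  show ?thesis
    unfolding wedge_form_def
  proof (rule the_equality)
    fix c assume c: "\<forall>f\<in>wedge S P u1 u2 u3. \<forall>g\<in>wedge S P v1 v2 v3.
       c = (\<Oplus>x\<in>{x. f x \<noteq> \<zero>}. \<Oplus>y\<in>{y. g y \<noteq> \<zero>}. f x \<otimes> bar (g y) \<otimes> gram_det S h x y)"
    show "c = gram_det S h ?x ?y" by (rule trans[OF bspec[OF bspec[OF c inx] iny] val[OF inx iny]])
  qed (intro ballI, rule val[symmetric])
qed

text \<open>The isometry property of \<open>\<alpha>\<close>, evaluated at pure wedges.\<close>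
lemma gram_det_vol:
  assumes x: "u1 \<in> carrier P" "u2 \<in> carrier P" "u3 \<in> carrier P"
    and y: "v1 \<in> carrier P" "v2 \<in> carrier P" "v3 \<in> carrier P"
  shows "det3 S (h u1 v1) (h u1 v2) (h u1 v3) (h u2 v1) (h u2 v2) (h u2 v3) (h u3 v1) (h u3 v2) (h u3 v3) =
    vol u1 u2 u3 \<otimes> bar (vol v1 v2 v3)"
proof -
  have cube: "wedge S P u v w \<in> carrier (exterior_cube S P)"
    if "u \<in> carrier P" "v \<in> carrier P" "w \<in> carrier P" for u v w
    unfolding exterior_cube_carrier[OF module_P] wedge_class[OF module_P]
    by (rule imageI) (rule wedge_gen_closed[OF module_P that])
  have "unit_form S (\<alpha> X) (\<alpha> Y) = wedge_form S h X Y"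
    if "X \<in> carrier (exterior_cube S P)" "Y \<in> carrier (exterior_cube S P)" for X Y
    using triv that unfolding det_trivialisations_def hermitian_iso_def by simp
  then show ?thesis
    using cube[OF x] cube[OF y] wedge_form_wedge[OF x y] by (simp add: gram_det3 unit_form_def vol_def)
qed

end


section \<open>Constant rank and Cramer's rule\<close>

text \<open>If the images of \<open>b\<^sub>0, \<dots>, b\<^sub>n\<^sub>-\<^sub>1\<close> vanish in the localisation at \<open>\<pp>\<close> then so does the image of every \<open>x\<close>. The
  denominators are multiplied together; the product stays outside \<open>\<pp>\<close>.\<close>
lemma (in module) local_vanishing_from_generators:
  assumes p: "primeideal \<pp> R" and b: "b \<in> {..<n::nat} \<rightarrow> carrier M"
    and span: "\<exists>s \<in> carrier R - \<pp>. \<exists>c \<in> {..<n} \<rightarrow> carrier R. s \<odot>\<^bsub>M\<^esub> x = (\<Oplus>\<^bsub>M\<^esub>i\<in>{..<n}. c i \<odot>\<^bsub>M\<^esub> b i)"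
    and L: "linear_map R M (regular_module R) L"
    and zero: "\<And>i. i < n \<Longrightarrow> \<exists>t\<in>carrier R - \<pp>. t \<otimes> L (b i) = \<zero>" and x: "x \<in> carrier M"
  shows "\<exists>t\<in>carrier R - \<pp>. t \<otimes> L x = \<zero>"
proof -
  interpret p: primeideal \<pp> R by (rule p)
  have lin: "\<And>x. x \<in> carrier M \<Longrightarrow> L x \<in> carrier R"
    "\<And>x y. x \<in> carrier M \<Longrightarrow> y \<in> carrier M \<Longrightarrow> L (x \<oplus>\<^bsub>M\<^esub> y) = L x \<oplus> L y"
    "\<And>a x. a \<in> carrier R \<Longrightarrow> x \<in> carrier M \<Longrightarrow> L (a \<odot>\<^bsub>M\<^esub> x) = a \<otimes> L x"
    using linear_mapD[OF L] by simp_all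
  have mult: "s \<otimes> t \<in> carrier R - \<pp>" if "s \<in> carrier R - \<pp>" "t \<in> carrier R - \<pp>" for s t
    using that p.I_prime by auto
  have bi: "b i \<in> carrier M" if "i < n" for i using b that by auto
  have "k \<le> n \<Longrightarrow> \<exists>t\<in>carrier R - \<pp>. \<forall>i<k. t \<otimes> L (b i) = \<zero>" for k
  proof (induction k)
    case 0
    have "\<one> \<in> carrier R - \<pp>" using p.I_notcarr p.one_imp_carrier by auto
    then show ?case by auto
  next
    case (Suc k)
    then obtain t where t: "t \<in> carrier R - \<pp>" "\<forall>i<k. t \<otimes> L (b i) = \<zero>" by auto
    obtain s where s: "s \<in> carrier R - \<pp>" "s \<otimes> L (b k) = \<zero>" using zero[of k] Suc.prems by auto
    have "(s \<otimes> t) \<otimes> L (b i) = \<zero>" if i: "i < Suc k" for i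
    proof (cases "i = k")
      case True
      have "(s \<otimes> t) \<otimes> L (b k) = t \<otimes> (s \<otimes> L (b k))"
        using s(1) t(1) lin(1)[OF bi[of k]] Suc.prems by (simp add: R.m_ac)
      then show ?thesis using True s t(1) by simp
    next
      case False
      have "(s \<otimes> t) \<otimes> L (b i) = s \<otimes> (t \<otimes> L (b i))"
        using s(1) t(1) lin(1)[OF bi[of i]] i Suc.prems by (simp add: R.m_ac)
      then show ?thesis using False s(1) t(2) i by simp
    qed
    then show ?case using mult[OF s(1) t(1)] by blast
  qed
  then obtain t where t: "t \<in> carrier R - \<pp>" "\<forall>i<n. t \<otimes> L (b i) = \<zero>" by auto
  obtain s c where s: "s \<in> carrier R - \<pp>" and c: "c \<in> {..<n} \<rightarrow> carrier R"
    and sx: "s \<odot>\<^bsub>M\<^esub> x = (\<Oplus>\<^bsub>M\<^esub>i\<in>{..<n}. c i \<odot>\<^bsub>M\<^esub> b i)" using span by auto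
  have ci: "c i \<in> carrier R" if "i < n" for i using c that by auto
  have "(t \<otimes> s) \<otimes> L x = t \<otimes> L (s \<odot>\<^bsub>M\<^esub> x)"
    using s t(1) x by (simp add: lin R.m_assoc)
  also have "\<dots> = t \<otimes> L (\<Oplus>\<^bsub>M\<^esub>i\<in>{..<n}. c i \<odot>\<^bsub>M\<^esub> b i)" by (simp only: sx)
  also have "\<dots> = (\<Oplus>i\<in>{..<n}. t \<otimes> L (c i \<odot>\<^bsub>M\<^esub> b i))"
    by (rule additive_map_finsum[OF M.abelian_group_axioms R.abelian_group_axioms])
      (use t(1) in \<open>auto simp: lin R.r_distr ci bi\<close>)
  also have "\<dots> = \<zero>"
  proof (rule R.add.finprod_one_eqI)
    fix i assume "i \<in> {..<n}"
    then have i: "i < n" by simp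
    have "t \<otimes> L (c i \<odot>\<^bsub>M\<^esub> b i) = c i \<otimes> (t \<otimes> L (b i))"
      using t(1) i by (simp add: lin ci bi R.m_ac)
    then show "t \<otimes> L (c i \<odot>\<^bsub>M\<^esub> b i) = \<zero>" using t(2) i ci by simp
  qed
  finally show ?thesis using mult[OF t(1) s] by blast
qed

text \<open>At a prime three vectors span. Four of them, chosen with repetition, cannot be distinct, so \<open>\<Psi>\<close> vanishes on
  them; the four arguments are then freed one after the other.\<close>
lemma (in module) alternating_four_linear_vanishes:
  assumes rank: "constant_rank R M 3"
    and lin: "\<And>v w x. \<lbrakk>v \<in> carrier M; w \<in> carrier M; x \<in> carrier M\<rbrakk> \<Longrightarrow> linear_map R M (regular_module R) (\<lambda>u. \<Psi> u v w x)"
      "\<And>u w x. \<lbrakk>u \<in> carrier M; w \<in> carrier M; x \<in> carrier M\<rbrakk> \<Longrightarrow> linear_map R M (regular_module R) (\<lambda>v. \<Psi> u v w x)"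
      "\<And>u v x. \<lbrakk>u \<in> carrier M; v \<in> carrier M; x \<in> carrier M\<rbrakk> \<Longrightarrow> linear_map R M (regular_module R) (\<lambda>w. \<Psi> u v w x)"
      "\<And>u v w. \<lbrakk>u \<in> carrier M; v \<in> carrier M; w \<in> carrier M\<rbrakk> \<Longrightarrow> linear_map R M (regular_module R) (\<lambda>x. \<Psi> u v w x)"
    and alt: "\<And>u v w. \<lbrakk>u \<in> carrier M; v \<in> carrier M; w \<in> carrier M\<rbrakk> \<Longrightarrow>
       \<Psi> u u v w = \<zero> \<and> \<Psi> u v u w = \<zero> \<and> \<Psi> u v w u = \<zero> \<and> \<Psi> u v v w = \<zero> \<and> \<Psi> u v w v = \<zero> \<and> \<Psi> u v w w = \<zero>"
    and u: "u \<in> carrier M" and v: "v \<in> carrier M" and w: "w \<in> carrier M" and x: "x \<in> carrier M"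
  shows "\<Psi> u v w x = \<zero>"
proof (rule R.locally_zero_imp_zero)
  show "\<Psi> u v w x \<in> carrier R" using linear_mapD(1)[OF lin(1)[OF v w x] u] by simp
  fix \<pp> assume p: "primeideal \<pp> R"
  then have "free_at_prime R M \<pp> 3" using rank unfolding constant_rank_def by blast
  then obtain b where b: "b \<in> {..<3::nat} \<rightarrow> carrier M"
    and span: "\<And>x. x \<in> carrier M \<Longrightarrow> \<exists>s \<in> carrier R - \<pp>. \<exists>c \<in> {..<3::nat} \<rightarrow> carrier R. s \<odot>\<^bsub>M\<^esub> x = (\<Oplus>\<^bsub>M\<^esub>i\<in>{..<3}. c i \<odot>\<^bsub>M\<^esub> b i)"
    unfolding free_at_prime_def by auto
  note spread = local_vanishing_from_generators[OF p b span]
  have bi: "b i \<in> carrier M" if "i < 3" for i using b that by auto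
  have one: "\<one> \<in> carrier R - \<pp>" using primeideal.I_notcarr[OF p] ideal.one_imp_carrier[OF primeideal.axioms(1)[OF p]] by auto
  have bbbb: "\<exists>t\<in>carrier R - \<pp>. t \<otimes> \<Psi> (b i) (b j) (b k) (b l) = \<zero>"
    if ijkl: "i < 3" "j < 3" "k < 3" "l < 3" for i j k l
  proof -
    have "i = j \<or> i = k \<or> i = l \<or> j = k \<or> j = l \<or> k = l" using ijkl by auto
    then have "\<Psi> (b i) (b j) (b k) (b l) = \<zero>"
      using alt[OF bi bi bi] ijkl by (elim disjE) simp_all
    then show ?thesis using one by (intro bexI[of _ \<one>]) simp_all
  qed
  have bbb: "\<exists>t\<in>carrier R - \<pp>. t \<otimes> \<Psi> (b i) (b j) (b k) x = \<zero>" if "i < 3" "j < 3" "k < 3" "x \<in> carrier M" for i j k x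
    by (rule spread[OF _ lin(4)]) (use that bi bbbb in simp_all)
  have bb: "\<exists>t\<in>carrier R - \<pp>. t \<otimes> \<Psi> (b i) (b j) w x = \<zero>" if "i < 3" "j < 3" "w \<in> carrier M" "x \<in> carrier M" for i j w x
    by (rule spread[OF _ lin(3)]) (use that bi bbb in simp_all)
  have b1: "\<exists>t\<in>carrier R - \<pp>. t \<otimes> \<Psi> (b i) v w x = \<zero>" if "i < 3" "v \<in> carrier M" "w \<in> carrier M" "x \<in> carrier M" for i v w x
    by (rule spread[OF _ lin(2)]) (use that bi bb in simp_all)
  show "\<exists>t\<in>carrier R - \<pp>. t \<otimes> \<Psi> u v w x = \<zero>"
    by (rule spread[OF _ lin(1)]) (use u v w x b1 in simp_all)
qed

context trivialised_space
begin

lemma rank_P: "constant_rank S P 3"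
  using space by (simp add: hermitian_space_def)

text \<open>The difference of the two sides is an alternating four-linear form in \<open>u, v, w, x\<close>.\<close>
lemma cramer:
  assumes "u \<in> carrier P" "v \<in> carrier P" "w \<in> carrier P" "x \<in> carrier P" "y \<in> carrier P"
  shows "vol u v w \<otimes> h x y = vol x v w \<otimes> h u y \<oplus> vol u x w \<otimes> h v y \<oplus> vol u v x \<otimes> h w y"
proof -
  define \<Psi> where "\<Psi> u v w x =
     vol u v w \<otimes> h x y \<ominus> (vol x v w \<otimes> h u y \<oplus> vol u x w \<otimes> h v y \<oplus> vol u v x \<otimes> h w y)" for u v w x
  note y = assms(5)
  have "\<Psi> u v w x = \<zero>"
  proof (rule P.alternating_four_linear_vanishes[OF rank_P])
    fix u v w assume c: "u \<in> carrier P" "v \<in> carrier P" "w \<in> carrier P"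
    show "linear_map S P (regular_module S) (\<lambda>x. \<Psi> x u v w)"
      "linear_map S P (regular_module S) (\<lambda>x. \<Psi> u x v w)"
      "linear_map S P (regular_module S) (\<lambda>x. \<Psi> u v x w)"
      "linear_map S P (regular_module S) (\<lambda>x. \<Psi> u v w x)"
      using c y
      by (simp_all add: linear_map_def \<Psi>_def vol_add vol_smult h_add_left h_smult_left S.expand_simps)
    have "vol w v u = \<ominus> vol u v w"
      using c vol_swap12[of v w u] vol_cycle[of u v w] by simp
    then have "\<Psi> u v u w = \<zero>" using c y by (simp add: \<Psi>_def S.expand_simps)
    moreover have "\<Psi> u u v w = \<zero>" using c y vol_swap12[of u w v] by (simp add: \<Psi>_def S.expand_simps)
    moreover have "\<Psi> u v v w = \<zero>" using c y vol_swap23[of u v w] by (simp add: \<Psi>_def S.expand_simps)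
    moreover have "\<Psi> u v w u = \<zero>" "\<Psi> u v w v = \<zero>" "\<Psi> u v w w = \<zero>"
      using c y by (simp_all add: \<Psi>_def S.expand_simps)
    ultimately show "\<Psi> u u v w = \<zero> \<and> \<Psi> u v u w = \<zero> \<and> \<Psi> u v w u = \<zero> \<and> \<Psi> u v v w = \<zero> \<and> \<Psi> u v w v = \<zero> \<and> \<Psi> u v w w = \<zero>"
      by (intro conjI)
  qed (use assms in simp_all)
  then show ?thesis using assms by (simp add: \<Psi>_def S.minus_eq_zero_iff)
qed

end


section \<open>Identities of the cross product\<close>

context trivialised_space
begin

abbreviation cr where "cr \<equiv> cross S P h \<alpha>"

text \<open>The functional \<open>u \<mapsto> vol u v w\<close> is represented by a unique vector because \<open>h\<close> is nondegenerate.\<close>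
lemma cross_exists:
  assumes v: "v \<in> carrier P" and w: "w \<in> carrier P"
  shows "cr v w \<in> carrier P \<and> (\<forall>u\<in>carrier P. h u (cr v w) = vol u v w)"
proof -
  have "(\<lambda>u\<in>carrier P. vol u v w) \<in> Hom_mod S P (regular_module S)"
    using v w by (simp add: Hom_mod_def vol_add vol_smult)
  then have "(\<lambda>u\<in>carrier P. vol u v w) \<in> (\<lambda>w. \<lambda>u\<in>carrier P. h u w) ` carrier P"
    using bij_betw_imp_surj_on[OF nondeg] by simp
  then obtain z where z: "z \<in> carrier P" "(\<lambda>u\<in>carrier P. vol u v w) = (\<lambda>u\<in>carrier P. h u z)"
    by (rule imageE)
  have hz: "h u z = vol u v w" if "u \<in> carrier P" for u
    using fun_cong[OF z(2), of u] that by simp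
  show ?thesis
    unfolding cross_def vol_def[symmetric]
  proof (rule theI')
    show "\<exists>!z. z \<in> carrier P \<and> (\<forall>u\<in>carrier P. h u z = vol u v w)"
    proof (rule ex1I)
      show "z \<in> carrier P \<and> (\<forall>u\<in>carrier P. h u z = vol u v w)" using z(1) hz by simp
      show "y = z" if "y \<in> carrier P \<and> (\<forall>u\<in>carrier P. h u y = vol u v w)" for y
        using h_right_cancel[of y z] that z(1) hz by simp
    qed
  qed
qed

lemma cr_closed [simp]: "v \<in> carrier P \<Longrightarrow> w \<in> carrier P \<Longrightarrow> cr v w \<in> carrier P"
  and h_cr: "u \<in> carrier P \<Longrightarrow> v \<in> carrier P \<Longrightarrow> w \<in> carrier P \<Longrightarrow> h u (cr v w) = vol u v w"
  using cross_exists by blast+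

lemma cr_add_left: "\<lbrakk>u \<in> carrier P; v \<in> carrier P; w \<in> carrier P\<rbrakk> \<Longrightarrow> cr (u \<oplus>\<^bsub>P\<^esub> v) w = cr u w \<oplus>\<^bsub>P\<^esub> cr v w"
  by (rule h_right_cancel) (simp_all add: h_cr h_add_right vol_add)

lemma cr_smult_left: "\<lbrakk>a \<in> carrier S; v \<in> carrier P; w \<in> carrier P\<rbrakk> \<Longrightarrow> cr (a \<odot>\<^bsub>P\<^esub> v) w = bar a \<odot>\<^bsub>P\<^esub> cr v w"
  by (rule h_right_cancel) (simp_all add: h_cr h_smult_right vol_smult)

lemma cr_smult_right: "\<lbrakk>a \<in> carrier S; v \<in> carrier P; w \<in> carrier P\<rbrakk> \<Longrightarrow> cr v (a \<odot>\<^bsub>P\<^esub> w) = bar a \<odot>\<^bsub>P\<^esub> cr v w"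
  by (rule h_right_cancel) (simp_all add: h_cr h_smult_right vol_smult)

lemma cr_swap: "\<lbrakk>v \<in> carrier P; w \<in> carrier P\<rbrakk> \<Longrightarrow> cr w v = \<ominus>\<^bsub>P\<^esub> cr v w"
  using additive_map_zero_minus(2)[OF P.abelian_group_axioms S.abelian_group_axioms, of "h u" for u]
  by (intro h_right_cancel) (simp_all add: h_cr h_add_right vol_swap23[of _ v w])

lemma vol_faithful:
  assumes c: "c \<in> carrier S"
    and zero: "\<And>u v w. \<lbrakk>u \<in> carrier P; v \<in> carrier P; w \<in> carrier P\<rbrakk> \<Longrightarrow> vol u v w \<otimes> c = \<zero>"
  shows "c = \<zero>"
proof -
  have "ideal {t \<in> carrier S. t \<otimes> c = \<zero>} S"
    using module.annihilator_ideal[OF S.regular_module, of c] c by simp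
  from vol_values_generate[OF this] show ?thesis using zero c by simp
qed

lemma vol_faithful_module:
  assumes x: "x \<in> carrier P"
    and zero: "\<And>u v w. \<lbrakk>u \<in> carrier P; v \<in> carrier P; w \<in> carrier P\<rbrakk> \<Longrightarrow> vol u v w \<odot>\<^bsub>P\<^esub> x = \<zero>\<^bsub>P\<^esub>"
  shows "x = \<zero>\<^bsub>P\<^esub>"
  using vol_values_generate[OF P.annihilator_ideal[OF x]] zero x by simp

lemma scalar_unique:
  assumes a: "a \<in> carrier S" and b: "b \<in> carrier S"
    and eq: "\<And>v. v \<in> carrier P \<Longrightarrow> a \<odot>\<^bsub>P\<^esub> v = b \<odot>\<^bsub>P\<^esub> v"
  shows "a = b"
proof -
  have "a \<ominus> b = \<zero>"
  proof (rule vol_faithful)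
    fix u v w assume c: "u \<in> carrier P" "v \<in> carrier P" "w \<in> carrier P"
    have "a \<otimes> vol u v w = vol (a \<odot>\<^bsub>P\<^esub> u) v w" using a c by (simp add: vol_smult)
    also have "\<dots> = b \<otimes> vol u v w" using b c by (simp add: eq vol_smult)
    finally show "vol u v w \<otimes> (a \<ominus> b) = \<zero>"
      using a b c by (simp add: S.m_comm[of "vol u v w"] S.minus_eq S.l_distr S.l_minus S.r_neg)
  qed (use a b in simp)
  then show ?thesis using a b by (simp add: S.minus_eq_zero_iff)
qed

text \<open>For the difference \<open>d\<close> all volumes with an argument \<open>d\<close> vanish. Then Cramer's rule for \<open>d\<close> has only zero terms
  on the right and gives \<open>vol u v w \<cdot> h d z = 0\<close>.\<close>
lemma cr_left_cancel:
  assumes x: "x \<in> carrier P" and y: "y \<in> carrier P" and eq: "\<And>v. v \<in> carrier P \<Longrightarrow> cr x v = cr y v"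
  shows "x = y"
proof -
  have cr_m: "cr (x \<ominus>\<^bsub>P\<^esub> y) v = \<zero>\<^bsub>P\<^esub>" if v: "v \<in> carrier P" for v
    using additive_map_zero_minus(3)[OF P.abelian_group_axioms P.abelian_group_axioms, of "\<lambda>x. cr x v" x y] x y v eq[OF v]
    by (simp add: cr_add_left P.minus_eq_zero_iff)
  define d where "d = x \<ominus>\<^bsub>P\<^esub> y"
  have d: "d \<in> carrier P" using x y by (simp add: d_def)
  have vd: "vol u d w = \<zero>" if "u \<in> carrier P" "w \<in> carrier P" for u w
    using h_cr[OF that(1) d that(2)] cr_m[OF that(2)] that(1) by (simp add: d_def)
  have vd': "vol d v w = \<zero>" "vol v w d = \<zero>" if "v \<in> carrier P" "w \<in> carrier P" for v w
    using vd[of w v] vd[of v w] vol_cycle[of w d v] vol_cycle[of d v w] that d by simp_all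
  have "d = \<zero>\<^bsub>P\<^esub>"
  proof (rule vol_faithful_module[OF d])
    fix u v w assume c: "u \<in> carrier P" "v \<in> carrier P" "w \<in> carrier P"
    have *: "vol u v w \<otimes> h d z = \<zero>" if z: "z \<in> carrier P" for z
      using cramer[OF c d z] c z d by (simp add: vd vd')
    show "vol u v w \<odot>\<^bsub>P\<^esub> d = \<zero>\<^bsub>P\<^esub>"
    proof (rule h_right_cancel)
      fix z assume z: "z \<in> carrier P"
      have "h z (vol u v w \<odot>\<^bsub>P\<^esub> d) = bar (vol u v w \<otimes> h d z)" using c d z by (simp add: h_smult_right)
      then show "h z (vol u v w \<odot>\<^bsub>P\<^esub> d) = h z \<zero>\<^bsub>P\<^esub>" using *[OF z] z by simp
    qed (use c d in simp_all)
  qed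
  then show ?thesis using x y by (simp add: d_def P.minus_eq_zero_iff)
qed

text \<open>Put \<open>z = a \<times> b\<close> and let \<open>C p q\<close> be the difference of the right hand side and \<open>vol z p q\<close>. Expand the
  Gram determinant of \<open>v\<^sub>1, v\<^sub>2, v\<^sub>3\<close> against \<open>w, a, b\<close> along its first column, and expand
  \<open>vol v\<^sub>1 v\<^sub>2 v\<^sub>3 \<cdot> h z w\<close> by Cramer's rule. Both equal the same product, and the comparison is a linear relation
  between \<open>C v\<^sub>2 v\<^sub>3\<close>, \<open>C v\<^sub>3 v\<^sub>1\<close> and \<open>C v\<^sub>1 v\<^sub>2\<close>. Together with Cramer's rule for the linear function
  \<open>p \<mapsto> C p q\<close> it forces \<open>X = vol v\<^sub>1 v\<^sub>2 v\<^sub>3 \<cdot> C p q\<close> to satisfy \<open>X = X + X\<close>.\<close>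
lemma h_cr_cr:
  assumes a: "a \<in> carrier P" and b: "b \<in> carrier P" and p: "p \<in> carrier P" and q: "q \<in> carrier P"
  shows "h (cr a b) (cr p q) = h p a \<otimes> h q b \<ominus> h p b \<otimes> h q a"
proof -
  define z where "z = cr a b"
  have z: "z \<in> carrier P" using a b by (simp add: z_def)
  define C where "C p q = h p a \<otimes> h q b \<ominus> h p b \<otimes> h q a \<ominus> vol z p q" for p q
  have C: "C p q \<in> carrier S" if "p \<in> carrier P" "q \<in> carrier P" for p q
    using that a b z by (simp add: C_def)
  have C_swap: "C q p = \<ominus> C p q" if "p \<in> carrier P" "q \<in> carrier P" for p q
    using that a b z vol_swap23[of z p q] by (simp add: C_def S.expand_simps)
  \<comment> \<open>This is the relation from the Gram determinant, with its terms in cyclic order.\<close>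
  have gram: "C v2 v3 \<otimes> h v1 w \<oplus> C v3 v1 \<otimes> h v2 w \<oplus> C v1 v2 \<otimes> h v3 w = \<zero>"
    if v: "v1 \<in> carrier P" "v2 \<in> carrier P" "v3 \<in> carrier P" and w: "w \<in> carrier P" for v1 v2 v3 w
  proof -
    let ?d = "det3 S (h v1 w) (h v1 a) (h v1 b) (h v2 w) (h v2 a) (h v2 b) (h v3 w) (h v3 a) (h v3 b)"
    let ?c = "vol z v2 v3 \<otimes> h v1 w \<oplus> vol z v3 v1 \<otimes> h v2 w \<oplus> vol z v1 v2 \<otimes> h v3 w"
    have "?d = vol v1 v2 v3 \<otimes> h z w"
      using gram_det_vol[OF v w a b] h_cr[OF w a b] w z bar_h[OF w z] by (simp add: z_def)
    also have "\<dots> = ?c"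
      using cramer[OF v z w] vol_cycle[of v1 z v3] vol_cycle[of z v3 v1] vol_cycle[of z v1 v2] vol_cycle[of v1 v2 z] v z by simp
    finally have "?d = ?c" .
    have "C v2 v3 \<otimes> h v1 w \<oplus> C v3 v1 \<otimes> h v2 w \<oplus> C v1 v2 \<otimes> h v3 w = ?d \<ominus> ?c"
      using v w a b z by (simp add: C_def det3_def S.expand_simps)
    then show ?thesis using \<open>?d = ?c\<close> v w z by (simp add: S.minus_eq S.r_neg)
  qed
  \<comment> \<open>Taking \<open>w = s \<times> t\<close> turns the values of \<open>h\<close> into volumes.\<close>
  have Z: "C y x \<otimes> vol v s t \<oplus> C x v \<otimes> vol y s t \<oplus> C v y \<otimes> vol x s t = \<zero>"
    if "v \<in> carrier P" "y \<in> carrier P" "x \<in> carrier P" "s \<in> carrier P" "t \<in> carrier P" for v y x s t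
    using gram[of v y x "cr s t"] that by (simp add: h_cr)
  have C_cramer: "vol v1 v2 v3 \<otimes> C x y = vol x v2 v3 \<otimes> C v1 y \<oplus> vol v1 x v3 \<otimes> C v2 y \<oplus> vol v1 v2 x \<otimes> C v3 y"
    if v: "v1 \<in> carrier P" "v2 \<in> carrier P" "v3 \<in> carrier P" and x: "x \<in> carrier P" and y: "y \<in> carrier P" for v1 v2 v3 x y
  proof -
    \<comment> \<open>The vector representing the functional \<open>x \<mapsto> C x y\<close>.\<close>
    let ?c = "h b y \<odot>\<^bsub>P\<^esub> a \<ominus>\<^bsub>P\<^esub> h a y \<odot>\<^bsub>P\<^esub> b \<ominus>\<^bsub>P\<^esub> cr y z"
    have "C x y = h x ?c" if x: "x \<in> carrier P" for x
      using x y a b z vol_cycle[of z x y]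
      by (simp add: C_def h_minus_right h_smult_right h_cr S.m_comm)
    then show ?thesis using cramer[OF v x, of ?c] v x y a b z by simp
  qed
  have "C p q = \<zero>"
  proof (rule vol_faithful[OF C[OF p q]])
    fix v1 v2 v3 assume v: "v1 \<in> carrier P" "v2 \<in> carrier P" "v3 \<in> carrier P"
    let ?X = "vol v1 v2 v3 \<otimes> C p q"
    have A: "vol x s t \<otimes> C v y = vol v s t \<otimes> C x y \<oplus> vol y s t \<otimes> C v x"
      if c: "v \<in> carrier P" "x \<in> carrier P" "y \<in> carrier P" "s \<in> carrier P" "t \<in> carrier P" for x s t v y
    proof -
      have "vol x s t \<otimes> C v y \<ominus> (vol v s t \<otimes> C x y \<oplus> vol y s t \<otimes> C v x) =
          C y x \<otimes> vol v s t \<oplus> C x v \<otimes> vol y s t \<oplus> C v y \<otimes> vol x s t"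
        using c C C_swap[of x y] C_swap[of v x] by (simp add: S.expand_simps)
      then show ?thesis using Z[OF c(1,3,2,4,5)] c C by (simp add: S.minus_eq_zero_iff)
    qed
    let ?B1 = "vol q v2 v3 \<otimes> C v1 p" and ?B2 = "vol v1 q v3 \<otimes> C v2 p" and ?B3 = "vol v1 v2 q \<otimes> C v3 p"
    have cyc: "vol p v3 v1 = vol v1 p v3" "vol q v3 v1 = vol v1 q v3" "vol p v1 v2 = vol v1 v2 p" "vol q v1 v2 = vol v1 v2 q"
      "vol v2 v3 v1 = vol v1 v2 v3" "vol v3 v1 v2 = vol v1 v2 v3"
      using v p q vol_cycle[of v1 p v3] vol_cycle[of v1 q v3] vol_cycle[of v1 v2 p] vol_cycle[of v1 v2 q]
        vol_cycle[of p v1 v2] vol_cycle[of q v1 v2] vol_cycle[of v1 v2 v3] vol_cycle[of v2 v3 v1] by simp_all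
    have X: "?X \<in> carrier S" and B: "?B1 \<in> carrier S" "?B2 \<in> carrier S" "?B3 \<in> carrier S"
      using v p q C by simp_all
    have "?X = (?X \<oplus> ?B1) \<oplus> (?X \<oplus> ?B2) \<oplus> (?X \<oplus> ?B3)"
      using C_cramer[OF v p q] A[of v1 p q v2 v3] A[of v2 p q v3 v1] A[of v3 p q v1 v2] v p q by (simp add: cyc)
    also have "\<dots> = ?X \<oplus> ?X \<oplus> (?X \<oplus> (?B1 \<oplus> ?B2 \<oplus> ?B3))"
      using X B by (simp add: S.a_ac)
    also have "?B1 \<oplus> ?B2 \<oplus> ?B3 = vol v1 v2 v3 \<otimes> C q p" using C_cramer[OF v q p] by simp
    also have "\<dots> = \<ominus> ?X" using C_swap[OF p q] v C[OF p q] by (simp add: S.r_minus)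
    finally have "?X = ?X \<oplus> ?X" using X by (simp add: S.r_neg)
    then show "?X = \<zero>" using X by (metis S.add.l_cancel_one)
  qed
  moreover have "h z (cr p q) = vol z p q" using z p q by (simp add: h_cr)
  ultimately show ?thesis using a b p q z by (simp add: C_def z_def S.minus_eq_zero_iff)
qed

text \<open>Pair both sides with \<open>y\<close>: since volumes are cyclic, \<open>h y ((a \<times> b) \<times> c) = h (a \<times> b) (c \<times> y)\<close>.\<close>
lemma triple_product:
  assumes a: "a \<in> carrier P" and b: "b \<in> carrier P" and c: "c \<in> carrier P"
  shows "cr (cr a b) c = h a c \<odot>\<^bsub>P\<^esub> b \<ominus>\<^bsub>P\<^esub> h b c \<odot>\<^bsub>P\<^esub> a"
proof (rule h_right_cancel)
  fix y assume y: "y \<in> carrier P"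
  have "h y (cr (cr a b) c) = vol (cr a b) c y"
    using y a b c vol_cycle[of y "cr a b" c] by (simp add: h_cr)
  also have "\<dots> = h (cr a b) (cr c y)" using y a b c by (simp add: h_cr)
  also have "\<dots> = h y (h a c \<odot>\<^bsub>P\<^esub> b \<ominus>\<^bsub>P\<^esub> h b c \<odot>\<^bsub>P\<^esub> a)"
    using y a b c by (simp add: h_cr_cr h_minus_right h_smult_right)
  finally show "h y (cr (cr a b) c) = h y (h a c \<odot>\<^bsub>P\<^esub> b \<ominus>\<^bsub>P\<^esub> h b c \<odot>\<^bsub>P\<^esub> a)" .
qed (use a b c in simp_all)

end


section \<open>Recovering the scalars and the form\<close>

lemma (in cring) idealI_elements:
  assumes "I \<subseteq> carrier R" "\<zero> \<in> I" "\<And>a b. a \<in> I \<Longrightarrow> b \<in> I \<Longrightarrow> a \<oplus> b \<in> I"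
    "\<And>a x. a \<in> I \<Longrightarrow> x \<in> carrier R \<Longrightarrow> x \<otimes> a \<in> I"
  shows "ideal I R"
proof (rule idealI[OF ring_axioms])
  show "subgroup I (add_monoid R)"
  proof (rule add.subgroupI)
    show "\<ominus> a \<in> I" if a: "a \<in> I" for a
    proof -
      have "\<ominus> a = (\<ominus> \<one>) \<otimes> a" using a assms(1) by (auto simp: l_minus)
      then show ?thesis using assms(4)[OF a, of "\<ominus> \<one>"] by simp
    qed
  qed (use assms in auto)
  show "x \<otimes> a \<in> I" "a \<otimes> x \<in> I" if "a \<in> I" "x \<in> carrier R" for a x
    using assms(4)[OF that] assms(1) that m_comm[of a x] by auto
qed

context trivialised_space
begin

lemma half_R: "half R \<in> carrier R" "half R \<oplus>\<^bsub>R\<^esub> half R = \<one>\<^bsub>R\<^esub>"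
proof -
  show h: "half R \<in> carrier R" unfolding half_def using two_unit by simp
  have "(\<one>\<^bsub>R\<^esub> \<oplus>\<^bsub>R\<^esub> \<one>\<^bsub>R\<^esub>) \<otimes>\<^bsub>R\<^esub> half R = \<one>\<^bsub>R\<^esub>" unfolding half_def using two_unit by simp
  then show "half R \<oplus>\<^bsub>R\<^esub> half R = \<one>\<^bsub>R\<^esub>" using h by (simp add: R.l_distr)
qed

definition half_S where "half_S = half R \<odot> \<one>"

lemma half_S: "half_S \<in> carrier S" "half_S \<oplus> half_S = \<one>"
  using half_R A.smult_l_distr[of "half R" "half R" \<one>] by (simp_all add: half_S_def)

lemma halve: "c \<in> carrier S \<Longrightarrow> half_S \<otimes> (c \<oplus> c) = c"
  and halve_module: "x \<in> carrier P \<Longrightarrow> half_S \<odot>\<^bsub>P\<^esub> (x \<oplus>\<^bsub>P\<^esub> x) = x"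
proof -
  show "half_S \<otimes> (c \<oplus> c) = c" if c: "c \<in> carrier S"
    using S.l_distr[OF half_S(1) half_S(1) c] half_S c by (simp add: S.r_distr)
  show "half_S \<odot>\<^bsub>P\<^esub> (x \<oplus>\<^bsub>P\<^esub> x) = x" if x: "x \<in> carrier P"
    using P.smult_l_distr[OF half_S(1) half_S(1) x] half_S x by (simp add: P.smult_r_distr)
qed

text \<open>The vector algebra sees multiplication by a scalar \<open>l\<close> as a map \<open>\<phi>\<close> with the properties below, \<open>\<psi>\<close> being
  multiplication by the conjugate of \<open>l\<close>. Conversely such a \<open>\<phi>\<close> is \<open>S\<close>-linear because cross products
  separate vectors. Applying it to \<open>(u \<times> v) \<times> w = (h u w) v - (h v w) u\<close> gives
  \<open>(h u w) \<phi> v = (h (\<phi> u) w) v\<close>, so \<open>c \<phi>\<close> is a scalar for every \<open>c\<close> in the ideal generated by the values of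
  \<open>h\<close>. That ideal contains \<open>vol u v w = h u (v \<times> w)\<close> and therefore \<open>1\<close>.\<close>
lemma centroid_scalar:
  assumes \<phi>: "\<phi> \<in> carrier P \<rightarrow> carrier P"
    and add: "\<forall>u\<in>carrier P. \<forall>v\<in>carrier P. \<phi> (u \<oplus>\<^bsub>P\<^esub> v) = \<phi> u \<oplus>\<^bsub>P\<^esub> \<phi> v"
    and \<psi>: "\<psi> \<in> carrier P \<rightarrow> carrier P"
    and left: "\<And>u v. \<lbrakk>u \<in> carrier P; v \<in> carrier P\<rbrakk> \<Longrightarrow> cr (\<phi> u) v = \<psi> (cr u v)"
    and right: "\<And>u v. \<lbrakk>u \<in> carrier P; v \<in> carrier P\<rbrakk> \<Longrightarrow> cr u (\<phi> v) = \<psi> (cr u v)"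
    and conj: "\<And>u v. \<lbrakk>u \<in> carrier P; v \<in> carrier P\<rbrakk> \<Longrightarrow> cr (\<psi> u) v = \<phi> (cr u v)"
  obtains l where "l \<in> carrier S" "\<And>v. v \<in> carrier P \<Longrightarrow> \<phi> v = l \<odot>\<^bsub>P\<^esub> v"
proof -
  have clo [simp]: "\<phi> u \<in> carrier P" "\<psi> u \<in> carrier P" if "u \<in> carrier P" for u
    using \<phi> \<psi> that by auto
  have smult: "\<phi> (s \<odot>\<^bsub>P\<^esub> u) = s \<odot>\<^bsub>P\<^esub> \<phi> u" if s: "s \<in> carrier S" and u: "u \<in> carrier P" for s u
  proof (rule cr_left_cancel)
    fix v assume v: "v \<in> carrier P"
    have "cr (\<phi> (s \<odot>\<^bsub>P\<^esub> u)) v = cr (s \<odot>\<^bsub>P\<^esub> u) (\<phi> v)" using s u v by (simp add: left right)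
    also have "\<dots> = bar s \<odot>\<^bsub>P\<^esub> cr u (\<phi> v)" using s u v by (simp add: cr_smult_left)
    also have "cr u (\<phi> v) = cr (\<phi> u) v" using u v by (simp add: left right)
    finally show "cr (\<phi> (s \<odot>\<^bsub>P\<^esub> u)) v = cr (s \<odot>\<^bsub>P\<^esub> \<phi> u) v" using s u v by (simp add: cr_smult_left)
  qed (use s u in simp_all)
  have key: "h u w \<odot>\<^bsub>P\<^esub> \<phi> v = h (\<phi> u) w \<odot>\<^bsub>P\<^esub> v"
    if u: "u \<in> carrier P" and v: "v \<in> carrier P" and w: "w \<in> carrier P" for u v w
  proof -
    have "\<phi> (cr (cr u v) w) = cr (cr (\<phi> u) v) w" using u v w by (simp add: left conj)
    then have "\<phi> (h u w \<odot>\<^bsub>P\<^esub> v \<ominus>\<^bsub>P\<^esub> h v w \<odot>\<^bsub>P\<^esub> u) = h (\<phi> u) w \<odot>\<^bsub>P\<^esub> v \<ominus>\<^bsub>P\<^esub> h v w \<odot>\<^bsub>P\<^esub> \<phi> u"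
      using u v w by (simp add: triple_product)
    moreover have "\<phi> (h u w \<odot>\<^bsub>P\<^esub> v \<ominus>\<^bsub>P\<^esub> h v w \<odot>\<^bsub>P\<^esub> u) = h u w \<odot>\<^bsub>P\<^esub> \<phi> v \<ominus>\<^bsub>P\<^esub> h v w \<odot>\<^bsub>P\<^esub> \<phi> u"
      using additive_map_zero_minus(3)[OF P.abelian_group_axioms P.abelian_group_axioms \<phi> add,
          of "h u w \<odot>\<^bsub>P\<^esub> v" "h v w \<odot>\<^bsub>P\<^esub> u"] u v w by (simp add: smult)
    ultimately show ?thesis using u v w by (simp add: P.minus_eq)
  qed
  let ?I = "{c \<in> carrier S. \<exists>l\<in>carrier S. \<forall>v\<in>carrier P. c \<odot>\<^bsub>P\<^esub> \<phi> v = l \<odot>\<^bsub>P\<^esub> v}"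
  have "ideal ?I S"
  proof (rule S.idealI_elements)
    show "\<zero> \<in> ?I" by (auto intro!: bexI[of _ \<zero>])
  next
    fix a b assume "a \<in> ?I" "b \<in> ?I"
    then obtain k l where kl: "k \<in> carrier S" "l \<in> carrier S" "a \<in> carrier S" "b \<in> carrier S"
      "\<forall>v\<in>carrier P. a \<odot>\<^bsub>P\<^esub> \<phi> v = k \<odot>\<^bsub>P\<^esub> v" "\<forall>v\<in>carrier P. b \<odot>\<^bsub>P\<^esub> \<phi> v = l \<odot>\<^bsub>P\<^esub> v" by auto
    then have "\<forall>v\<in>carrier P. (a \<oplus> b) \<odot>\<^bsub>P\<^esub> \<phi> v = (k \<oplus> l) \<odot>\<^bsub>P\<^esub> v" by (simp add: P.smult_l_distr)
    then show "a \<oplus> b \<in> ?I" using kl(1-4) by (auto intro!: bexI[of _ "k \<oplus> l"])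
  next
    fix a x assume "a \<in> ?I" and x: "x \<in> carrier S"
    then obtain k where k: "k \<in> carrier S" "a \<in> carrier S" "\<forall>v\<in>carrier P. a \<odot>\<^bsub>P\<^esub> \<phi> v = k \<odot>\<^bsub>P\<^esub> v" by auto
    then have "\<forall>v\<in>carrier P. (x \<otimes> a) \<odot>\<^bsub>P\<^esub> \<phi> v = (x \<otimes> k) \<odot>\<^bsub>P\<^esub> v" using x by (simp add: P.smult_assoc1)
    then show "x \<otimes> a \<in> ?I" using k(1,2) x by (auto intro!: bexI[of _ "x \<otimes> k"])
  qed auto
  then have "\<one> \<in> ?I"
  proof (rule vol_values_generate)
    fix u v w assume c: "u \<in> carrier P" "v \<in> carrier P" "w \<in> carrier P"
    have "h u (cr v w) \<in> ?I" using key c by (auto intro!: bexI[of _ "h (\<phi> u) (cr v w)"])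
    then show "vol u v w \<in> ?I" using c by (simp add: h_cr)
  qed
  then obtain l where "l \<in> carrier S" "\<forall>v\<in>carrier P. \<one> \<odot>\<^bsub>P\<^esub> \<phi> v = l \<odot>\<^bsub>P\<^esub> v" by blast
  then show thesis using that[of l] by simp
qed

text \<open>The hypothesis allows the argument of \<open>E\<close> to be exchanged with a vector inside \<open>vol\<close>. Three such exchanges
  rearrange \<open>E a \<cdot> vol u v w\<close> into \<open>- E a \<cdot> vol u v w\<close>.\<close>
lemma proportional_functional_zero:
  assumes E: "\<And>a. a \<in> carrier P \<Longrightarrow> E a \<in> carrier S"
    and exchange: "\<And>a b. \<lbrakk>a \<in> carrier P; b \<in> carrier P\<rbrakk> \<Longrightarrow> E a \<odot>\<^bsub>P\<^esub> b = E b \<odot>\<^bsub>P\<^esub> a"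
    and a: "a \<in> carrier P"
  shows "E a = \<zero>"
proof (rule vol_faithful[OF E[OF a]])
  have exch: "E x \<otimes> vol y v w = E y \<otimes> vol x v w"
    if "x \<in> carrier P" "y \<in> carrier P" "v \<in> carrier P" "w \<in> carrier P" for x y v w
  proof -
    have "E x \<otimes> vol y v w = vol (E x \<odot>\<^bsub>P\<^esub> y) v w" using that E by (simp add: vol_smult)
    also have "E x \<odot>\<^bsub>P\<^esub> y = E y \<odot>\<^bsub>P\<^esub> x" using that by (simp only: exchange)
    also have "vol (E y \<odot>\<^bsub>P\<^esub> x) v w = E y \<otimes> vol x v w" using that E by (simp add: vol_smult)
    finally show ?thesis .
  qed
  fix u v w assume c: "u \<in> carrier P" "v \<in> carrier P" "w \<in> carrier P"
  let ?X = "E a \<otimes> vol u v w"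
  have X: "?X \<in> carrier S" using a c E by simp
  have "?X = E u \<otimes> vol a v w" by (rule exch[OF a c])
  also have "\<dots> = \<ominus> (E u \<otimes> vol v a w)" using a c E vol_swap12[of v a w] by (simp add: S.r_minus)
  also have "E u \<otimes> vol v a w = E v \<otimes> vol u a w" by (rule exch) (use a c in simp_all)
  also have "\<dots> = \<ominus> (E v \<otimes> vol a u w)" using a c E vol_swap12[of a u w] by (simp add: S.r_minus)
  also have "E v \<otimes> vol a u w = E a \<otimes> vol v u w" by (rule exch) (use a c in simp_all)
  also have "\<dots> = \<ominus> ?X" using a c E vol_swap12[of u v w] by (simp add: S.r_minus)
  finally have neg: "?X = \<ominus> (\<ominus> (\<ominus> ?X))" .
  have "?X \<oplus> ?X = ?X \<oplus> \<ominus> (\<ominus> (\<ominus> ?X))" by (rule arg_cong[OF neg])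
  also have "\<dots> = \<zero>" using X by (simp add: S.r_neg)
  finally have "?X = \<zero>" using halve[OF X] half_S(1) S.r_null by metis
  then show "vol u v w \<otimes> E a = \<zero>" using a c E by (simp add: S.m_comm)
qed

text \<open>Modulo \<open>N\<close> the triple product \<open>(p \<times> q) \<times> (s \<times> t)\<close> says \<open>(vol p s t) q \<equiv> (vol q s t) p\<close>. As in \<open>proportional_functional_zero\<close>, three
  exchanges give \<open>(vol u v w) y \<equiv> - (vol u v w) y\<close>; here \<open>y\<close> is half of the vector that is to be reached, because
  \<open>N\<close> need not be closed under halving.\<close>
lemma cross_products_span:
  assumes N: "N \<subseteq> carrier P" "\<zero>\<^bsub>P\<^esub> \<in> N"
    and add: "\<And>x y. x \<in> N \<Longrightarrow> y \<in> N \<Longrightarrow> x \<oplus>\<^bsub>P\<^esub> y \<in> N" and neg: "\<And>x. x \<in> N \<Longrightarrow> \<ominus>\<^bsub>P\<^esub> x \<in> N"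
    and crN: "\<And>u v. \<lbrakk>u \<in> carrier P; v \<in> carrier P\<rbrakk> \<Longrightarrow> cr u v \<in> N"
  shows "N = carrier P"
proof -
  let ?I = "{c \<in> carrier S. \<forall>x\<in>carrier P. c \<odot>\<^bsub>P\<^esub> x \<in> N}"
  have "ideal ?I S"
  proof (rule S.idealI_elements)
    show "a \<oplus> b \<in> ?I" if "a \<in> ?I" "b \<in> ?I" for a b
      using that add by (simp add: P.smult_l_distr)
    show "x \<otimes> a \<in> ?I" if "a \<in> ?I" "x \<in> carrier S" for a x
      using that by (simp add: S.m_comm[of x a] P.smult_assoc1)
  qed (use N in auto)
  then have "\<one> \<in> ?I"
  proof (rule vol_values_generate)
    fix u v w assume c: "u \<in> carrier P" "v \<in> carrier P" "w \<in> carrier P"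
    have "vol u v w \<odot>\<^bsub>P\<^esub> x \<in> N" if x: "x \<in> carrier P" for x
    proof -
      define y where "y = half_S \<odot>\<^bsub>P\<^esub> x"
      have y: "y \<in> carrier P" using x half_S by (simp add: y_def)
      have exch: "vol p s t \<odot>\<^bsub>P\<^esub> q \<ominus>\<^bsub>P\<^esub> vol q s t \<odot>\<^bsub>P\<^esub> p \<in> N"
        if "p \<in> carrier P" "q \<in> carrier P" "s \<in> carrier P" "t \<in> carrier P" for p q s t
        using crN[of "cr p q" "cr s t"] that by (simp add: triple_product h_cr)
      let ?T1 = "vol u v w \<odot>\<^bsub>P\<^esub> y" and ?T2 = "vol v y w \<odot>\<^bsub>P\<^esub> u" and ?T3 = "vol y u w \<odot>\<^bsub>P\<^esub> v"
      have T: "?T1 \<in> carrier P" "?T2 \<in> carrier P" "?T3 \<in> carrier P" using c y by simp_all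
      have 1: "?T1 \<oplus>\<^bsub>P\<^esub> ?T2 \<in> N"
        using exch[of u y v w] c y vol_swap12[of v y w] by (simp add: P.smult_l_minus P.minus_eq)
      have 2: "?T2 \<oplus>\<^bsub>P\<^esub> ?T3 \<in> N"
        using exch[of v u y w] c y vol_swap12[of y u w] by (simp add: P.smult_l_minus P.minus_eq)
      have 3: "?T3 \<oplus>\<^bsub>P\<^esub> ?T1 \<in> N"
        using exch[of y v u w] c y vol_swap12[of u v w] by (simp add: P.smult_l_minus P.minus_eq)
      have "?T1 \<oplus>\<^bsub>P\<^esub> ?T1 = (?T1 \<oplus>\<^bsub>P\<^esub> ?T2) \<oplus>\<^bsub>P\<^esub> \<ominus>\<^bsub>P\<^esub> (?T2 \<oplus>\<^bsub>P\<^esub> ?T3) \<oplus>\<^bsub>P\<^esub> (?T3 \<oplus>\<^bsub>P\<^esub> ?T1)"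
      proof -
        have "\<ominus>\<^bsub>P\<^esub> (?T2 \<oplus>\<^bsub>P\<^esub> ?T3) = \<ominus>\<^bsub>P\<^esub> ?T3 \<oplus>\<^bsub>P\<^esub> \<ominus>\<^bsub>P\<^esub> ?T2" using T by (simp add: P.minus_add P.M.a_comm)
        then have "(?T1 \<oplus>\<^bsub>P\<^esub> ?T2) \<oplus>\<^bsub>P\<^esub> \<ominus>\<^bsub>P\<^esub> (?T2 \<oplus>\<^bsub>P\<^esub> ?T3) \<oplus>\<^bsub>P\<^esub> (?T3 \<oplus>\<^bsub>P\<^esub> ?T1) =
           (?T1 \<oplus>\<^bsub>P\<^esub> ?T1) \<oplus>\<^bsub>P\<^esub> ((?T2 \<oplus>\<^bsub>P\<^esub> \<ominus>\<^bsub>P\<^esub> ?T2) \<oplus>\<^bsub>P\<^esub> (?T3 \<oplus>\<^bsub>P\<^esub> \<ominus>\<^bsub>P\<^esub> ?T3))"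
          using T by (simp add: P.M.a_ac)
        then show ?thesis using T by (simp add: P.M.r_neg)
      qed
      then have "?T1 \<oplus>\<^bsub>P\<^esub> ?T1 \<in> N" using add[OF add[OF 1 neg[OF 2]] 3] by simp
      moreover have "?T1 \<oplus>\<^bsub>P\<^esub> ?T1 = vol u v w \<odot>\<^bsub>P\<^esub> x"
        using halve_module[OF x] x c y half_S by (simp add: y_def P.smult_r_distr[symmetric])
      ultimately show ?thesis by simp
    qed
    then show "vol u v w \<in> ?I" using c by simp
  qed
  then show ?thesis using N(1) by auto
qed

end


section \<open>Faithful scalars and the twisted separability idempotent\<close>

lemma (in ideal) finsum_mem:
  assumes "finite A" "\<And>i. i \<in> A \<Longrightarrow> f i \<in> I"
  shows "(\<Oplus>i\<in>A. f i) \<in> I"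
  using assms
proof (induction A rule: finite_induct)
  case (insert i A)
  have "f i \<in> carrier R" "f \<in> A \<rightarrow> carrier R" using insert.prems Icarr by auto
  then show ?case using insert by simp
qed simp

context trivialised_space
begin

text \<open>A basis vector of the localisation of \<open>S\<close> at \<open>\<pp>\<close> is killed by \<open>r\<close>, so \<open>r\<close> vanishes locally.\<close>
lemma scalar_embedding_kernel:
  assumes r: "r \<in> carrier R" and zero: "r \<odot> \<one> = \<zero>"
  shows "r = \<zero>\<^bsub>R\<^esub>"
proof (rule R.locally_zero_imp_zero[OF r])
  fix \<pp> assume "primeideal \<pp> R"
  moreover have "constant_rank R S 2" using etale by (simp add: quadratic_etale_def)
  ultimately have "free_at_prime R S \<pp> 2" unfolding constant_rank_def by blast
  then obtain b where b: "b \<in> {..<2::nat} \<rightarrow> carrier S"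
    and ind: "\<And>c. c \<in> {..<2::nat} \<rightarrow> carrier R \<Longrightarrow> \<exists>t \<in> carrier R - \<pp>. t \<odot> (\<Oplus>i\<in>{..<2}. c i \<odot> b i) = \<zero> \<Longrightarrow>
       \<forall>i<2. \<exists>t \<in> carrier R - \<pp>. t \<otimes>\<^bsub>R\<^esub> c i = \<zero>\<^bsub>R\<^esub>"
    unfolding free_at_prime_def by auto
  have one: "\<one>\<^bsub>R\<^esub> \<in> carrier R - \<pp>"
    using primeideal.I_notcarr[OF \<open>primeideal \<pp> R\<close>]
      ideal.one_imp_carrier[OF primeideal.axioms(1)[OF \<open>primeideal \<pp> R\<close>]] by auto
  have "r \<odot> b i = \<zero>" if "i < 2" for i
  proof -
    have bi: "b i \<in> carrier S" using b that by auto
    have "r \<odot> b i = (r \<odot> \<one>) \<otimes> b i" using A.smult_assoc2[OF r S.one_closed bi] bi by simp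
    then show ?thesis using bi zero by simp
  qed
  then have "(\<Oplus>i\<in>{..<2}. r \<odot> b i) = \<zero>" by (intro S.add.finprod_one_eqI) simp
  then have *: "\<exists>t \<in> carrier R - \<pp>. t \<odot> (\<Oplus>i\<in>{..<2}. r \<odot> b i) = \<zero>"
    using one by (intro bexI[of _ "\<one>\<^bsub>R\<^esub>"]) simp_all
  have "(\<lambda>_. r) \<in> {..<2::nat} \<rightarrow> carrier R" using r by simp
  from ind[OF this *] show "\<exists>t\<in>carrier R - \<pp>. t \<otimes>\<^bsub>R\<^esub> r = \<zero>\<^bsub>R\<^esub>" by fastforce
qed

lemma scalar_embedding_inj:
  assumes "r \<in> carrier R" "s \<in> carrier R" "r \<odot> \<one> = s \<odot> \<one>"
  shows "r = s"
proof -
  have "(r \<oplus>\<^bsub>R\<^esub> \<ominus>\<^bsub>R\<^esub> s) \<odot> \<one> = \<zero>"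
    using assms by (simp add: A.smult_l_distr A.smult_l_minus S.r_neg)
  then have "r \<ominus>\<^bsub>R\<^esub> s = \<zero>\<^bsub>R\<^esub>" using scalar_embedding_kernel[of "r \<ominus>\<^bsub>R\<^esub> s"] assms by (simp add: R.minus_eq)
  then show ?thesis using assms by (simp add: R.minus_eq_zero_iff)
qed

lemma smult_via_one: "r \<in> carrier R \<Longrightarrow> x \<in> carrier S \<Longrightarrow> r \<odot> x = (r \<odot> \<one>) \<otimes> x"
  using A.smult_assoc2[of r \<one> x] by simp

lemma smult_right: "r \<in> carrier R \<Longrightarrow> x \<in> carrier S \<Longrightarrow> y \<in> carrier S \<Longrightarrow> x \<otimes> (r \<odot> y) = r \<odot> (x \<otimes> y)"
  using A.smult_assoc2[of r y x] by (simp add: S.m_comm)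

text \<open>The map \<open>x \<otimes> y \<mapsto> x \<cdot> bar y\<close> from \<open>S \<otimes> S\<close> to \<open>S\<close> is applied to the defining equation of a separability idempotent.\<close>
lemma twisted_separability:
  obtains n :: nat and a b where "a \<in> {..<n} \<rightarrow> carrier S" "b \<in> {..<n} \<rightarrow> carrier S"
    "(\<Oplus>i\<in>{..<n}. a i \<otimes> b i) = \<one>"
    "\<And>s. s \<in> carrier S \<Longrightarrow> (\<Oplus>i\<in>{..<n}. (s \<otimes> a i) \<otimes> bar (b i)) = (\<Oplus>i\<in>{..<n}. a i \<otimes> bar (s \<otimes> b i))"
proof -
  obtain n :: nat and a b where a: "a \<in> {..<n} \<rightarrow> carrier S" and b: "b \<in> {..<n} \<rightarrow> carrier S"
    and sum: "(\<Oplus>i\<in>{..<n}. a i \<otimes> b i) = \<one>"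
    and sep: "\<And>s. s \<in> carrier S \<Longrightarrow>
          (\<Oplus>\<^bsub>tensor_module R S S\<^esub>i\<in>{..<n}. tensor R S S (s \<otimes> a i) (b i)) =
          (\<Oplus>\<^bsub>tensor_module R S S\<^esub>i\<in>{..<n}. tensor R S S (a i) (s \<otimes> b i))"
    using etale unfolding quadratic_etale_def separable_algebra_def by auto
  let ?X = "carrier S \<times> carrier S" and ?K = "tensor_kernel R S S"
  define G where "G = free_module R ?X"
  define \<beta> where "\<beta> = linear_ext R S (\<lambda>(x, y). x \<otimes> bar y)"
  have G: "module R G" unfolding G_def by (rule free_module_module[OF R_cring])
  interpret G: module R G by (rule G)
  have mS: "module R S" by (rule A.module_axioms)
  have gen: "free_gen R (x, y) \<in> carrier G" if "x \<in> carrier S" "y \<in> carrier S" for x y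
    unfolding G_def by (rule free_gen_closed[OF R_cring]) (use that in simp)
  have \<beta>: "linear_map R G S \<beta>"
    unfolding G_def \<beta>_def by (rule linear_ext_linear[OF R_cring mS]) auto
  have \<beta>gen: "\<beta> (free_gen R (x, y)) = x \<otimes> bar y" if "x \<in> carrier S" "y \<in> carrier S" for x y
  proof -
    have "linear_ext R S (\<lambda>(x, y). x \<otimes> bar y) (free_gen R (x, y)) = (case (x, y) of (x, y) \<Rightarrow> x \<otimes> bar y)"
      by (rule linear_ext_gen[OF R_cring mS, of ?X]) (use that in auto)
    then show ?thesis by (simp add: \<beta>_def)
  qed
  note lin = linear_mapD[OF \<beta>] linear_map_minus[OF G mS \<beta>]
  have rel: "tensor_relations R S S \<subseteq> carrier G"
    unfolding tensor_relations_def Let_def G_def[symmetric] by (auto simp: gen)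
  have kill: "\<beta> r = \<zero>" if "r \<in> tensor_relations R S S" for r
    using that unfolding tensor_relations_def Let_def G_def[symmetric]
    by (auto simp: gen lin \<beta>gen S.minus_eq_zero_iff S.l_distr S.r_distr A.smult_assoc2 bar_smult smult_right)
  have K: "submodule ?K R G"
    unfolding tensor_kernel_def G_def[symmetric] by (rule submodule_gen_properties(1)[OF G rel])
  have killK: "\<beta> k = \<zero>" if "k \<in> ?K" for k
    using linear_map_kills_submodule_gen[OF G mS \<beta> rel kill] that
    unfolding tensor_kernel_def G_def[symmetric] by simp
  have T: "tensor_module R S S = quotient_module G ?K"
    by (simp add: tensor_module_def G_def)
  have \<pi>: "linear_map R G (tensor_module R S S) (\<lambda>x. ?K +>\<^bsub>G\<^esub> x)"
    unfolding T by (rule coset_map_linear[OF G K])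
  have Tgrp: "abelian_group (tensor_module R S S)" unfolding T by (rule quotient_abelian_group[OF G K])
  have val: "\<beta> f = (\<Oplus>i\<in>{..<n}. c i \<otimes> bar (d i)) \<and> f \<in> carrier G \<and>
      ?K +>\<^bsub>G\<^esub> f = (\<Oplus>\<^bsub>tensor_module R S S\<^esub>i\<in>{..<n}. tensor R S S (c i) (d i))"
    if f: "f = (\<Oplus>\<^bsub>G\<^esub>i\<in>{..<n}. free_gen R (c i, d i))" and c: "c \<in> {..<n} \<rightarrow> carrier S" and d: "d \<in> {..<n} \<rightarrow> carrier S" for f c d
  proof -
    have g: "(\<lambda>i. free_gen R (c i, d i)) \<in> {..<n} \<rightarrow> carrier G" using c d by (auto intro: gen)
    have "\<beta> f = (\<Oplus>i\<in>{..<n}. \<beta> (free_gen R (c i, d i)))"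
      unfolding f by (rule additive_map_finsum[OF G.abelian_group_axioms S.abelian_group_axioms])
        (use \<beta> g in \<open>auto simp: linear_map_def\<close>)
    also have "\<dots> = (\<Oplus>i\<in>{..<n}. c i \<otimes> bar (d i))"
      by (rule S.finsum_cong') (use c d in \<open>auto simp: \<beta>gen Pi_def\<close>)
    finally have 1: "\<beta> f = (\<Oplus>i\<in>{..<n}. c i \<otimes> bar (d i))" .
    have 2: "f \<in> carrier G" unfolding f by (rule G.finsum_closed[OF g])
    have "?K +>\<^bsub>G\<^esub> f = (\<Oplus>\<^bsub>tensor_module R S S\<^esub>i\<in>{..<n}. ?K +>\<^bsub>G\<^esub> free_gen R (c i, d i))"
      unfolding f by (rule additive_map_finsum[OF G.abelian_group_axioms Tgrp])
        (use \<pi> g in \<open>auto simp: linear_map_def\<close>)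
    then show ?thesis using 1 2 by (simp add: tensor_def G_def)
  qed
  have "(\<Oplus>i\<in>{..<n}. (s \<otimes> a i) \<otimes> bar (b i)) = (\<Oplus>i\<in>{..<n}. a i \<otimes> bar (s \<otimes> b i))" if s: "s \<in> carrier S" for s
  proof -
    let ?f = "\<Oplus>\<^bsub>G\<^esub>i\<in>{..<n}. free_gen R (s \<otimes> a i, b i)" and ?g = "\<Oplus>\<^bsub>G\<^esub>i\<in>{..<n}. free_gen R (a i, s \<otimes> b i)"
    have f': "\<beta> ?f = (\<Oplus>i\<in>{..<n}. (s \<otimes> a i) \<otimes> bar (b i)) \<and> ?f \<in> carrier G \<and>
      ?K +>\<^bsub>G\<^esub> ?f = (\<Oplus>\<^bsub>tensor_module R S S\<^esub>i\<in>{..<n}. tensor R S S (s \<otimes> a i) (b i))"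
      by (rule val[OF refl]) (use a b s in auto)
    note f = f'[THEN conjunct1] f'[THEN conjunct2, THEN conjunct1] f'[THEN conjunct2, THEN conjunct2]
    have g': "\<beta> ?g = (\<Oplus>i\<in>{..<n}. a i \<otimes> bar (s \<otimes> b i)) \<and> ?g \<in> carrier G \<and>
      ?K +>\<^bsub>G\<^esub> ?g = (\<Oplus>\<^bsub>tensor_module R S S\<^esub>i\<in>{..<n}. tensor R S S (a i) (s \<otimes> b i))"
      by (rule val[OF refl]) (use a b s in auto)
    note g = g'[THEN conjunct1] g'[THEN conjunct2, THEN conjunct1] g'[THEN conjunct2, THEN conjunct2]
    have "?K +>\<^bsub>G\<^esub> ?f = ?K +>\<^bsub>G\<^esub> ?g" by (simp only: f(3) g(3) sep[OF s])
    then have "?f \<ominus>\<^bsub>G\<^esub> ?g \<in> ?K" by (simp only: coset_eq_iff[OF G K f(2) g(2)])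
    then have "\<beta> (?f \<ominus>\<^bsub>G\<^esub> ?g) = \<zero>" by (rule killK)
    then have "\<beta> ?f \<ominus> \<beta> ?g = \<zero>" by (simp only: lin(6)[OF f(2) g(2)])
    then have "\<beta> ?f = \<beta> ?g" by (simp only: S.minus_eq_zero_iff lin(1) f(2) g(2))
    then show ?thesis by (simp only: f(1) g(1))
  qed
  then show thesis using that a b sum by blast
qed

text \<open>Let \<open>\<Sum> a\<^sub>i \<otimes> b\<^sub>i\<close> be a separability idempotent and \<open>\<epsilon> = \<Sum> a\<^sub>i bar b\<^sub>i\<close>. Then \<open>1 - \<epsilon> = \<Sum> a\<^sub>i (b\<^sub>i - bar b\<^sub>i)\<close> lies in \<open>I\<close>,
  and \<open>\<epsilon>\<close> is annihilated by all differences \<open>s - bar s\<close>; in particular \<open>\<epsilon>\<close> is idempotent and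
  equal to its norm, hence \<open>\<epsilon> = r 1\<close> with \<open>r \<in> R\<close>. On the part of \<open>S\<close> cut out by \<open>r\<close> the involution is trivial, so
  that \<open>2 r s = r (s + bar s)\<close> is a scalar for every \<open>s\<close>: this part has rank at most one. As \<open>S\<close> has
  rank two, \<open>r = 0\<close>.\<close>
lemma etale_differences_generate:
  assumes I: "ideal I S" and diff: "\<And>s. s \<in> carrier S \<Longrightarrow> s \<ominus> bar s \<in> I"
  shows "\<one> \<in> I"
proof -
  interpret I: ideal I S by (rule I)
  obtain n :: nat and a b where a: "a \<in> {..<n} \<rightarrow> carrier S" and b: "b \<in> {..<n} \<rightarrow> carrier S"
    and sum: "(\<Oplus>i\<in>{..<n}. a i \<otimes> b i) = \<one>"
    and sep: "\<And>s. s \<in> carrier S \<Longrightarrow> (\<Oplus>i\<in>{..<n}. (s \<otimes> a i) \<otimes> bar (b i)) = (\<Oplus>i\<in>{..<n}. a i \<otimes> bar (s \<otimes> b i))"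
    by (rule twisted_separability, rule that)
  have ai: "a i \<in> carrier S" and bi: "b i \<in> carrier S" if "i \<in> {..<n}" for i using a b that by auto
  define \<epsilon> where "\<epsilon> = (\<Oplus>i\<in>{..<n}. a i \<otimes> bar (b i))"
  have \<epsilon>: "\<epsilon> \<in> carrier S" unfolding \<epsilon>_def by (rule S.finsum_closed) (auto simp: ai bi)
  have conj: "s \<otimes> \<epsilon> = bar s \<otimes> \<epsilon>" if s: "s \<in> carrier S" for s
  proof -
    have "s \<otimes> \<epsilon> = (\<Oplus>i\<in>{..<n}. s \<otimes> (a i \<otimes> bar (b i)))"
      unfolding \<epsilon>_def by (rule S.finsum_rdistr) (use s ai bi in auto)
    also have "\<dots> = (\<Oplus>i\<in>{..<n}. (s \<otimes> a i) \<otimes> bar (b i))"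
      by (rule S.finsum_cong') (use s ai bi in \<open>auto simp: S.m_assoc\<close>)
    also have "\<dots> = (\<Oplus>i\<in>{..<n}. a i \<otimes> bar (s \<otimes> b i))" by (rule sep[OF s])
    also have "\<dots> = (\<Oplus>i\<in>{..<n}. bar s \<otimes> (a i \<otimes> bar (b i)))"
      by (rule S.finsum_cong') (use s ai bi in \<open>auto simp: S.m_lcomm\<close>)
    also have "\<dots> = bar s \<otimes> \<epsilon>"
      unfolding \<epsilon>_def by (rule S.finsum_rdistr[symmetric]) (use s ai bi in auto)
    finally show ?thesis .
  qed
  define \<delta> where "\<delta> = (\<Oplus>i\<in>{..<n}. a i \<otimes> (b i \<ominus> bar (b i)))"
  have \<delta>: "\<delta> \<in> carrier S" unfolding \<delta>_def by (rule S.finsum_closed) (auto simp: ai bi)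
  have \<delta>I: "\<delta> \<in> I" unfolding \<delta>_def
    by (rule I.finsum_mem) (auto intro!: I.I_l_closed diff simp: ai bi)
  have split: "\<one> = \<delta> \<oplus> \<epsilon>"
  proof -
    have "\<delta> \<oplus> \<epsilon> = (\<Oplus>i\<in>{..<n}. a i \<otimes> (b i \<ominus> bar (b i)) \<oplus> a i \<otimes> bar (b i))"
      unfolding \<delta>_def \<epsilon>_def by (rule S.finsum_addf[symmetric]) (auto simp: ai bi)
    also have "\<dots> = (\<Oplus>i\<in>{..<n}. a i \<otimes> b i)"
      by (rule S.finsum_cong') (use ai bi in \<open>auto simp: S.r_distr[symmetric] S.minus_eq S.a_assoc S.l_neg\<close>)
    finally show ?thesis using sum by simp
  qed
  have "\<epsilon> \<otimes> \<delta> = (\<Oplus>i\<in>{..<n}. \<epsilon> \<otimes> (a i \<otimes> (b i \<ominus> bar (b i))))"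
    unfolding \<delta>_def by (rule S.finsum_rdistr) (use \<epsilon> ai bi in auto)
  also have "\<dots> = \<zero>"
  proof (rule S.add.finprod_one_eqI)
    fix i assume i: "i \<in> {..<n}"
    have "\<epsilon> \<otimes> (a i \<otimes> (b i \<ominus> bar (b i))) = a i \<otimes> (b i \<otimes> \<epsilon> \<ominus> bar (b i) \<otimes> \<epsilon>)"
      using ai[OF i] bi[OF i] \<epsilon> by (simp add: S.expand_simps)
    then show "\<epsilon> \<otimes> (a i \<otimes> (b i \<ominus> bar (b i))) = \<zero>"
      using conj[OF bi[OF i]] ai[OF i] bi[OF i] \<epsilon> by (simp add: S.minus_eq S.r_neg)
  qed
  finally have \<epsilon>\<delta>: "\<epsilon> \<otimes> \<delta> = \<zero>" .
  have "\<epsilon> = \<epsilon> \<otimes> (\<delta> \<oplus> \<epsilon>)" using \<epsilon> by (simp only: split[symmetric] S.r_one)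
  then have idem: "\<epsilon> \<otimes> \<epsilon> = \<epsilon>" using \<epsilon> \<delta> \<epsilon>\<delta> by (simp add: S.r_distr)
  have "\<epsilon> \<otimes> bar \<epsilon> = \<epsilon>" using conj[OF \<epsilon>] idem \<epsilon> by (simp add: S.m_comm)
  then obtain r where r: "r \<in> carrier R" "\<epsilon> = r \<odot> \<one>"
    using norm_scalar[OF \<epsilon>] by (auto simp: scalars_def)
  have rank1: "\<exists>k\<in>carrier R. r \<odot> s = k \<odot> \<one>" if s: "s \<in> carrier S" for s
  proof -
    obtain q where q: "q \<in> carrier R" "s \<oplus> bar s = q \<odot> \<one>"
      using trace_scalar[OF s] by (auto simp: scalars_def)
    have rs: "r \<odot> s = \<epsilon> \<otimes> s" using smult_via_one[OF r(1) s] r(2) by simp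
    have "\<epsilon> \<otimes> s \<oplus> \<epsilon> \<otimes> s = \<epsilon> \<otimes> (s \<oplus> bar s)"
      using conj[OF s] s \<epsilon> by (simp add: S.r_distr S.m_comm)
    also have "\<dots> = (r \<otimes>\<^bsub>R\<^esub> q) \<odot> \<one>"
      using r q by (simp add: smult_via_one[symmetric] A.smult_assoc1)
    finally have "half_S \<otimes> ((r \<otimes>\<^bsub>R\<^esub> q) \<odot> \<one>) = \<epsilon> \<otimes> s" using halve[of "\<epsilon> \<otimes> s"] \<epsilon> s by simp
    moreover have "half_S \<otimes> ((r \<otimes>\<^bsub>R\<^esub> q) \<odot> \<one>) = (half R \<otimes>\<^bsub>R\<^esub> (r \<otimes>\<^bsub>R\<^esub> q)) \<odot> \<one>"
      using half_R r(1) q(1) unfolding half_S_def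
      by (simp add: smult_via_one[symmetric] A.smult_assoc1)
    ultimately have "r \<odot> s = (half R \<otimes>\<^bsub>R\<^esub> (r \<otimes>\<^bsub>R\<^esub> q)) \<odot> \<one>" using rs by simp
    then show ?thesis using half_R r(1) q(1) by blast
  qed
  have "(r \<otimes>\<^bsub>R\<^esub> r) \<odot> \<one> = r \<odot> \<one>"
    using idem r by (simp add: A.smult_assoc1 smult_via_one[of r "r \<odot> \<one>"])
  then have rr: "r \<otimes>\<^bsub>R\<^esub> r = r" using scalar_embedding_inj r(1) by simp
  have "r = \<zero>\<^bsub>R\<^esub>"
  proof (rule R.locally_zero_imp_zero[OF r(1)])
    fix \<pp> assume p: "primeideal \<pp> R"
    moreover have "constant_rank R S 2" using etale by (simp add: quadratic_etale_def)
    ultimately have "free_at_prime R S \<pp> 2" unfolding constant_rank_def by blast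
    then obtain b where b: "b \<in> {..<2::nat} \<rightarrow> carrier S"
      and ind: "\<And>c. c \<in> {..<2::nat} \<rightarrow> carrier R \<Longrightarrow> \<exists>t \<in> carrier R - \<pp>. t \<odot> (\<Oplus>i\<in>{..<2}. c i \<odot> b i) = \<zero> \<Longrightarrow>
         \<forall>i<2. \<exists>t \<in> carrier R - \<pp>. t \<otimes>\<^bsub>R\<^esub> c i = \<zero>\<^bsub>R\<^esub>"
      unfolding free_at_prime_def by auto
    have b01: "b 0 \<in> carrier S" "b 1 \<in> carrier S" using b by auto
    have indep: "(\<exists>t \<in> carrier R - \<pp>. t \<otimes>\<^bsub>R\<^esub> x = \<zero>\<^bsub>R\<^esub>) \<and> (\<exists>t \<in> carrier R - \<pp>. t \<otimes>\<^bsub>R\<^esub> y = \<zero>\<^bsub>R\<^esub>)"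
      if x: "x \<in> carrier R" and y: "y \<in> carrier R" and t: "t \<in> carrier R - \<pp>"
        and z: "t \<odot> (x \<odot> b 0 \<oplus> y \<odot> b 1) = \<zero>" for x y t
    proof -
      let ?c = "\<lambda>i::nat. if i = 0 then x else y"
      have c: "?c \<in> {..<2} \<rightarrow> carrier R" using x y by auto
      have sum: "(\<Oplus>i\<in>{..<2}. ?c i \<odot> b i) = x \<odot> b 0 \<oplus> y \<odot> b 1"
        using x y b01 by (simp add: numeral_2_eq_2 lessThan_Suc S.a_comm)
      have "\<exists>t \<in> carrier R - \<pp>. t \<odot> (\<Oplus>i\<in>{..<2}. ?c i \<odot> b i) = \<zero>"
        unfolding sum by (rule bexI[of _ t]) (rule z, rule t)
      from ind[OF c this, rule_format, of 0] ind[OF c this, rule_format, of 1] show ?thesis by simp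
    qed
    have one: "\<one>\<^bsub>R\<^esub> \<in> carrier R - \<pp>"
      using primeideal.I_notcarr[OF p] ideal.one_imp_carrier[OF primeideal.axioms(1)[OF p]] by auto
    obtain k0 where k0: "k0 \<in> carrier R" "r \<odot> b 0 = k0 \<odot> \<one>" using rank1[OF b01(1)] by blast
    obtain k1 where k1: "k1 \<in> carrier R" "r \<odot> b 1 = k1 \<odot> \<one>" using rank1[OF b01(2)] by blast
    \<comment> \<open>Independence of \<open>b\<^sub>0, b\<^sub>1\<close> makes \<open>k\<^sub>1 r\<close>, and with it \<open>r b\<^sub>1\<close>, vanish locally; then \<open>r\<close> vanishes locally.\<close>
    have "(k0 \<otimes>\<^bsub>R\<^esub> r) \<odot> b 1 = (k1 \<otimes>\<^bsub>R\<^esub> r) \<odot> b 0"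
    proof -
      have "(k0 \<otimes>\<^bsub>R\<^esub> r) \<odot> b 1 = (k0 \<otimes>\<^bsub>R\<^esub> k1) \<odot> \<one>" "(k1 \<otimes>\<^bsub>R\<^esub> r) \<odot> b 0 = (k1 \<otimes>\<^bsub>R\<^esub> k0) \<odot> \<one>"
        using k0 k1 r(1) b01 by (simp_all add: A.smult_assoc1)
      then show ?thesis by (simp only: R.m_comm[OF k0(1) k1(1)])
    qed
    then have "\<one>\<^bsub>R\<^esub> \<odot> ((k1 \<otimes>\<^bsub>R\<^esub> r) \<odot> b 0 \<oplus> (\<ominus>\<^bsub>R\<^esub> (k0 \<otimes>\<^bsub>R\<^esub> r)) \<odot> b 1) = \<zero>"
      using k0(1) k1(1) r(1) b01 by (simp add: A.smult_l_minus S.r_neg)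
    then obtain t where t: "t \<in> carrier R - \<pp>" "t \<otimes>\<^bsub>R\<^esub> (k1 \<otimes>\<^bsub>R\<^esub> r) = \<zero>\<^bsub>R\<^esub>"
      using indep[of "k1 \<otimes>\<^bsub>R\<^esub> r" "\<ominus>\<^bsub>R\<^esub> (k0 \<otimes>\<^bsub>R\<^esub> r)", OF _ _ one] k0(1) k1(1) r(1) by auto
    have "t \<odot> (r \<odot> b 1) = (t \<otimes>\<^bsub>R\<^esub> (k1 \<otimes>\<^bsub>R\<^esub> r)) \<odot> \<one>"
    proof -
      have "t \<odot> (r \<odot> b 1) = t \<odot> ((r \<otimes>\<^bsub>R\<^esub> r) \<odot> b 1)" by (simp add: rr)
      also have "\<dots> = t \<odot> (r \<odot> (k1 \<odot> \<one>))" using r(1) b01 k1(2) by (simp add: A.smult_assoc1)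
      finally show ?thesis using r(1) t(1) k1(1) by (simp add: A.smult_assoc1 R.m_comm[OF k1(1) r(1)])
    qed
    then have "t \<odot> (\<zero>\<^bsub>R\<^esub> \<odot> b 0 \<oplus> r \<odot> b 1) = \<zero>" using t(2) b01 r(1) by simp
    then show "\<exists>t\<in>carrier R - \<pp>. t \<otimes>\<^bsub>R\<^esub> r = \<zero>\<^bsub>R\<^esub>"
      using indep[OF R.zero_closed r(1) t(1)] by simp
  qed
  then have "\<epsilon> = \<zero>" using r by simp
  then have "\<one> = \<delta>" using split \<delta> by (metis S.r_zero)
  then show ?thesis using \<delta>I by simp
qed

end


section \<open>Semilinear isometries from isomorphisms of vector algebras\<close>

context trivialised_space
begin

lemma h_zero_left [simp]: "u \<in> carrier P \<Longrightarrow> h \<zero>\<^bsub>P\<^esub> u = \<zero>"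
  using bar_h[of u "\<zero>\<^bsub>P\<^esub>"] by simp

lemma cr_zero [simp]: "u \<in> carrier P \<Longrightarrow> cr \<zero>\<^bsub>P\<^esub> u = \<zero>\<^bsub>P\<^esub>" "u \<in> carrier P \<Longrightarrow> cr u \<zero>\<^bsub>P\<^esub> = \<zero>\<^bsub>P\<^esub>"
  using cr_smult_left[of \<zero> "\<zero>\<^bsub>P\<^esub>" u] cr_smult_right[of \<zero> u "\<zero>\<^bsub>P\<^esub>"] by simp_all

lemma smult_minus_left: "\<lbrakk>a \<in> carrier S; b \<in> carrier S; u \<in> carrier P\<rbrakk> \<Longrightarrow>
    (a \<ominus> b) \<odot>\<^bsub>P\<^esub> u = a \<odot>\<^bsub>P\<^esub> u \<ominus>\<^bsub>P\<^esub> b \<odot>\<^bsub>P\<^esub> u"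
  by (simp add: S.minus_eq P.minus_eq P.smult_l_distr P.smult_l_minus)

lemma restrict_smult_closed [simp]: "r \<in> carrier R \<Longrightarrow> u \<in> carrier P \<Longrightarrow> restrict_smult S P r u \<in> carrier P"
  and restrict_smult_zero [simp]: "u \<in> carrier P \<Longrightarrow> restrict_smult S P \<zero>\<^bsub>R\<^esub> u = \<zero>\<^bsub>P\<^esub>"
  and restrict_smult_one [simp]: "u \<in> carrier P \<Longrightarrow> restrict_smult S P \<one>\<^bsub>R\<^esub> u = u"
  and restrict_smult_zero_right [simp]: "r \<in> carrier R \<Longrightarrow> restrict_smult S P r \<zero>\<^bsub>P\<^esub> = \<zero>\<^bsub>P\<^esub>"
  by (simp_all add: restrict_smult_def)

lemma scalar_part_eq: "r \<in> carrier R \<Longrightarrow> r \<odot> \<one> = x \<Longrightarrow> scalar_part R S x = r"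
  unfolding scalar_part_def by (rule the_equality) (auto intro: scalar_embedding_inj)

lemma scalar_part_zero [simp]: "scalar_part R S \<zero> = \<zero>\<^bsub>R\<^esub>"
  by (rule scalar_part_eq) simp_all

lemma scalar_part_closed: "x \<in> scalars R S \<Longrightarrow> scalar_part R S x \<in> carrier R"
  by (auto simp: scalars_def scalar_part_eq)

lemma trace_form_closed [simp]:
  "u \<in> carrier P \<Longrightarrow> v \<in> carrier P \<Longrightarrow> scalar_part R S (h u v \<oplus> h v u) \<in> carrier R"
  using scalar_part_closed[OF trace_scalar[of "h u v"]] by simp

end

locale two_spaces =
  Q: trivialised_space R S P h \<alpha> + Q': trivialised_space R S' P' h' \<alpha>'
  for R :: "('r, 'm) ring_scheme"
    and S :: "('r, 's) invol_algebra" and P :: "('s, 'p) module" and h \<alpha>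
    and S' :: "('r, 't) invol_algebra" and P' :: "('t, 'q) module" and h' \<alpha>'

locale vector_iso = two_spaces +
  fixes f
  assumes bij: "bij_betw f (carrier P) (carrier P')"
    and add: "\<And>u v. \<lbrakk>u \<in> carrier P; v \<in> carrier P\<rbrakk> \<Longrightarrow> f (u \<oplus>\<^bsub>P\<^esub> v) = f u \<oplus>\<^bsub>P'\<^esub> f v"
    and smult: "\<And>r u. \<lbrakk>r \<in> carrier R; u \<in> carrier P\<rbrakk> \<Longrightarrow> f (restrict_smult S P r u) = restrict_smult S' P' r (f u)"
    and cross: "\<And>u v. \<lbrakk>u \<in> carrier P; v \<in> carrier P\<rbrakk> \<Longrightarrow> f (Q.cr u v) = Q'.cr (f u) (f v)"
begin

abbreviation "f_inv \<equiv> inv_into (carrier P) f"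

lemma f_closed [simp]: "u \<in> carrier P \<Longrightarrow> f u \<in> carrier P'"
  using bij by (rule bij_betwE[rule_format])

lemma f_inv_closed [simp]: "w \<in> carrier P' \<Longrightarrow> f_inv w \<in> carrier P"
  using bij by (metis bij_betw_imp_surj_on inv_into_into)

lemma f_f_inv [simp]: "w \<in> carrier P' \<Longrightarrow> f (f_inv w) = w"
  using bij by (rule bij_betw_inv_into_right)

lemma f_inv_f [simp]: "u \<in> carrier P \<Longrightarrow> f_inv (f u) = u"
  using bij by (rule bij_betw_inv_into_left)

lemma f_inject: "u \<in> carrier P \<Longrightarrow> v \<in> carrier P \<Longrightarrow> f u = f v \<Longrightarrow> u = v"
  using f_inv_f by metis

lemma f_minus: "u \<in> carrier P \<Longrightarrow> v \<in> carrier P \<Longrightarrow> f (u \<ominus>\<^bsub>P\<^esub> v) = f u \<ominus>\<^bsub>P'\<^esub> f v"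
  using additive_map_zero_minus(3)[OF Q.P.abelian_group_axioms Q'.P.abelian_group_axioms, of f u v] by (simp add: add)

lemma f_zero: "f \<zero>\<^bsub>P\<^esub> = \<zero>\<^bsub>P'\<^esub>"
  using additive_map_zero_minus(1)[OF Q.P.abelian_group_axioms Q'.P.abelian_group_axioms, of f] by (simp add: add)

lemma inverse: "vector_iso R S' P' h' \<alpha>' S P h \<alpha> f_inv"
proof (intro vector_iso.intro two_spaces.intro vector_iso_axioms.intro)
  show "bij_betw f_inv (carrier P') (carrier P)" by (rule bij_betw_inv_into[OF bij])
  show "f_inv (u \<oplus>\<^bsub>P'\<^esub> v) = f_inv u \<oplus>\<^bsub>P\<^esub> f_inv v" if "u \<in> carrier P'" "v \<in> carrier P'" for u v
    by (rule f_inject) (use that in \<open>simp_all add: add\<close>)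
  show "f_inv (restrict_smult S' P' r u) = restrict_smult S P r (f_inv u)" if "r \<in> carrier R" "u \<in> carrier P'" for r u
    by (rule f_inject) (use that in \<open>simp_all add: smult\<close>)
  show "f_inv (Q'.cr u v) = Q.cr (f_inv u) (f_inv v)" if "u \<in> carrier P'" "v \<in> carrier P'" for u v
    by (rule f_inject) (use that in \<open>simp_all add: cross\<close>)
qed (rule Q'.trivialised_space_axioms Q.trivialised_space_axioms)+

text \<open>The conjugate by \<open>f\<close> of the multiplication by \<open>a\<close> satisfies the hypotheses of \<open>centroid_scalar\<close>.\<close>
lemma scalar_exists:
  assumes a: "a \<in> carrier S"
  shows "\<exists>l\<in>carrier S'. \<forall>u\<in>carrier P. f (a \<odot>\<^bsub>P\<^esub> u) = l \<odot>\<^bsub>P'\<^esub> f u"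
proof -
  let ?\<phi> = "\<lambda>x. f (a \<odot>\<^bsub>P\<^esub> f_inv x)" and ?\<psi> = "\<lambda>x. f (Q.bar a \<odot>\<^bsub>P\<^esub> f_inv x)"
  have inv_add: "f_inv (u \<oplus>\<^bsub>P'\<^esub> v) = f_inv u \<oplus>\<^bsub>P\<^esub> f_inv v" if "u \<in> carrier P'" "v \<in> carrier P'" for u v
    by (rule f_inject) (use that in \<open>simp_all add: add\<close>)
  have inv_cross: "f_inv (Q'.cr u v) = Q.cr (f_inv u) (f_inv v)" if "u \<in> carrier P'" "v \<in> carrier P'" for u v
    by (rule f_inject) (use that in \<open>simp_all add: cross\<close>)
  have cr_f: "Q'.cr (f x) v = f (Q.cr x (f_inv v))" "Q'.cr v (f x) = f (Q.cr (f_inv v) x)"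
    if "x \<in> carrier P" "v \<in> carrier P'" for x v
    using that by (simp_all add: cross)
  obtain l where "l \<in> carrier S'" "\<And>v. v \<in> carrier P' \<Longrightarrow> ?\<phi> v = l \<odot>\<^bsub>P'\<^esub> v"
  proof (rule Q'.centroid_scalar[of ?\<phi> ?\<psi>])
    show "\<forall>u\<in>carrier P'. \<forall>v\<in>carrier P'. ?\<phi> (u \<oplus>\<^bsub>P'\<^esub> v) = ?\<phi> u \<oplus>\<^bsub>P'\<^esub> ?\<phi> v"
      using a by (simp add: inv_add add Q.P.smult_r_distr)
  qed (use a in \<open>auto simp: inv_cross cr_f Q.cr_smult_left Q.cr_smult_right\<close>)
  then show ?thesis by (intro bexI[of _ l]) (metis f_closed f_inv_f)
qed

definition \<sigma> where "\<sigma> a = (SOME l. l \<in> carrier S' \<and> (\<forall>u\<in>carrier P. f (a \<odot>\<^bsub>P\<^esub> u) = l \<odot>\<^bsub>P'\<^esub> f u))"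

lemma \<sigma>:
  assumes "a \<in> carrier S"
  shows \<sigma>_closed: "\<sigma> a \<in> carrier S'" and f_smult: "u \<in> carrier P \<Longrightarrow> f (a \<odot>\<^bsub>P\<^esub> u) = \<sigma> a \<odot>\<^bsub>P'\<^esub> f u"
proof -
  have "\<exists>l. l \<in> carrier S' \<and> (\<forall>u\<in>carrier P. f (a \<odot>\<^bsub>P\<^esub> u) = l \<odot>\<^bsub>P'\<^esub> f u)"
    using scalar_exists[OF assms] by blast
  from someI_ex[OF this] have *: "\<sigma> a \<in> carrier S' \<and> (\<forall>u\<in>carrier P. f (a \<odot>\<^bsub>P\<^esub> u) = \<sigma> a \<odot>\<^bsub>P'\<^esub> f u)"
    unfolding \<sigma>_def .
  then show "\<sigma> a \<in> carrier S'" by blast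
  show "f (a \<odot>\<^bsub>P\<^esub> u) = \<sigma> a \<odot>\<^bsub>P'\<^esub> f u" if "u \<in> carrier P" using * that by blast
qed

declare \<sigma>_closed [simp]

lemma \<sigma>_unique:
  assumes a: "a \<in> carrier S" and l: "l \<in> carrier S'" and eq: "\<And>u. u \<in> carrier P \<Longrightarrow> f (a \<odot>\<^bsub>P\<^esub> u) = l \<odot>\<^bsub>P'\<^esub> f u"
  shows "\<sigma> a = l"
proof (rule Q'.scalar_unique)
  fix v assume v: "v \<in> carrier P'"
  show "\<sigma> a \<odot>\<^bsub>P'\<^esub> v = l \<odot>\<^bsub>P'\<^esub> v"
    using f_smult[OF a, of "f_inv v"] eq[of "f_inv v"] v by simp
qed (use a l in simp_all)

lemma \<sigma>_add: "a \<in> carrier S \<Longrightarrow> b \<in> carrier S \<Longrightarrow> \<sigma> (a \<oplus>\<^bsub>S\<^esub> b) = \<sigma> a \<oplus>\<^bsub>S'\<^esub> \<sigma> b"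
  by (rule \<sigma>_unique) (simp_all add: Q.P.smult_l_distr Q'.P.smult_l_distr add f_smult)

lemma \<sigma>_mult: "a \<in> carrier S \<Longrightarrow> b \<in> carrier S \<Longrightarrow> \<sigma> (a \<otimes>\<^bsub>S\<^esub> b) = \<sigma> a \<otimes>\<^bsub>S'\<^esub> \<sigma> b"
  by (rule \<sigma>_unique) (simp_all add: Q.P.smult_assoc1 Q'.P.smult_assoc1 f_smult)

lemma \<sigma>_minus: "a \<in> carrier S \<Longrightarrow> b \<in> carrier S \<Longrightarrow> \<sigma> (a \<ominus>\<^bsub>S\<^esub> b) = \<sigma> a \<ominus>\<^bsub>S'\<^esub> \<sigma> b"
  by (rule \<sigma>_unique) (simp_all add: Q.smult_minus_left Q'.smult_minus_left f_minus f_smult)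

lemma \<sigma>_scalar: "r \<in> carrier R \<Longrightarrow> \<sigma> (r \<odot>\<^bsub>S\<^esub> \<one>\<^bsub>S\<^esub>) = r \<odot>\<^bsub>S'\<^esub> \<one>\<^bsub>S'\<^esub>"
  by (rule \<sigma>_unique) (use smult in \<open>simp_all add: restrict_smult_def\<close>)

lemma \<sigma>_smult: "r \<in> carrier R \<Longrightarrow> a \<in> carrier S \<Longrightarrow> \<sigma> (r \<odot>\<^bsub>S\<^esub> a) = r \<odot>\<^bsub>S'\<^esub> \<sigma> a"
  using Q.smult_via_one[of r a] Q'.smult_via_one[of r "\<sigma> a"] by (simp add: \<sigma>_mult \<sigma>_scalar)

lemma \<sigma>_bij: "bij_betw \<sigma> (carrier S) (carrier S')"
proof (rule bij_betw_imageI)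
  show "inj_on \<sigma> (carrier S)"
  proof (rule inj_onI)
    fix a b assume ab: "a \<in> carrier S" "b \<in> carrier S" "\<sigma> a = \<sigma> b"
    show "a = b"
    proof (rule Q.scalar_unique[OF ab(1,2)])
      fix v assume v: "v \<in> carrier P"
      show "a \<odot>\<^bsub>P\<^esub> v = b \<odot>\<^bsub>P\<^esub> v" by (rule f_inject) (use ab v in \<open>simp_all add: f_smult\<close>)
    qed
  qed
  show "\<sigma> ` carrier S = carrier S'"
  proof
    show "carrier S' \<subseteq> \<sigma> ` carrier S"
    proof
      fix b assume b: "b \<in> carrier S'"
      obtain a where a: "a \<in> carrier S" "\<forall>w\<in>carrier P'. f_inv (b \<odot>\<^bsub>P'\<^esub> w) = a \<odot>\<^bsub>P\<^esub> f_inv w"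
        using vector_iso.scalar_exists[OF inverse b] by blast
      have "\<sigma> a = b"
      proof (rule \<sigma>_unique[OF a(1) b])
        fix u assume u: "u \<in> carrier P"
        have "f_inv (b \<odot>\<^bsub>P'\<^esub> f u) = a \<odot>\<^bsub>P\<^esub> u" using a(2) u by simp
        then show "f (a \<odot>\<^bsub>P\<^esub> u) = b \<odot>\<^bsub>P'\<^esub> f u" using f_f_inv[of "b \<odot>\<^bsub>P'\<^esub> f u"] b u by simp
      qed
      then show "b \<in> \<sigma> ` carrier S" using a(1) by blast
    qed
  qed auto
qed

text \<open>The cross product is semilinear for the involution in each factor, so the two scalars agree on all cross
  products, and these span.\<close>
lemma \<sigma>_bar:
  assumes a: "a \<in> carrier S" shows "\<sigma> (Q.bar a) = Q'.bar (\<sigma> a)"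
proof -
  let ?N = "{w \<in> carrier P'. \<sigma> (Q.bar a) \<odot>\<^bsub>P'\<^esub> w = Q'.bar (\<sigma> a) \<odot>\<^bsub>P'\<^esub> w}"
  have "?N = carrier P'"
  proof (rule Q'.cross_products_span)
    fix u v assume c: "u \<in> carrier P'" "v \<in> carrier P'"
    define u0 v0 where "u0 = f_inv u" and "v0 = f_inv v"
    have c0: "u0 \<in> carrier P" "v0 \<in> carrier P" "f u0 = u" "f v0 = v" using c by (simp_all add: u0_def v0_def)
    have "\<sigma> (Q.bar a) \<odot>\<^bsub>P'\<^esub> Q'.cr u v = f (Q.cr (a \<odot>\<^bsub>P\<^esub> u0) v0)"
      using c0 a by (simp add: Q.cr_smult_left f_smult cross)
    also have "\<dots> = Q'.bar (\<sigma> a) \<odot>\<^bsub>P'\<^esub> Q'.cr u v"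
      using c0 a c by (simp add: Q'.cr_smult_left f_smult cross)
    finally show "Q'.cr u v \<in> ?N" using c by simp
  qed (use a in \<open>auto simp: Q'.P.smult_r_distr Q'.P.smult_r_minus\<close>)
  then show ?thesis using a by (intro Q'.scalar_unique) auto
qed

text \<open>Comparing \<open>f ((x \<times> y) \<times> w)\<close> with \<open>(f x \<times> f y) \<times> f w\<close> shows that the defect \<open>\<sigma> (h x w) - h' (f x) (f w)\<close>, as a function of
  \<open>f x\<close>, is proportional in the sense of \<open>proportional_functional_zero\<close>.\<close>
lemma isometry:
  assumes u: "u \<in> carrier P" and w: "w \<in> carrier P"
  shows "h' (f u) (f w) = \<sigma> (h u w)"
proof -
  let ?E = "\<lambda>x. \<sigma> (h (f_inv x) w) \<ominus>\<^bsub>S'\<^esub> h' x (f w)"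
  have "?E (f u) = \<zero>\<^bsub>S'\<^esub>"
  proof (rule Q'.proportional_functional_zero[of ?E])
    show "?E a \<in> carrier S'" if "a \<in> carrier P'" for a using that w by simp
    fix a b assume ab: "a \<in> carrier P'" "b \<in> carrier P'"
    define x y where "x = f_inv a" and "y = f_inv b"
    have xy: "x \<in> carrier P" "y \<in> carrier P" "f x = a" "f y = b" using ab by (simp_all add: x_def y_def)
    have "f (Q.cr (Q.cr x y) w) = Q'.cr (Q'.cr a b) (f w)" using xy w by (simp add: cross)
    then have eq: "\<sigma> (h x w) \<odot>\<^bsub>P'\<^esub> b \<ominus>\<^bsub>P'\<^esub> \<sigma> (h y w) \<odot>\<^bsub>P'\<^esub> a =
        h' a (f w) \<odot>\<^bsub>P'\<^esub> b \<ominus>\<^bsub>P'\<^esub> h' b (f w) \<odot>\<^bsub>P'\<^esub> a"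
      using xy w ab by (simp add: Q.triple_product Q'.triple_product f_minus f_smult)
    have shuffle: "p \<ominus>\<^bsub>P'\<^esub> r = q \<ominus>\<^bsub>P'\<^esub> s" if eq: "p \<ominus>\<^bsub>P'\<^esub> q = r \<ominus>\<^bsub>P'\<^esub> s"
      and c: "p \<in> carrier P'" "q \<in> carrier P'" "r \<in> carrier P'" "s \<in> carrier P'" for p q r s
    proof -
      have "p = (p \<ominus>\<^bsub>P'\<^esub> q) \<oplus>\<^bsub>P'\<^esub> q" using c by (simp add: Q'.P.minus_eq Q'.P.M.a_assoc Q'.P.M.l_neg)
      also have "\<dots> = (r \<ominus>\<^bsub>P'\<^esub> s) \<oplus>\<^bsub>P'\<^esub> q" by (simp only: eq)
      also have "\<dots> \<ominus>\<^bsub>P'\<^esub> r = (r \<oplus>\<^bsub>P'\<^esub> \<ominus>\<^bsub>P'\<^esub> r) \<oplus>\<^bsub>P'\<^esub> (q \<ominus>\<^bsub>P'\<^esub> s)" using c by (simp add: Q'.P.minus_eq Q'.P.M.a_ac)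
      finally show ?thesis using c by (simp add: Q'.P.M.r_neg)
    qed
    show "?E a \<odot>\<^bsub>P'\<^esub> b = ?E b \<odot>\<^bsub>P'\<^esub> a"
      using shuffle[OF eq] ab xy w by (simp add: Q'.smult_minus_left x_def y_def)
  qed (use u in simp)
  then show ?thesis using u w by (simp add: Q'.S.minus_eq_zero_iff)
qed

end


section \<open>Comparing the three kinds of algebras\<close>

context trivialised_space
begin

abbreviation "vectors \<equiv> vector_algebra R (S, P, h, \<alpha>)"
abbreviation "colours \<equiv> colour_algebra R (S, P, h, \<alpha>)"
abbreviation "octonions \<equiv> octonion_algebra R (S, P, h, \<alpha>)"

end
lemma algebra_isoD:
  assumes "g \<in> algebra_iso R A B"
  shows "bij_betw g (carrier A) (carrier B)"
    "\<And>x. x \<in> carrier A \<Longrightarrow> g x \<in> carrier B"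
    "\<And>x y. x \<in> carrier A \<Longrightarrow> y \<in> carrier A \<Longrightarrow> g (x \<oplus>\<^bsub>A\<^esub> y) = g x \<oplus>\<^bsub>B\<^esub> g y"
    "\<And>r x. r \<in> carrier R \<Longrightarrow> x \<in> carrier A \<Longrightarrow> g (r \<odot>\<^bsub>A\<^esub> x) = r \<odot>\<^bsub>B\<^esub> g x"
    "\<And>x y. x \<in> carrier A \<Longrightarrow> y \<in> carrier A \<Longrightarrow> g (x \<otimes>\<^bsub>A\<^esub> y) = g x \<otimes>\<^bsub>B\<^esub> g y"
  using assms by (auto simp: algebra_iso_def Hom_mod_def)

text \<open>The map is cut down to the carrier of \<open>A\<close>; it stays additive and multiplicative because \<open>A\<close> is closed under
  its operations.\<close>

lemma algebra_isoI:
  assumes "bij_betw g (carrier A) (carrier B)"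
    "\<And>x y. x \<in> carrier A \<Longrightarrow> y \<in> carrier A \<Longrightarrow> x \<oplus>\<^bsub>A\<^esub> y \<in> carrier A \<and> g (x \<oplus>\<^bsub>A\<^esub> y) = g x \<oplus>\<^bsub>B\<^esub> g y"
    "\<And>r x. r \<in> carrier R \<Longrightarrow> x \<in> carrier A \<Longrightarrow> r \<odot>\<^bsub>A\<^esub> x \<in> carrier A \<and> g (r \<odot>\<^bsub>A\<^esub> x) = r \<odot>\<^bsub>B\<^esub> g x"
    "\<And>x y. x \<in> carrier A \<Longrightarrow> y \<in> carrier A \<Longrightarrow> x \<otimes>\<^bsub>A\<^esub> y \<in> carrier A \<and> g (x \<otimes>\<^bsub>A\<^esub> y) = g x \<otimes>\<^bsub>B\<^esub> g y"
  shows "restrict g (carrier A) \<in> algebra_iso R A B"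
proof -
  have "bij_betw (restrict g (carrier A)) (carrier A) (carrier B)"
    using assms(1) by (simp cong: bij_betw_cong)
  moreover have "g x \<in> carrier B" if "x \<in> carrier A" for x using assms(1) that by (rule bij_betwE[rule_format])
  ultimately show ?thesis using assms(2-4) by (auto simp: algebra_iso_def Hom_mod_def)
qed

lemma (in vector_iso) vector_algebra_iso:
  "isomorphic_algebras R Q.vectors Q'.vectors"
proof -
  have "restrict f (carrier Q.vectors)
      \<in> algebra_iso R Q.vectors Q'.vectors"
    by (rule algebra_isoI) (simp_all add: bij add smult cross)
  then show ?thesis unfolding isomorphic_algebras_def by blast
qed


lemma (in two_spaces) vector_iso_of_algebra_iso:
  assumes "f \<in> algebra_iso R Q.vectors Q'.vectors"
  shows "vector_iso R S P h \<alpha> S' P' h' \<alpha>' f"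
  using algebra_isoD[OF assms] by unfold_locales simp_all

lemma (in vector_iso) pair_bij:
  assumes "bij_betw \<tau> X Y"
  shows "bij_betw (\<lambda>(a, u). (\<tau> a, f u)) (X \<times> carrier P) (Y \<times> carrier P')"
  using bij_betw_map_prod[OF assms bij] by (simp add: map_prod_def)

lemma (in vector_iso) octonion_pair_iso:
  "isomorphic_pairs R (octonion_pair R (S, P, h, \<alpha>)) (octonion_pair R (S', P', h', \<alpha>'))"
proof -
  let ?A = "Q.octonions" and ?g = "\<lambda>(a, u). (\<sigma> a, f u)"
  have "restrict ?g (carrier ?A) \<in> algebra_iso R ?A Q'.octonions"
  proof (rule algebra_isoI)
    show "bij_betw ?g (carrier ?A) (carrier Q'.octonions)"
      using pair_bij[OF \<sigma>_bij] by simp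
  qed (auto simp: \<sigma>_add add \<sigma>_smult smult \<sigma>_minus \<sigma>_mult isometry f_smult \<sigma>_bar cross)
  moreover have "restrict ?g (carrier ?A) ` (carrier S \<times> {\<zero>\<^bsub>P\<^esub>}) = carrier S' \<times> {\<zero>\<^bsub>P'\<^esub>}"
  proof -
    have "restrict ?g (carrier ?A) ` (carrier S \<times> {\<zero>\<^bsub>P\<^esub>}) = ?g ` (carrier S \<times> {\<zero>\<^bsub>P\<^esub>})"
      by (rule image_cong[OF refl]) auto
    also have "\<dots> = (\<sigma> ` carrier S) \<times> {\<zero>\<^bsub>P'\<^esub>}" by (auto simp: f_zero image_iff)
    finally show ?thesis using bij_betw_imp_surj_on[OF \<sigma>_bij] by simp
  qed
  ultimately show ?thesis unfolding isomorphic_pairs_def octonion_pair.simps fst_conv snd_conv by blast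
qed

text \<open>The trace \<open>h u v + h v u\<close> is a scalar from \<open>R\<close>, and \<open>\<sigma>\<close> fixes scalars.\<close>
lemma (in vector_iso) scalar_part_isometry:
  assumes u: "u \<in> carrier P" and v: "v \<in> carrier P"
  shows "scalar_part R S' (h' (f u) (f v) \<oplus>\<^bsub>S'\<^esub> h' (f v) (f u)) = scalar_part R S (h u v \<oplus>\<^bsub>S\<^esub> h v u)"
proof -
  have "h u v \<oplus>\<^bsub>S\<^esub> h v u \<in> scalars R S" using Q.trace_scalar[of "h u v"] u v by simp
  then obtain r where r: "r \<in> carrier R" "r \<odot>\<^bsub>S\<^esub> \<one>\<^bsub>S\<^esub> = h u v \<oplus>\<^bsub>S\<^esub> h v u" by (auto simp: scalars_def)
  have "r \<odot>\<^bsub>S'\<^esub> \<one>\<^bsub>S'\<^esub> = h' (f u) (f v) \<oplus>\<^bsub>S'\<^esub> h' (f v) (f u)"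
    using \<sigma>_scalar[OF r(1)] r(2) u v by (simp add: isometry \<sigma>_add)
  then show ?thesis using r Q.scalar_part_eq Q'.scalar_part_eq by simp
qed

lemma (in vector_iso) colour_algebra_iso:
  "isomorphic_algebras R Q.colours Q'.colours"
proof -
  let ?A = "Q.colours" and ?g = "\<lambda>(a, u). (a, f u)"
  have "restrict ?g (carrier ?A) \<in> algebra_iso R ?A Q'.colours"
  proof (rule algebra_isoI)
    show "bij_betw ?g (carrier ?A) (carrier Q'.colours)"
      using pair_bij[OF bij_betw_id, of "carrier R"] by simp
  qed (auto simp: add smult cross scalar_part_isometry Q.half_R)
  then show ?thesis unfolding isomorphic_algebras_def by blast
qed

context two_spaces
begin

text \<open>A bijection restricts to one of \<open>P\<close> with \<open>P'\<close> if it and its inverse map the slices over \<open>x\<close> and \<open>y\<close> into each other.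
  In the applications \<open>x\<close> and \<open>y\<close> are zero elements.\<close>
lemma graded_iso_restricts:
  assumes g: "bij_betw g (X \<times> carrier P) (Y \<times> carrier P')" and x: "x \<in> X" "y \<in> Y"
    and fwd: "\<And>u. u \<in> carrier P \<Longrightarrow> fst (g (x, u)) = y"
    and bwd: "\<And>w. w \<in> carrier P' \<Longrightarrow> fst (inv_into (X \<times> carrier P) g (y, w)) = x"
  shows "bij_betw (\<lambda>u. snd (g (x, u))) (carrier P) (carrier P')"
proof (rule bij_betwI)
  let ?k = "inv_into (X \<times> carrier P) g"
  have g_eq: "g (x, u) = (y, snd (g (x, u)))" if "u \<in> carrier P" for u using fwd[OF that] by (metis prod.collapse)
  have k_eq: "?k (y, w) = (x, snd (?k (y, w)))" if "w \<in> carrier P'" for w using bwd[OF that] by (metis prod.collapse)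
  have gc: "g (x, u) \<in> Y \<times> carrier P'" if "u \<in> carrier P" for u
    using bij_betwE[OF g] x that by blast
  have kc: "?k (y, w) \<in> X \<times> carrier P" if "w \<in> carrier P'" for w
    using bij_betwE[OF bij_betw_inv_into[OF g]] x that by blast
  show "(\<lambda>u. snd (g (x, u))) \<in> carrier P \<rightarrow> carrier P'" using gc by (auto simp: mem_Times_iff)
  show "(\<lambda>w. snd (?k (y, w))) \<in> carrier P' \<rightarrow> carrier P" using kc by (auto simp: mem_Times_iff)
  show "snd (?k (y, snd (g (x, u)))) = u" if u: "u \<in> carrier P" for u
    using bij_betw_inv_into_left[OF g, of "(x, u)"] g_eq[OF u] x u by simp
  show "snd (g (x, snd (?k (y, w)))) = w" if w: "w \<in> carrier P'" for w
    using bij_betw_inv_into_right[OF g, of "(y, w)"] k_eq[OF w] x w by simp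
qed

text \<open>For \<open>s \<in> S\<close> and \<open>u \<in> P\<close> one has \<open>(s, 0) (0, u) = (0, s u)\<close> and \<open>(0, u) (s, 0) = (0, bar s \<cdot> u)\<close>. The
  \<open>S'\<close>-components of the images of these two products agree because \<open>g\<close> maps \<open>S\<close> into the commutative ring \<open>S'\<close>. So the
  scalars \<open>c\<close> for which \<open>g\<close> maps \<open>c P\<close> into \<open>P'\<close> form an ideal containing all \<open>s - bar s\<close>.\<close>
lemma octonion_iso_preserves_complement:
  assumes g: "g \<in> algebra_iso R Q.octonions Q'.octonions"
    and sub: "g ` (carrier S \<times> {\<zero>\<^bsub>P\<^esub>}) \<subseteq> carrier S' \<times> {\<zero>\<^bsub>P'\<^esub>}" and u: "u \<in> carrier P"
  shows "fst (g (\<zero>\<^bsub>S\<^esub>, u)) = \<zero>\<^bsub>S'\<^esub>"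
proof -
  let ?A = "Q.octonions" and ?B = "Q'.octonions"
  note D = algebra_isoD[OF g]
  define L where "L u = fst (g (\<zero>\<^bsub>S\<^esub>, u))" for u
  have gc: "g (\<zero>\<^bsub>S\<^esub>, u) \<in> carrier S' \<times> carrier P'" if "u \<in> carrier P" for u using D(2)[of "(\<zero>\<^bsub>S\<^esub>, u)"] that by simp
  have Lc: "L u \<in> carrier S'" if "u \<in> carrier P" for u using gc[OF that] by (auto simp: L_def mem_Times_iff)
  have Ladd: "L (u \<oplus>\<^bsub>P\<^esub> v) = L u \<oplus>\<^bsub>S'\<^esub> L v" if c: "u \<in> carrier P" "v \<in> carrier P" for u v
    using D(3)[of "(\<zero>\<^bsub>S\<^esub>, u)" "(\<zero>\<^bsub>S\<^esub>, v)"] c by (simp add: L_def case_prod_beta)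
  have Lminus: "L (u \<ominus>\<^bsub>P\<^esub> v) = L u \<ominus>\<^bsub>S'\<^esub> L v" if "u \<in> carrier P" "v \<in> carrier P" for u v
    using additive_map_zero_minus(3)[OF Q.P.abelian_group_axioms Q'.S.abelian_group_axioms, of L u v] that
    by (simp add: Lc Ladd)
  have Lzero: "L \<zero>\<^bsub>P\<^esub> = \<zero>\<^bsub>S'\<^esub>"
    using additive_map_zero_minus(1)[OF Q.P.abelian_group_axioms Q'.S.abelian_group_axioms, of L] by (simp add: Lc Ladd)
  have comm: "L (s \<odot>\<^bsub>P\<^esub> u) = L (Q.bar s \<odot>\<^bsub>P\<^esub> u)" if s: "s \<in> carrier S" and u: "u \<in> carrier P" for s u
  proof -
    obtain t where t: "t \<in> carrier S'" "g (s, \<zero>\<^bsub>P\<^esub>) = (t, \<zero>\<^bsub>P'\<^esub>)" using sub s by auto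
    obtain x w where xw: "x \<in> carrier S'" "w \<in> carrier P'" "g (\<zero>\<^bsub>S\<^esub>, u) = (x, w)" using gc[OF u] by auto
    have "g (\<zero>\<^bsub>S\<^esub>, s \<odot>\<^bsub>P\<^esub> u) = g ((s, \<zero>\<^bsub>P\<^esub>) \<otimes>\<^bsub>?A\<^esub> (\<zero>\<^bsub>S\<^esub>, u))" using s u by (simp add: Q.S.minus_eq)
    also have "\<dots> = (t, \<zero>\<^bsub>P'\<^esub>) \<otimes>\<^bsub>?B\<^esub> (x, w)" using D(5)[of "(s, \<zero>\<^bsub>P\<^esub>)" "(\<zero>\<^bsub>S\<^esub>, u)"] s u t xw by simp
    finally have 1: "L (s \<odot>\<^bsub>P\<^esub> u) = t \<otimes>\<^bsub>S'\<^esub> x" using t xw by (simp add: L_def Q'.S.minus_eq)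
    have "g (\<zero>\<^bsub>S\<^esub>, Q.bar s \<odot>\<^bsub>P\<^esub> u) = g ((\<zero>\<^bsub>S\<^esub>, u) \<otimes>\<^bsub>?A\<^esub> (s, \<zero>\<^bsub>P\<^esub>))" using s u by (simp add: Q.S.minus_eq)
    also have "\<dots> = (x, w) \<otimes>\<^bsub>?B\<^esub> (t, \<zero>\<^bsub>P'\<^esub>)" using D(5)[of "(\<zero>\<^bsub>S\<^esub>, u)" "(s, \<zero>\<^bsub>P\<^esub>)"] s u t xw by simp
    finally have 2: "L (Q.bar s \<odot>\<^bsub>P\<^esub> u) = x \<otimes>\<^bsub>S'\<^esub> t" using t xw by (simp add: L_def Q'.S.minus_eq)
    show ?thesis using 1 2 t(1) xw(1) by (simp add: Q'.S.m_comm)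
  qed
  let ?I = "{c \<in> carrier S. \<forall>u\<in>carrier P. L (c \<odot>\<^bsub>P\<^esub> u) = \<zero>\<^bsub>S'\<^esub>}"
  have "ideal ?I S"
  proof (rule Q.S.idealI_elements)
    show "a \<oplus>\<^bsub>S\<^esub> b \<in> ?I" if "a \<in> ?I" "b \<in> ?I" for a b
      using that by (simp add: Q.P.smult_l_distr Ladd)
    show "x \<otimes>\<^bsub>S\<^esub> a \<in> ?I" if "a \<in> ?I" "x \<in> carrier S" for a x
      using that by (simp add: Q.S.m_comm[of x a] Q.P.smult_assoc1)
  qed (auto simp: Lzero)
  then have "\<one>\<^bsub>S\<^esub> \<in> ?I"
  proof (rule Q.etale_differences_generate)
    show "s \<ominus>\<^bsub>S\<^esub> Q.bar s \<in> ?I" if s: "s \<in> carrier S" for s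
      using s comm[OF s] by (simp add: Q.smult_minus_left Lminus Lc Q'.S.minus_eq_zero_iff)
  qed
  then show ?thesis using u by (simp add: L_def)
qed

end

lemma inv_into_algebra_iso:
  assumes g: "g \<in> algebra_iso R A B"
    and clo: "\<And>x y. x \<in> carrier A \<Longrightarrow> y \<in> carrier A \<Longrightarrow> x \<oplus>\<^bsub>A\<^esub> y \<in> carrier A \<and> x \<otimes>\<^bsub>A\<^esub> y \<in> carrier A"
      "\<And>r x. r \<in> carrier R \<Longrightarrow> x \<in> carrier A \<Longrightarrow> r \<odot>\<^bsub>A\<^esub> x \<in> carrier A"
    and clo': "\<And>x y. x \<in> carrier B \<Longrightarrow> y \<in> carrier B \<Longrightarrow> x \<oplus>\<^bsub>B\<^esub> y \<in> carrier B \<and> x \<otimes>\<^bsub>B\<^esub> y \<in> carrier B"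
      "\<And>r x. r \<in> carrier R \<Longrightarrow> x \<in> carrier B \<Longrightarrow> r \<odot>\<^bsub>B\<^esub> x \<in> carrier B"
  shows "restrict (inv_into (carrier A) g) (carrier B) \<in> algebra_iso R B A"
proof (rule algebra_isoI)
  note D = algebra_isoD[OF g]
  let ?k = "inv_into (carrier A) g"
  show bij: "bij_betw ?k (carrier B) (carrier A)" by (rule bij_betw_inv_into[OF D(1)])
  have kc: "?k x \<in> carrier A" if "x \<in> carrier B" for x using bij_betwE[OF bij] that by blast
  have gk: "g (?k x) = x" if "x \<in> carrier B" for x using bij_betw_inv_into_right[OF D(1) that] .
  have kg: "?k (g x) = x" if "x \<in> carrier A" for x using bij_betw_inv_into_left[OF D(1) that] .
  show "x \<oplus>\<^bsub>B\<^esub> y \<in> carrier B \<and> ?k (x \<oplus>\<^bsub>B\<^esub> y) = ?k x \<oplus>\<^bsub>A\<^esub> ?k y" if c: "x \<in> carrier B" "y \<in> carrier B" for x y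
    using kg[of "?k x \<oplus>\<^bsub>A\<^esub> ?k y"] D(3)[of "?k x" "?k y"] clo(1)[of "?k x" "?k y"] clo'(1)[OF c] kc gk c by simp
  show "x \<otimes>\<^bsub>B\<^esub> y \<in> carrier B \<and> ?k (x \<otimes>\<^bsub>B\<^esub> y) = ?k x \<otimes>\<^bsub>A\<^esub> ?k y" if c: "x \<in> carrier B" "y \<in> carrier B" for x y
    using kg[of "?k x \<otimes>\<^bsub>A\<^esub> ?k y"] D(5)[of "?k x" "?k y"] clo(1)[of "?k x" "?k y"] clo'(1)[OF c] kc gk c by simp
  show "r \<odot>\<^bsub>B\<^esub> x \<in> carrier B \<and> ?k (r \<odot>\<^bsub>B\<^esub> x) = r \<odot>\<^bsub>A\<^esub> ?k x" if r: "r \<in> carrier R" and c: "x \<in> carrier B" for r x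
    using kg[of "r \<odot>\<^bsub>A\<^esub> ?k x"] D(4)[OF r, of "?k x"] clo(2)[OF r, of "?k x"] clo'(2)[OF r c] kc gk c by simp
qed

lemma (in trivialised_space) octonion_closed:
  "\<lbrakk>x \<in> carrier octonions; y \<in> carrier octonions\<rbrakk> \<Longrightarrow>
     x \<oplus>\<^bsub>octonions\<^esub> y \<in> carrier octonions \<and>
     x \<otimes>\<^bsub>octonions\<^esub> y \<in> carrier octonions"
  "\<lbrakk>r \<in> carrier R; x \<in> carrier octonions\<rbrakk> \<Longrightarrow>
     r \<odot>\<^bsub>octonions\<^esub> x \<in> carrier octonions"
  by auto

lemma (in trivialised_space) colour_closed:
  "\<lbrakk>x \<in> carrier colours; y \<in> carrier colours\<rbrakk> \<Longrightarrow>
     x \<oplus>\<^bsub>colours\<^esub> y \<in> carrier colours \<and>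
     x \<otimes>\<^bsub>colours\<^esub> y \<in> carrier colours"
  "\<lbrakk>r \<in> carrier R; x \<in> carrier colours\<rbrakk> \<Longrightarrow>
     r \<odot>\<^bsub>colours\<^esub> x \<in> carrier colours"
  by (auto simp: half_R)

lemma (in two_spaces) swap: "two_spaces R S' P' h' \<alpha>' S P h \<alpha>"
  by (intro two_spaces.intro Q.trivialised_space_axioms Q'.trivialised_space_axioms)

text \<open>In \<open>(0, u) (0, v) = (- h u v, u \<times> v)\<close> the first summand is mapped into \<open>S'\<close>, so the \<open>P'\<close>-component of the
  image is \<open>g (u \<times> v)\<close>.\<close>
lemma (in two_spaces) vector_iso_of_octonion_iso:
  assumes g: "g \<in> algebra_iso R Q.octonions Q'.octonions"
    and S: "g ` (carrier S \<times> {\<zero>\<^bsub>P\<^esub>}) = carrier S' \<times> {\<zero>\<^bsub>P'\<^esub>}"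
  shows "vector_iso R S P h \<alpha> S' P' h' \<alpha>' (\<lambda>u. snd (g (\<zero>\<^bsub>S\<^esub>, u)))"
proof -
  let ?A = "Q.octonions" and ?B = "Q'.octonions"
  let ?k = "inv_into (carrier ?A) g" and ?f = "\<lambda>u. snd (g (\<zero>\<^bsub>S\<^esub>, u))"
  note D = algebra_isoD[OF g]
  have k: "restrict ?k (carrier ?B) \<in> algebra_iso R ?B ?A"
    by (rule inv_into_algebra_iso[OF g]; (rule Q.octonion_closed Q'.octonion_closed; assumption)?)
  have fwd: "fst (g (\<zero>\<^bsub>S\<^esub>, u)) = \<zero>\<^bsub>S'\<^esub>" if "u \<in> carrier P" for u
    by (rule octonion_iso_preserves_complement[OF g _ that]) (simp add: S)
  have kS: "restrict ?k (carrier ?B) ` (carrier S' \<times> {\<zero>\<^bsub>P'\<^esub>}) \<subseteq> carrier S \<times> {\<zero>\<^bsub>P\<^esub>}"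
  proof (rule image_subsetI)
    fix y assume y: "y \<in> carrier S' \<times> {\<zero>\<^bsub>P'\<^esub>}"
    then have yB: "y \<in> carrier ?B" by auto
    obtain x where x: "x \<in> carrier S \<times> {\<zero>\<^bsub>P\<^esub>}" "y = g x" using y S by blast
    then have "x \<in> carrier ?A" by auto
    then have "?k y = x" using bij_betw_inv_into_left[OF D(1)] x(2) by simp
    then show "restrict ?k (carrier ?B) y \<in> carrier S \<times> {\<zero>\<^bsub>P\<^esub>}" using x(1) yB by simp
  qed
  have bwd: "fst (?k (\<zero>\<^bsub>S'\<^esub>, w)) = \<zero>\<^bsub>S\<^esub>" if "w \<in> carrier P'" for w
    using two_spaces.octonion_iso_preserves_complement[OF swap k kS that] that by simp
  have bij: "bij_betw ?f (carrier P) (carrier P')"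
    by (rule graded_iso_restricts[where X = "carrier S" and Y = "carrier S'"])
      (use D(1) fwd bwd in simp_all)
  have g_eq: "g (\<zero>\<^bsub>S\<^esub>, u) = (\<zero>\<^bsub>S'\<^esub>, ?f u)" if "u \<in> carrier P" for u
    using fwd[OF that] by (metis prod.collapse)
  have fc: "?f u \<in> carrier P'" if "u \<in> carrier P" for u using bij that by (rule bij_betwE[rule_format])
  show ?thesis
  proof (intro vector_iso.intro vector_iso_axioms.intro two_spaces_axioms bij)
    fix u v assume c: "u \<in> carrier P" "v \<in> carrier P"
    show "?f (u \<oplus>\<^bsub>P\<^esub> v) = ?f u \<oplus>\<^bsub>P'\<^esub> ?f v"
      using D(3)[of "(\<zero>\<^bsub>S\<^esub>, u)" "(\<zero>\<^bsub>S\<^esub>, v)"] c by (simp add: case_prod_beta)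
    let ?t = "\<ominus>\<^bsub>S\<^esub> h u v"
    have "(?t, \<zero>\<^bsub>P\<^esub>) \<in> carrier S \<times> {\<zero>\<^bsub>P\<^esub>}" using c by simp
    then have "g (?t, \<zero>\<^bsub>P\<^esub>) \<in> carrier S' \<times> {\<zero>\<^bsub>P'\<^esub>}" unfolding S[symmetric] by (rule imageI)
    then obtain t where t: "t \<in> carrier S'" "g (?t, \<zero>\<^bsub>P\<^esub>) = (t, \<zero>\<^bsub>P'\<^esub>)" by auto
    have "g (?t, Q.cr u v) = (t, ?f (Q.cr u v))"
      using D(3)[of "(?t, \<zero>\<^bsub>P\<^esub>)" "(\<zero>\<^bsub>S\<^esub>, Q.cr u v)"] c t fwd[of "Q.cr u v"] fc[of "Q.cr u v"] by (simp add: case_prod_beta)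
    moreover have "g (?t, Q.cr u v) = (\<zero>\<^bsub>S'\<^esub>, ?f u) \<otimes>\<^bsub>?B\<^esub> (\<zero>\<^bsub>S'\<^esub>, ?f v)"
      using D(5)[of "(\<zero>\<^bsub>S\<^esub>, u)" "(\<zero>\<^bsub>S\<^esub>, v)"] c g_eq[OF c(1)] g_eq[OF c(2)] by (simp add: Q.S.minus_eq)
    ultimately show "?f (Q.cr u v) = Q'.cr (?f u) (?f v)" using fc c by simp
  next
    fix r u assume c: "r \<in> carrier R" "u \<in> carrier P"
    show "?f (restrict_smult S P r u) = restrict_smult S' P' r (?f u)"
      using D(4)[OF c(1), of "(\<zero>\<^bsub>S\<^esub>, u)"] c by (simp add: case_prod_beta)
  qed
qed

context two_spaces
begin

text \<open>The image of the unit element is a left unit on the image of \<open>g\<close>, which is everything; multiply it by the unit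
  element of the target.\<close>
lemma colour_iso_one:
  assumes g: "g \<in> algebra_iso R Q.colours Q'.colours"
  shows "g (\<one>\<^bsub>R\<^esub>, \<zero>\<^bsub>P\<^esub>) = (\<one>\<^bsub>R\<^esub>, \<zero>\<^bsub>P'\<^esub>)"
proof -
  let ?A = "Q.colours" and ?B = "Q'.colours"
  note D = algebra_isoD[OF g]
  have "(\<one>\<^bsub>R\<^esub>, \<zero>\<^bsub>P'\<^esub>) \<in> g ` carrier ?A" using bij_betw_imp_surj_on[OF D(1)] by simp
  then obtain b v where bv: "b \<in> carrier R" "v \<in> carrier P" "g (b, v) = (\<one>\<^bsub>R\<^esub>, \<zero>\<^bsub>P'\<^esub>)" by auto
  obtain a u where au: "a \<in> carrier R" "u \<in> carrier P'" "g (\<one>\<^bsub>R\<^esub>, \<zero>\<^bsub>P\<^esub>) = (a, u)"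
    using D(2)[of "(\<one>\<^bsub>R\<^esub>, \<zero>\<^bsub>P\<^esub>)"] by auto
  have cA: "(\<one>\<^bsub>R\<^esub>, \<zero>\<^bsub>P\<^esub>) \<in> carrier ?A" "(b, v) \<in> carrier ?A" using bv by simp_all
  have e: "(\<one>\<^bsub>R\<^esub>, \<zero>\<^bsub>P\<^esub>) \<otimes>\<^bsub>?A\<^esub> (b, v) = (b, v)"
    using bv Q.half_R(1) by (simp add: Q.R.minus_eq)
  have "(\<one>\<^bsub>R\<^esub>, \<zero>\<^bsub>P'\<^esub>) = (a, u) \<otimes>\<^bsub>?B\<^esub> (\<one>\<^bsub>R\<^esub>, \<zero>\<^bsub>P'\<^esub>)"
    using D(5)[OF cA] unfolding e bv(3) au(3) .
  also have "\<dots> = (a, u)" using au(1,2) Q.half_R(1) by (simp add: Q.R.minus_eq)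
  finally show ?thesis using au(3) by simp
qed

text \<open>The products \<open>(0, u) (0, v)\<close> and \<open>(0, v) (0, u)\<close> have the same \<open>R\<close>-component and opposite cross products,
  and the \<open>R\<close>-component of a product in the target is symmetric. So the \<open>R\<close>-component \<open>L\<close> of \<open>g\<close> satisfies
  \<open>L (u \<times> v) = - L (u \<times> v)\<close>, and it vanishes on \<open>P\<close> because the cross products span.\<close>
lemma colour_iso_preserves_complement:
  assumes g: "g \<in> algebra_iso R Q.colours Q'.colours"
    and u: "u \<in> carrier P"
  shows "fst (g (\<zero>\<^bsub>R\<^esub>, u)) = \<zero>\<^bsub>R\<^esub>"
proof -
  let ?A = "Q.colours" and ?B = "Q'.colours"
  note D = algebra_isoD[OF g]
  define L where "L u = fst (g (\<zero>\<^bsub>R\<^esub>, u))" for u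
  have gc: "g (\<zero>\<^bsub>R\<^esub>, u) \<in> carrier R \<times> carrier P'" if "u \<in> carrier P" for u using D(2)[of "(\<zero>\<^bsub>R\<^esub>, u)"] that by simp
  have Lc: "L u \<in> carrier R" if "u \<in> carrier P" for u using gc[OF that] by (auto simp: L_def mem_Times_iff)
  have Ladd: "L (u \<oplus>\<^bsub>P\<^esub> v) = L u \<oplus>\<^bsub>R\<^esub> L v" if c: "u \<in> carrier P" "v \<in> carrier P" for u v
    using D(3)[of "(\<zero>\<^bsub>R\<^esub>, u)" "(\<zero>\<^bsub>R\<^esub>, v)"] c by (simp add: L_def case_prod_beta)
  have Lneg: "L (\<ominus>\<^bsub>P\<^esub> u) = \<ominus>\<^bsub>R\<^esub> L u" if "u \<in> carrier P" for u
    using additive_map_zero_minus(2)[OF Q.P.abelian_group_axioms Q.R.abelian_group_axioms, of L u] that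
    by (simp add: Lc Ladd)
  have Lzero: "L \<zero>\<^bsub>P\<^esub> = \<zero>\<^bsub>R\<^esub>"
    using additive_map_zero_minus(1)[OF Q.P.abelian_group_axioms Q.R.abelian_group_axioms, of L] by (simp add: Lc Ladd)
  have Lcr: "L (Q.cr u v) = \<zero>\<^bsub>R\<^esub>" if c: "u \<in> carrier P" "v \<in> carrier P" for u v
  proof -
    obtain x w where xw: "x \<in> carrier R" "w \<in> carrier P'" "g (\<zero>\<^bsub>R\<^esub>, u) = (x, w)" using gc[OF c(1)] by auto
    obtain y z where yz: "y \<in> carrier R" "z \<in> carrier P'" "g (\<zero>\<^bsub>R\<^esub>, v) = (y, z)" using gc[OF c(2)] by auto
    define t where "t = \<ominus>\<^bsub>R\<^esub> (half R \<otimes>\<^bsub>R\<^esub> scalar_part R S (h u v \<oplus>\<^bsub>S\<^esub> h v u))"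
    have t: "t \<in> carrier R" using c Q.half_R by (simp add: t_def)
    have gt: "g (t, \<zero>\<^bsub>P\<^esub>) \<in> carrier R \<times> carrier P'" using D(2)[of "(t, \<zero>\<^bsub>P\<^esub>)"] t by simp
    have T: "fst (g (t, n)) = fst (g (t, \<zero>\<^bsub>P\<^esub>)) \<oplus>\<^bsub>R\<^esub> L n" if "n \<in> carrier P" for n
      using D(3)[of "(t, \<zero>\<^bsub>P\<^esub>)" "(\<zero>\<^bsub>R\<^esub>, n)"] t that by (simp add: L_def case_prod_beta)
    have 1: "(\<zero>\<^bsub>R\<^esub>, u) \<otimes>\<^bsub>?A\<^esub> (\<zero>\<^bsub>R\<^esub>, v) = (t, Q.cr u v)"
      using c Q.half_R by (simp add: t_def Q.R.minus_eq)
    have 2: "(\<zero>\<^bsub>R\<^esub>, v) \<otimes>\<^bsub>?A\<^esub> (\<zero>\<^bsub>R\<^esub>, u) = (t, Q.cr v u)"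
      using c Q.half_R by (simp add: t_def Q.R.minus_eq Q.S.a_comm)
    have "fst (g (t, Q.cr u v)) = fst ((x, w) \<otimes>\<^bsub>?B\<^esub> (y, z))"
      using D(5)[of "(\<zero>\<^bsub>R\<^esub>, u)" "(\<zero>\<^bsub>R\<^esub>, v)"] 1 c xw yz by simp
    also have "\<dots> = fst ((y, z) \<otimes>\<^bsub>?B\<^esub> (x, w))"
      using xw yz by (simp add: Q.R.m_comm Q'.S.a_comm)
    also have "\<dots> = fst (g (t, Q.cr v u))"
      using D(5)[of "(\<zero>\<^bsub>R\<^esub>, v)" "(\<zero>\<^bsub>R\<^esub>, u)"] 2 c xw yz by simp
    finally have "L (Q.cr u v) = L (\<ominus>\<^bsub>P\<^esub> Q.cr u v)"
      using T[of "Q.cr u v"] T[of "Q.cr v u"] c gt Q.cr_swap[OF c]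
      by (auto simp: mem_Times_iff Lc)
    then have neg: "L (Q.cr u v) = \<ominus>\<^bsub>R\<^esub> L (Q.cr u v)" using Lneg c by simp
    have X: "L (Q.cr u v) \<in> carrier R" using Lc c by simp
    have "L (Q.cr u v) = (half R \<oplus>\<^bsub>R\<^esub> half R) \<otimes>\<^bsub>R\<^esub> L (Q.cr u v)" using X Q.half_R by simp
    also have "\<dots> = half R \<otimes>\<^bsub>R\<^esub> (L (Q.cr u v) \<oplus>\<^bsub>R\<^esub> L (Q.cr u v))"
      using X Q.half_R(1) by (simp only: Q.R.l_distr Q.R.r_distr)
    also have "L (Q.cr u v) \<oplus>\<^bsub>R\<^esub> L (Q.cr u v) = L (Q.cr u v) \<oplus>\<^bsub>R\<^esub> \<ominus>\<^bsub>R\<^esub> L (Q.cr u v)" by (rule arg_cong[OF neg])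
    also have "\<dots> = \<zero>\<^bsub>R\<^esub>" by (rule Q.R.r_neg[OF X])
    finally show ?thesis using Q.half_R(1) by simp
  qed
  have "{u \<in> carrier P. L u = \<zero>\<^bsub>R\<^esub>} = carrier P"
    by (rule Q.cross_products_span) (auto simp: Lzero Ladd Lneg Lcr)
  then show ?thesis using u by (auto simp: L_def)
qed

lemma vector_iso_of_colour_iso:
  assumes g: "g \<in> algebra_iso R Q.colours Q'.colours"
  shows "vector_iso R S P h \<alpha> S' P' h' \<alpha>' (\<lambda>u. snd (g (\<zero>\<^bsub>R\<^esub>, u)))"
proof -
  let ?A = "Q.colours" and ?B = "Q'.colours"
  let ?k = "inv_into (carrier ?A) g" and ?f = "\<lambda>u. snd (g (\<zero>\<^bsub>R\<^esub>, u))"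
  note D = algebra_isoD[OF g]
  have k: "restrict ?k (carrier ?B) \<in> algebra_iso R ?B ?A"
    by (rule inv_into_algebra_iso[OF g]; (rule Q.colour_closed Q'.colour_closed; assumption)?)
  have fwd: "fst (g (\<zero>\<^bsub>R\<^esub>, u)) = \<zero>\<^bsub>R\<^esub>" if "u \<in> carrier P" for u
    by (rule colour_iso_preserves_complement[OF g that])
  have bwd: "fst (?k (\<zero>\<^bsub>R\<^esub>, w)) = \<zero>\<^bsub>R\<^esub>" if "w \<in> carrier P'" for w
    using two_spaces.colour_iso_preserves_complement[OF swap k that] that by simp
  have bij: "bij_betw ?f (carrier P) (carrier P')"
    by (rule graded_iso_restricts[where X = "carrier R" and Y = "carrier R"])
      (use D(1) fwd bwd in simp_all)
  have g_eq: "g (\<zero>\<^bsub>R\<^esub>, u) = (\<zero>\<^bsub>R\<^esub>, ?f u)" if "u \<in> carrier P" for u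
    using fwd[OF that] by (metis prod.collapse)
  have fc: "?f u \<in> carrier P'" if "u \<in> carrier P" for u using bij that by (rule bij_betwE[rule_format])
  show ?thesis
  proof (intro vector_iso.intro vector_iso_axioms.intro two_spaces_axioms bij)
    fix u v assume c: "u \<in> carrier P" "v \<in> carrier P"
    show "?f (u \<oplus>\<^bsub>P\<^esub> v) = ?f u \<oplus>\<^bsub>P'\<^esub> ?f v"
      using D(3)[of "(\<zero>\<^bsub>R\<^esub>, u)" "(\<zero>\<^bsub>R\<^esub>, v)"] c by (simp add: case_prod_beta)
    define t where "t = \<ominus>\<^bsub>R\<^esub> (half R \<otimes>\<^bsub>R\<^esub> scalar_part R S (h u v \<oplus>\<^bsub>S\<^esub> h v u))"
    have t: "t \<in> carrier R" using c Q.half_R by (simp add: t_def)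
    have gt: "g (t, \<zero>\<^bsub>P\<^esub>) = (t, \<zero>\<^bsub>P'\<^esub>)"
      using D(4)[OF t, of "(\<one>\<^bsub>R\<^esub>, \<zero>\<^bsub>P\<^esub>)"] t colour_iso_one[OF g] by simp
    have "g (t, Q.cr u v) = (t, ?f (Q.cr u v))"
      using D(3)[of "(t, \<zero>\<^bsub>P\<^esub>)" "(\<zero>\<^bsub>R\<^esub>, Q.cr u v)"] c t gt fwd[of "Q.cr u v"] fc[of "Q.cr u v"] by (simp add: case_prod_beta)
    moreover have "(\<zero>\<^bsub>R\<^esub>, u) \<otimes>\<^bsub>?A\<^esub> (\<zero>\<^bsub>R\<^esub>, v) = (t, Q.cr u v)"
      using c Q.half_R by (simp add: t_def Q.R.minus_eq)
    then have "g (t, Q.cr u v) = (\<zero>\<^bsub>R\<^esub>, ?f u) \<otimes>\<^bsub>?B\<^esub> (\<zero>\<^bsub>R\<^esub>, ?f v)"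
      using D(5)[of "(\<zero>\<^bsub>R\<^esub>, u)" "(\<zero>\<^bsub>R\<^esub>, v)"] c g_eq[OF c(1)] g_eq[OF c(2)] by simp
    ultimately show "?f (Q.cr u v) = Q'.cr (?f u) (?f v)" using fc c by simp
  next
    fix r u assume c: "r \<in> carrier R" "u \<in> carrier P"
    show "?f (restrict_smult S P r u) = restrict_smult S' P' r (?f u)"
      using D(4)[OF c(1), of "(\<zero>\<^bsub>R\<^esub>, u)"] c by (simp add: case_prod_beta)
  qed
qed

lemma vector_iff_octonion:
  "isomorphic_algebras R Q.vectors Q'.vectors \<longleftrightarrow>
   isomorphic_pairs R (octonion_pair R (S, P, h, \<alpha>)) (octonion_pair R (S', P', h', \<alpha>'))"
proof
  assume "isomorphic_algebras R Q.vectors Q'.vectors"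
  then show "isomorphic_pairs R (octonion_pair R (S, P, h, \<alpha>)) (octonion_pair R (S', P', h', \<alpha>'))"
    unfolding isomorphic_algebras_def
    using vector_iso.octonion_pair_iso[OF vector_iso_of_algebra_iso] by blast
next
  assume "isomorphic_pairs R (octonion_pair R (S, P, h, \<alpha>)) (octonion_pair R (S', P', h', \<alpha>'))"
  then show "isomorphic_algebras R Q.vectors Q'.vectors"
    unfolding isomorphic_pairs_def octonion_pair.simps fst_conv snd_conv
    using vector_iso.vector_algebra_iso[OF vector_iso_of_octonion_iso] by blast
qed

lemma vector_iff_colour:
  "isomorphic_algebras R Q.vectors Q'.vectors \<longleftrightarrow>
   isomorphic_algebras R Q.colours Q'.colours"
proof
  assume "isomorphic_algebras R Q.vectors Q'.vectors"
  then obtain f where "f \<in> algebra_iso R Q.vectors Q'.vectors"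
    unfolding isomorphic_algebras_def by blast
  from vector_iso.colour_algebra_iso[OF vector_iso_of_algebra_iso[OF this]]
  show "isomorphic_algebras R Q.colours Q'.colours" .
next
  assume "isomorphic_algebras R Q.colours Q'.colours"
  then obtain g where "g \<in> algebra_iso R Q.colours Q'.colours"
    unfolding isomorphic_algebras_def by blast
  from vector_iso.vector_algebra_iso[OF vector_iso_of_colour_iso[OF this]]
  show "isomorphic_algebras R Q.vectors Q'.vectors" .
qed

end

section \<open>Bijections of isomorphism classes\<close>

text \<open>If two constructions identify the same parameters, each class on one side determines its parameters and
  thereby a class on the other side.\<close>
lemma classes_bijection:
  assumes iff: "\<And>q q'. q \<in> Q \<Longrightarrow> q' \<in> Q \<Longrightarrow> E (V q) (V q') \<longleftrightarrow> E' (C q) (C q')"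
  shows "\<exists>F. bij_betw F (iso_classes E (V ` Q)) (iso_classes E' (C ` Q)) \<and>
    (\<forall>q\<in>Q. F (iso_class E (V ` Q) (V q)) = iso_class E' (C ` Q) (C q))"
proof -
  define F where "F X = {C q | q. q \<in> Q \<and> V q \<in> X}" for X
  define G where "G X = {V q | q. q \<in> Q \<and> C q \<in> X}" for X
  have F: "F (iso_class E (V ` Q) (V q)) = iso_class E' (C ` Q) (C q)" if "q \<in> Q" for q
    using that iff[OF that] by (auto simp: F_def iso_class_def iso_rel_def)
  have G: "G (iso_class E' (C ` Q) (C q)) = iso_class E (V ` Q) (V q)" if "q \<in> Q" for q
    using that iff[OF that] by (auto simp: G_def iso_class_def iso_rel_def)
  have cls: "iso_classes E (V ` Q) = (\<lambda>q. iso_class E (V ` Q) (V q)) ` Q"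
    "iso_classes E' (C ` Q) = (\<lambda>q. iso_class E' (C ` Q) (C q)) ` Q"
    by (auto simp: iso_classes_def iso_class_def quotient_def)
  have "bij_betw F (iso_classes E (V ` Q)) (iso_classes E' (C ` Q))"
    by (rule bij_betwI[where g = G]) (auto simp: cls F G)
  then show ?thesis using F by blast
qed

theorem theorem3p4:
  fixes R :: "('r, 'm) ring_scheme"
    and Q :: "('r, 's, 'p) quadruple set"
  assumes "cring R"
    and "\<one>\<^bsub>R\<^esub> \<oplus>\<^bsub>R\<^esub> \<one>\<^bsub>R\<^esub> \<in> Units R"
    and "Q = quadruples R"
  shows
    "(\<exists>F. bij_betw F
            (iso_classes (isomorphic_algebras R) (vector_algebras R Q))
            (iso_classes (isomorphic_pairs R) (octonion_pairs R Q)) \<and>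
          (\<forall>q\<in>Q. F (iso_class (isomorphic_algebras R) (vector_algebras R Q) (vector_algebra R q)) =
                  iso_class (isomorphic_pairs R) (octonion_pairs R Q) (octonion_pair R q))) \<and>
     (\<exists>G. bij_betw G
            (iso_classes (isomorphic_algebras R) (vector_algebras R Q))
            (iso_classes (isomorphic_algebras R) (colour_algebras R Q)) \<and>
          (\<forall>q\<in>Q. G (iso_class (isomorphic_algebras R) (vector_algebras R Q) (vector_algebra R q)) =
                  iso_class (isomorphic_algebras R) (colour_algebras R Q) (colour_algebra R q)))"
proof -
  have two: "two_spaces R S P h \<alpha> S' P' h' \<alpha>'" if "(S, P, h, \<alpha>) \<in> Q" "(S', P', h', \<alpha>') \<in> Q"
    for S :: "('r, 's) invol_algebra" and P :: "('s, 'p) module" and h \<alpha>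
      and S' :: "('r, 's) invol_algebra" and P' :: "('s, 'p) module" and h' \<alpha>'
    using that assms by (simp add: two_spaces_def trivialised_space_def)
  have oct: "isomorphic_algebras R (vector_algebra R q) (vector_algebra R q') \<longleftrightarrow>
      isomorphic_pairs R (octonion_pair R q) (octonion_pair R q')" if "q \<in> Q" "q' \<in> Q" for q q'
    using two_spaces.vector_iff_octonion[OF two] that by (cases q; cases q') blast
  have col: "isomorphic_algebras R (vector_algebra R q) (vector_algebra R q') \<longleftrightarrow>
      isomorphic_algebras R (colour_algebra R q) (colour_algebra R q')" if "q \<in> Q" "q' \<in> Q" for q q'
    using two_spaces.vector_iff_colour[OF two] that by (cases q; cases q') blast
  show ?thesis
    unfolding vector_algebras_def octonion_pairs_def colour_algebras_def
    by (intro conjI classes_bijection oct col)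
qed

end
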